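(* Let $K$ be an algebraically closed field of characteristic zero, and for positive integers $d,r$ let $S_{d,r}\subset\mathbb{P}(K[u,v]_d)$ be the set of (classes of) binary forms of degree $d$ and Waring rank exactly $r$. Let $d$ be a positive integer and $k\ge 0$ an integer such that $d-k>\left\lceil\frac{d+1}{2}\right\rceil$. Then the singular locus of the projective variety $\overline{S_{d,d-k}}$ contains the subvariety $$\overline{S_{d,k+1}}\cup\overline{S_{d,d-k+1}},$$ where the bar denotes Zariski closure in $\mathbb{P}(K[u,v]_d)$.
   Context: $K[u,v]_d$ is the vector space of binary forms of degree $d$ over $K$, and $\mathbb{P}(K[u,v]_d)\cong\mathbb{P}^d$. The Waring rank of a nonzero form $f\in K[u,v]_d$ is the smallest integer $r$ such that $f=l_1^d+\dots+l_r^d$ for some linear forms $l_1,\dots,l_r\in K[u,v]_1$. It depends only on the class of $f$ up to nonzero scalars. By convention $\overline{S_{d,d+1}}=\emptyset$ (no binary form of degree $d$ has rank $d+1$). Zariski closures are regarded as reduced closed subvarieties of $\mathbb{P}(K[u,v]_d)$. *)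

theory Defs
  imports
    "HOL-Library.Poly_Mapping"
    "HOL-Library.Extended_Nat"
    "HOL-Computational_Algebra.Polynomial"
    "HOL-Analysis.Abstract_Topology"
begin

hide_const (open) Poly_Mapping.degree Poly_Mapping.map Poly_Mapping.nth
  Poly_Mapping.update Poly_Mapping.range

section \<open>Polynomials in variables indexed by the natural numbers\<close>

text \<open>An exponent vector is a finitely supported function from variable indices to exponents;
  a polynomial is a finitely supported function from exponent vectors to coefficients.
  Multiplication of such functions is convolution.\<close>

type_synonym 'a mpoly = "(nat \<Rightarrow>\<^sub>0 nat) \<Rightarrow>\<^sub>0 'a"

definition hom_polys :: "nat \<Rightarrow> nat \<Rightarrow> 'a::zero mpoly set" where
  \<comment> \<open>\<open>K[x\<^sub>0,\<dots>,x\<^sub>n]\<^sub>e\<close>, the zero polynomial included\<close>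
  "hom_polys n e =
     {F. \<forall>m\<in>Poly_Mapping.keys F. Poly_Mapping.keys m \<subseteq> {..n} \<and>
           (\<Sum>i\<in>Poly_Mapping.keys m. Poly_Mapping.lookup m i) = e}"

definition eval_monom :: "(nat \<Rightarrow>\<^sub>0 nat) \<Rightarrow> (nat \<Rightarrow> 'a::comm_semiring_1) \<Rightarrow> 'a" where
  "eval_monom m x = (\<Prod>i\<in>Poly_Mapping.keys m. x i ^ Poly_Mapping.lookup m i)"

definition eval_poly :: "'a::comm_semiring_1 mpoly \<Rightarrow> (nat \<Rightarrow> 'a) \<Rightarrow> 'a" where
  "eval_poly F x = (\<Sum>m\<in>Poly_Mapping.keys F. Poly_Mapping.lookup F m * eval_monom m x)"

definition partial_deriv :: "nat \<Rightarrow> 'a::comm_semiring_1 mpoly \<Rightarrow> 'a mpoly" where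
  \<comment> \<open>exponent subtraction is truncated, but then the coefficient vanishes\<close>
  "partial_deriv i F =
     (\<Sum>m\<in>Poly_Mapping.keys F.
        Poly_Mapping.single (m - Poly_Mapping.single i 1)
          (of_nat (Poly_Mapping.lookup m i) * Poly_Mapping.lookup F m))"

definition scale_poly :: "'a::comm_semiring_1 \<Rightarrow> 'a mpoly \<Rightarrow> 'a mpoly" where
  "scale_poly c F = Poly_Mapping.single 0 c * F"

global_interpretation mpoly: vector_space "scale_poly :: 'a::field \<Rightarrow> 'a mpoly \<Rightarrow> 'a mpoly"
  by unfold_locales
     (simp_all add: scale_poly_def algebra_simps single_add mult_single flip: mult.assoc)

section \<open>Binary forms and their projective space\<close>

text \<open>The variables \<open>u\<close>, \<open>v\<close> are the variables with indices \<open>0\<close>, \<open>1\<close>.\<close>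

abbreviation binary_forms :: "nat \<Rightarrow> 'a::zero mpoly set" where
  "binary_forms d \<equiv> hom_polys 1 d"

definition waring_rank :: "nat \<Rightarrow> 'a::comm_semiring_1 mpoly \<Rightarrow> nat" where
  "waring_rank d f =
     (LEAST r. \<exists>l :: nat \<Rightarrow> 'a mpoly. (\<forall>i<r. l i \<in> binary_forms 1) \<and> f = (\<Sum>i<r. l i ^ d))"

text \<open>A point of the projective space is the set of all its representatives.\<close>

type_synonym 'a form_point = "'a mpoly set"

definition form_class :: "'a::field mpoly \<Rightarrow> 'a form_point" where
  "form_class f = {scale_poly c f | c. c \<noteq> 0}"

definition proj_forms :: "nat \<Rightarrow> 'a::field form_point set" where
  "proj_forms d = form_class ` (binary_forms d - {0})"

definition rank_locus :: "nat \<Rightarrow> nat \<Rightarrow> 'a::field form_point set" where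
  "rank_locus d r = form_class ` {f \<in> binary_forms d - {0}. waring_rank d f = r}"

section \<open>The Zariski topology on the space of binary forms\<close>

text \<open>The homogeneous coordinates on the space of forms of degree \<open>d\<close> are the coefficients of
  the monomials \<open>u\<^bsup>d-i\<^esup>v\<^bsup>i\<^esup>\<close> for \<open>i = 0, \<dots>, d\<close>; the homogeneous coordinate ring is the
  polynomial ring in the variables with indices \<open>0, \<dots>, d\<close>.\<close>

definition form_coords :: "nat \<Rightarrow> 'a::zero mpoly \<Rightarrow> nat \<Rightarrow> 'a" where
  "form_coords d f i =
     Poly_Mapping.lookup f (Poly_Mapping.single 0 (d - i) + Poly_Mapping.single 1 i)"

definition vanishes_at :: "nat \<Rightarrow> 'a::field mpoly \<Rightarrow> 'a form_point \<Rightarrow> bool" where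
  "vanishes_at d F p \<longleftrightarrow> (\<forall>f\<in>p. eval_poly F (form_coords d f) = 0)"

definition zero_locus :: "nat \<Rightarrow> 'a::field mpoly set \<Rightarrow> 'a form_point set" where
  "zero_locus d T = {p \<in> proj_forms d. \<forall>F\<in>T. vanishes_at d F p}"

definition zariski :: "nat \<Rightarrow> 'a::field form_point topology" where
  "zariski d =
     topology (\<lambda>U. \<exists>T \<subseteq> (\<Union>e. hom_polys d e). U = proj_forms d - zero_locus d T)"

definition hom_ideal :: "nat \<Rightarrow> 'a::field form_point set \<Rightarrow> 'a mpoly set" where
  \<comment> \<open>the homogeneous elements of the vanishing ideal\<close>
  "hom_ideal d X = {F \<in> (\<Union>e. hom_polys d e). \<forall>p\<in>X. vanishes_at d F p}"

section \<open>Local dimension, tangent spaces and the singular locus\<close>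

definition irreducible_closedin :: "'b topology \<Rightarrow> 'b set \<Rightarrow> bool" where
  "irreducible_closedin T Z \<longleftrightarrow> closedin T Z \<and> Z \<noteq> {} \<and>
     (\<forall>A B. closedin T A \<and> closedin T B \<and> Z = A \<union> B \<longrightarrow> Z = A \<or> Z = B)"

text \<open>The Krull dimension of the local ring of a closed set \<open>X\<close> at \<open>p\<close>: the prime ideals of
  this ring correspond to the irreducible closed subsets of \<open>X\<close> through \<open>p\<close>.\<close>

definition local_dim :: "'b topology \<Rightarrow> 'b set \<Rightarrow> 'b \<Rightarrow> enat" where
  "local_dim T X p =
     Sup {enat n | n. \<exists>Z :: nat \<Rightarrow> 'b set.
            (\<forall>i\<le>n. irreducible_closedin T (Z i) \<and> p \<in> Z i \<and> Z i \<subseteq> X) \<and>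
            (\<forall>i<n. Z i \<subset> Z (Suc i))}"

text \<open>The tangent space at \<open>p\<close> of the affine cone over \<open>X\<close>. It contains the line \<open>p\<close>, and its
  quotient by this line is the Zariski tangent space of \<open>X\<close> at \<open>p\<close> (up to a twist by that line),
  so its dimension exceeds the dimension of the Zariski tangent space by one.\<close>

definition cone_tangent :: "nat \<Rightarrow> 'a::field form_point set \<Rightarrow> 'a form_point \<Rightarrow> 'a mpoly set" where
  "cone_tangent d X p =
     {w \<in> binary_forms d. \<forall>F\<in>hom_ideal d X. \<forall>f\<in>p.
        (\<Sum>i\<le>d. eval_poly (partial_deriv i F) (form_coords d f) * form_coords d w i) = 0}"

definition singular_locus :: "nat \<Rightarrow> 'a::field form_point set \<Rightarrow> 'a form_point set" where
  \<comment> \<open>\<open>dim T\<^sub>pX > dim \<O>\<^sub>X\<^sub>,\<^sub>p\<close>, with both sides increased by one\<close>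
  "singular_locus d X =
     {p \<in> X. enat (mpoly.dim (cone_tangent d X p)) > local_dim (zariski d) X p + 1}"

section \<open>The closed sets are the zero loci\<close>

lemma eval_monom_mono:
  assumes "finite A" "Poly_Mapping.keys m \<subseteq> A"
  shows "eval_monom m x = (\<Prod>i\<in>A. x i ^ Poly_Mapping.lookup m i)"
  unfolding eval_monom_def
  by (rule prod.mono_neutral_left) (use assms in \<open>auto simp: in_keys_iff\<close>)

lemma eval_monom_add: "eval_monom (m + n) x = eval_monom m x * eval_monom n x"
proof -
  let ?A = "Poly_Mapping.keys m \<union> Poly_Mapping.keys n"
  have "eval_monom (m + n) x = (\<Prod>i\<in>?A. x i ^ Poly_Mapping.lookup (m + n) i)"
    by (rule eval_monom_mono) (use Poly_Mapping.keys_add[of m n] in auto)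
  moreover have "eval_monom m x = (\<Prod>i\<in>?A. x i ^ Poly_Mapping.lookup m i)"
    "eval_monom n x = (\<Prod>i\<in>?A. x i ^ Poly_Mapping.lookup n i)"
    by (rule eval_monom_mono; auto)+
  ultimately show ?thesis
    by (simp add: lookup_add power_add prod.distrib)
qed

lemma eval_poly_mono:
  assumes "finite A" "Poly_Mapping.keys F \<subseteq> A"
  shows "eval_poly F x = (\<Sum>m\<in>A. Poly_Mapping.lookup F m * eval_monom m x)"
  unfolding eval_poly_def
  by (rule sum.mono_neutral_left) (use assms in \<open>auto simp: in_keys_iff\<close>)

lemma eval_poly_zero [simp]: "eval_poly 0 x = 0"
  by (simp add: eval_poly_def)

lemma eval_poly_one [simp]: "eval_poly 1 x = 1"
  by (simp add: eval_poly_def eval_monom_def)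

lemma eval_poly_single [simp]: "eval_poly (Poly_Mapping.single m c) x = c * eval_monom m x"
  by (simp add: eval_poly_def)

lemma eval_poly_add: "eval_poly (F + G) x = eval_poly F x + eval_poly G x"
proof -
  let ?A = "Poly_Mapping.keys F \<union> Poly_Mapping.keys G"
  have "eval_poly (F + G) x = (\<Sum>m\<in>?A. Poly_Mapping.lookup (F + G) m * eval_monom m x)"
    by (rule eval_poly_mono) (use Poly_Mapping.keys_add[of F G] in auto)
  moreover have "eval_poly F x = (\<Sum>m\<in>?A. Poly_Mapping.lookup F m * eval_monom m x)"
    "eval_poly G x = (\<Sum>m\<in>?A. Poly_Mapping.lookup G m * eval_monom m x)"
    by (rule eval_poly_mono; auto)+
  ultimately show ?thesis
    by (simp add: lookup_add algebra_simps sum.distrib)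
qed

lemma eval_poly_sum: "eval_poly (\<Sum>i\<in>A. F i) x = (\<Sum>i\<in>A. eval_poly (F i) x)"
  by (induction A rule: infinite_finite_induct) (auto simp: eval_poly_add)

lemma poly_as_sum:
  "F = (\<Sum>m\<in>Poly_Mapping.keys F. Poly_Mapping.single m (Poly_Mapping.lookup F m))"
  by (rule poly_mapping_eqI) (auto simp: lookup_sum lookup_single when_def in_keys_iff)

lemma eval_poly_mult: "eval_poly (F * G) x = eval_poly F x * eval_poly G x"
proof -
  have "F * G = (\<Sum>m\<in>Poly_Mapping.keys F. \<Sum>n\<in>Poly_Mapping.keys G.
      Poly_Mapping.single (m + n) (Poly_Mapping.lookup F m * Poly_Mapping.lookup G n))"
    using arg_cong2[OF poly_as_sum[of F] poly_as_sum[of G], of "(*)"]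
    by (simp only: sum_product mult_single)
  then show ?thesis
    by (simp add: eval_poly_sum eval_monom_add)
       (simp add: eval_poly_def sum_product algebra_simps)
qed

lemma hom_polys_mult:
  assumes "F \<in> hom_polys n a" "G \<in> hom_polys n b"
  shows "F * G \<in> hom_polys n (a + b)"
proof -
  have *: "(\<Sum>i\<in>Poly_Mapping.keys m. Poly_Mapping.lookup m i) = (\<Sum>i\<le>n. Poly_Mapping.lookup m i)"
    if "Poly_Mapping.keys m \<subseteq> {..n}" for m :: "nat \<Rightarrow>\<^sub>0 nat"
    by (rule sum.mono_neutral_left) (use that in \<open>auto simp: in_keys_iff\<close>)
  show ?thesis
    unfolding hom_polys_def
  proof safe
    fix m assume "m \<in> Poly_Mapping.keys (F * G)"
    then obtain p q where pq: "m = p + q" "p \<in> Poly_Mapping.keys F" "q \<in> Poly_Mapping.keys G"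
      using keys_mult[of F G] by auto
    have p: "Poly_Mapping.keys p \<subseteq> {..n}" "(\<Sum>i\<le>n. Poly_Mapping.lookup p i) = a"
      using assms(1) pq(2) * unfolding hom_polys_def by auto
    have q: "Poly_Mapping.keys q \<subseteq> {..n}" "(\<Sum>i\<le>n. Poly_Mapping.lookup q i) = b"
      using assms(2) pq(3) * unfolding hom_polys_def by auto
    have m: "Poly_Mapping.keys m \<subseteq> {..n}"
      using Poly_Mapping.keys_add[of p q] p q pq(1) by auto
    then show "x \<le> n" if "x \<in> Poly_Mapping.keys m" for x
      using that by auto
    show "(\<Sum>i\<in>Poly_Mapping.keys m. Poly_Mapping.lookup m i) = a + b"
      unfolding *[OF m] using p q pq(1) by (simp add: lookup_add sum.distrib)
  qed
qed

lemma form_coords_scale: "form_coords d (scale_poly c f) i = c * form_coords d f i"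
  by (simp add: form_coords_def scale_poly_def flip: mult_map_scale_conv_mult)
     (simp add: Poly_Mapping.map.rep_eq when_def)

lemma eval_poly_scale:
  assumes "F \<in> hom_polys n e"
  shows "eval_poly F (\<lambda>i. c * x i) = c ^ e * eval_poly F x"
proof -
  have "eval_monom m (\<lambda>i. c * x i) = c ^ e * eval_monom m x" if "m \<in> Poly_Mapping.keys F" for m
    using assms that
    by (auto simp: hom_polys_def eval_monom_def power_mult_distrib prod.distrib simp flip: power_sum)
  then show ?thesis
    by (simp add: eval_poly_def sum_distrib_left algebra_simps cong: sum.cong)
qed

lemma vanishes_at_class:
  assumes "F \<in> hom_polys n e"
  shows "vanishes_at d F (form_class f) \<longleftrightarrow> eval_poly F (form_coords d f) = 0"
proof -
  have "eval_poly F (form_coords d (scale_poly c f)) = c ^ e * eval_poly F (form_coords d f)" for c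
    using eval_poly_scale[OF assms, of c "form_coords d f"]
    by (simp add: form_coords_scale[abs_def])
  then show ?thesis
    by (auto simp: vanishes_at_def form_class_def intro: exI[of _ 1])
qed

lemma zero_locus_Un:
  assumes "S \<subseteq> (\<Union>e. hom_polys d e)" "T \<subseteq> (\<Union>e. hom_polys d e)"
  shows "zero_locus d S \<union> zero_locus d T = zero_locus d {F * G | F G. F \<in> S \<and> G \<in> T}"
proof -
  have *: "vanishes_at d (F * G) p \<longleftrightarrow> vanishes_at d F p \<or> vanishes_at d G p"
    if FG: "F \<in> S" "G \<in> T" and p: "p \<in> proj_forms d" for F G p
  proof -
    obtain a b where ab: "F \<in> hom_polys d a" "G \<in> hom_polys d b"
      using FG assms by blast
    obtain f where "p = form_class f"
      using p by (auto simp: proj_forms_def)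
    then show ?thesis
      using vanishes_at_class[OF ab(1)] vanishes_at_class[OF ab(2)]
        vanishes_at_class[OF hom_polys_mult[OF ab]]
      by (simp add: eval_poly_mult)
  qed
  show ?thesis
  proof (rule set_eqI)
    fix p
    have "p \<in> zero_locus d {F * G | F G. F \<in> S \<and> G \<in> T} \<longleftrightarrow>
        p \<in> proj_forms d \<and> (\<forall>F\<in>S. \<forall>G\<in>T. vanishes_at d (F * G) p)"
      unfolding zero_locus_def by blast
    also have "\<dots> \<longleftrightarrow> p \<in> proj_forms d \<and>
        (\<forall>F\<in>S. \<forall>G\<in>T. vanishes_at d F p \<or> vanishes_at d G p)"
      using * by meson
    also have "\<dots> \<longleftrightarrow> p \<in> zero_locus d S \<union> zero_locus d T"
      unfolding zero_locus_def by blast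
    finally show "p \<in> zero_locus d S \<union> zero_locus d T \<longleftrightarrow>
        p \<in> zero_locus d {F * G | F G. F \<in> S \<and> G \<in> T}" by (rule sym)
  qed
qed

lemma istopology_zariski:
  "istopology (\<lambda>U :: 'a::field form_point set.
     \<exists>T \<subseteq> (\<Union>e. hom_polys d e). U = proj_forms d - zero_locus d T)"
    (is "istopology ?open")
proof -
  have Int: "?open (U \<inter> V)" if U: "?open U" and V: "?open V" for U V
  proof -
    obtain S where S: "S \<subseteq> (\<Union>e. hom_polys d e)" "U = proj_forms d - zero_locus d S"
      using U by (elim exE conjE)
    obtain T where T: "T \<subseteq> (\<Union>e. hom_polys d e)" "V = proj_forms d - zero_locus d T"
      using V by (elim exE conjE)
    let ?R = "{F * G | F G. F \<in> S \<and> G \<in> T}"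
    have "?R \<subseteq> (\<Union>e. hom_polys d e)"
    proof
      fix H assume "H \<in> ?R"
      then obtain F G where H: "H = F * G" and "F \<in> S" "G \<in> T"
        by blast
      then obtain a b where "F \<in> hom_polys d a" "G \<in> hom_polys d b"
        using S(1) T(1) by blast
      then have "H \<in> hom_polys d (a + b)"
        unfolding H by (rule hom_polys_mult)
      then show "H \<in> (\<Union>e. hom_polys d e)"
        by (rule UN_I[OF UNIV_I])
    qed
    moreover have "U \<inter> V = proj_forms d - zero_locus d ?R"
      unfolding zero_locus_Un[OF S(1) T(1), symmetric] S(2) T(2) by (rule Diff_Un[symmetric])
    ultimately show ?thesis
      by (intro exI[of _ ?R] conjI)
  qed
  have Union: "?open (\<Union>\<U>)" if \<U>: "\<And>U. U \<in> \<U> \<Longrightarrow> ?open U" for \<U>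
  proof -
    have "\<forall>U\<in>\<U>. ?open U"
      using \<U> by (rule ballI)
    then obtain T where T: "\<forall>U\<in>\<U>. T U \<subseteq> (\<Union>e. hom_polys d e) \<and> U = proj_forms d - zero_locus d (T U)"
      unfolding bchoice_iff by (rule exE)
    have "p \<in> \<Union>\<U> \<longleftrightarrow> p \<in> proj_forms d - zero_locus d (\<Union>U\<in>\<U>. T U)" for p
    proof -
      have "p \<in> \<Union>\<U> \<longleftrightarrow> (\<exists>U\<in>\<U>. p \<in> U)"
        by (rule Union_iff)
      also have "\<dots> \<longleftrightarrow> (\<exists>U\<in>\<U>. p \<in> proj_forms d - zero_locus d (T U))"
        by (rule bex_cong[OF refl]) (metis T)
      also have "\<dots> \<longleftrightarrow> p \<in> proj_forms d - zero_locus d (\<Union>U\<in>\<U>. T U)"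
        by (auto simp: zero_locus_def)
      finally show ?thesis .
    qed
    then have "\<Union>\<U> = proj_forms d - zero_locus d (\<Union>U\<in>\<U>. T U)"
      by (rule set_eqI)
    moreover have "(\<Union>U\<in>\<U>. T U) \<subseteq> (\<Union>e. hom_polys d e)"
      using T by (intro UN_least) blast
    ultimately show ?thesis
      by (intro exI[of _ "\<Union>U\<in>\<U>. T U"] conjI)
  qed
  show ?thesis
    unfolding istopology_def
    by (intro conjI allI impI, rule Int, assumption, assumption, rule Union, erule bspec, assumption)
qed

lemma openin_zariski:
  "openin (zariski d) U \<longleftrightarrow>
     (\<exists>T \<subseteq> (\<Union>e. hom_polys d e). U = proj_forms d - zero_locus d T)"
  unfolding zariski_def topology_inverse'[OF istopology_zariski] ..

lemma topspace_zariski: "topspace (zariski d) = (proj_forms d :: 'a::field form_point set)"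
proof -
  have one: "(1 :: 'a mpoly) \<in> hom_polys d 0"
    by (simp add: hom_polys_def)
  have "zero_locus d {1 :: 'a mpoly} = {}"
    by (auto simp: zero_locus_def proj_forms_def vanishes_at_class[OF one])
  then have "openin (zariski d) (proj_forms d :: 'a form_point set)"
    unfolding openin_zariski using one by (intro exI[of _ "{1}"]) auto
  moreover have "topspace (zariski d) \<subseteq> (proj_forms d :: 'a form_point set)"
    unfolding topspace_def openin_zariski by blast
  ultimately show ?thesis
    using openin_subset by blast
qed

lemma closedin_zariski:
  "closedin (zariski d) Z \<longleftrightarrow> (\<exists>T \<subseteq> (\<Union>e. hom_polys d e). Z = zero_locus d T)"
proof -
  have "zero_locus d T \<subseteq> proj_forms d" for T :: "'a mpoly set"
    by (auto simp: zero_locus_def)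
  then show ?thesis
    unfolding closedin_def topspace_zariski openin_zariski
    by (metis Diff_subset double_diff order_refl)
qed

end

theory Submission
  imports Defs "Jordan_Normal_Form.Determinant"
begin

hide_const (open) Poly_Mapping.degree Poly_Mapping.map Poly_Mapping.nth
  Poly_Mapping.update Poly_Mapping.range
hide_const (open) module.smult

text \<open>
  A form of degree \<open>d\<close> is a linear functional on the polynomials of degree at most \<open>d\<close>, powers of
  linear forms being evaluations. By Sylvester's theorem a form of rank \<open>d - k\<close> is annihilated by a
  polynomial of degree \<open>k + 2\<close> with a double root, and conversely the functionals
  \<open>q \<mapsto> \<alpha> q(x\<^sub>0) + \<beta> q'(x\<^sub>0) + \<Sum>\<^sub>i c\<^sub>i q(x\<^sub>i)\<close> with \<open>k\<close> evaluations and \<open>\<beta>, c\<^sub>i \<noteq> 0\<close> have rank \<open>d - k\<close>. The first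
  statement parametrizes the locus by the linear recurrences with such characteristic polynomials,
  so its local dimensions are at most \<open>2k + 2\<close>. At a sum of \<open>k + 1\<close> powers, the second one puts
  into the tangent space of the cone the evaluations and first derivatives at the \<open>k + 1\<close> points, and,
  through the cuspidal curve \<open>q(x + t) - t q'(x + t)\<close>, also the second and third derivatives at one
  of them: \<open>2k + 4\<close> independent vectors, one more than a smooth point allows. Tangent dimensions
  are semicontinuous, so this persists on the closure. Finally, a form of rank \<open>d - k + 1\<close> is
  annihilated by a polynomial of degree \<open>k + 1\<close> and hence is a limit of sums of \<open>k + 1\<close> powers.
\<close>

text \<open>Only an upper bound for the local dimension is needed, and chains of irreducible closed
  sets are bounded by growth: a chain of length \<open>n\<close> through a point forces the
  functions of degree \<open>e\<close> to grow like \<open>e^n\<close>, while the parametrization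
  leaves at most a constant times \<open>(e + 1)^(2 * k + 2)\<close> of them. An annihilator may
  have a root at infinity, visible as a drop of its degree. Its degree is therefore made exact by
  one of \<open>d + 1\<close> fixed changes of coordinates; since their number does not depend on
  \<open>e\<close>, the growth exponent is unaffected. Every limit is taken along a polynomial
  curve: a form restricted to it is a polynomial in one variable, zero as soon as it has cofinitely
  many zeros, so its values at excluded parameters and its coefficients can be read off. The
  hypothesis on \<open>d\<close> and \<open>k\<close> amounts to \<open>2 * k + 3 \<le> d\<close>,
  exactly the room that \<open>2 * k + 4\<close> independent vectors require in dimension
  \<open>d + 1\<close>.\<close>

abbreviation (input) lookup :: "('b \<Rightarrow>\<^sub>0 'a::zero) \<Rightarrow> 'b \<Rightarrow> 'a" where "lookup \<equiv> Poly_Mapping.lookup"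

abbreviation (input) keys :: "('b \<Rightarrow>\<^sub>0 'a::zero) \<Rightarrow> 'b set" where "keys \<equiv> Poly_Mapping.keys"

section \<open>Linear systems and homogeneous polynomials\<close>

text \<open>Invertibility of the leading \<open>n\<close> by \<open>n\<close> block, phrased for
  plain functions so that matrices and determinants stay inside this section.\<close>

definition trivial_kernel :: "nat \<Rightarrow> (nat \<Rightarrow> nat \<Rightarrow> 'a::comm_ring_1) \<Rightarrow> bool" where
  "trivial_kernel n A \<longleftrightarrow>
     (\<forall>w. (\<forall>i<n. (\<Sum>j<n. A i j * w j) = 0) \<longrightarrow> (\<forall>j<n. w j = 0))"

lemma trivial_kernel_iff_det:
  fixes A :: "nat \<Rightarrow> nat \<Rightarrow> 'a::field"
  shows "trivial_kernel n A \<longleftrightarrow> det (mat n n (\<lambda>(i, j). A i j)) \<noteq> 0"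
proof -
  let ?M = "mat n n (\<lambda>(i, j). A i j)"
  have M: "?M \<in> carrier_mat n n" by simp
  have "det ?M = 0 \<longleftrightarrow> (\<exists>v. v \<in> carrier_vec n \<and> v \<noteq> 0\<^sub>v n \<and> ?M *\<^sub>v v = 0\<^sub>v n)"
    by (rule det_0_iff_vec_prod_zero_field[OF M])
  also have "\<dots> \<longleftrightarrow> \<not> trivial_kernel n A"
  proof
    assume "\<exists>v. v \<in> carrier_vec n \<and> v \<noteq> 0\<^sub>v n \<and> ?M *\<^sub>v v = 0\<^sub>v n"
    then obtain v where v: "v \<in> carrier_vec n" "v \<noteq> 0\<^sub>v n" "?M *\<^sub>v v = 0\<^sub>v n" by blast
    have "(\<Sum>j<n. A i j * v $ j) = 0" if "i < n" for i
    proof -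
      have "(?M *\<^sub>v v) $ i = 0" using that v(3) by simp
      then show ?thesis using that v(1) by (simp add: scalar_prod_def atLeast0LessThan)
    qed
    moreover have "\<exists>j<n. v $ j \<noteq> 0" using v(1,2) by (metis carrier_vecD eq_vecI index_zero_vec)
    ultimately show "\<not> trivial_kernel n A" unfolding trivial_kernel_def by blast
  next
    assume "\<not> trivial_kernel n A"
    then obtain w j where w: "\<And>i. i < n \<Longrightarrow> (\<Sum>j<n. A i j * w j) = 0" "j < n" "w j \<noteq> 0"
      unfolding trivial_kernel_def by blast
    have "vec n w \<noteq> 0\<^sub>v n" using w(2,3) by (metis index_vec index_zero_vec(1))
    moreover have "?M *\<^sub>v vec n w = 0\<^sub>v n"
      using w(1) by (intro eq_vecI) (auto simp: scalar_prod_def atLeast0LessThan)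
    ultimately show "\<exists>v. v \<in> carrier_vec n \<and> v \<noteq> 0\<^sub>v n \<and> ?M *\<^sub>v v = 0\<^sub>v n"
      by (intro exI[of _ "vec n w"]) auto
  qed
  finally show ?thesis by blast
qed

lemma trivial_kernel_solvable:
  fixes A :: "nat \<Rightarrow> nat \<Rightarrow> 'a::field"
  assumes "trivial_kernel n A"
  shows "\<exists>x. \<forall>i<n. (\<Sum>j<n. A i j * x j) = y i"
proof -
  let ?M = "mat n n (\<lambda>(i, j). A i j)"
  have M: "?M \<in> carrier_mat n n" by simp
  have "det ?M \<noteq> 0" using assms trivial_kernel_iff_det by blast
  then obtain B where B: "B \<in> carrier_mat n n" "?M * B = 1\<^sub>m n"
    using det_non_zero_imp_unit[OF M] unfolding Units_def by (auto simp: ring_mat_def)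
  define x where "x = B *\<^sub>v vec n y"
  have x: "x \<in> carrier_vec n" using B by (simp add: x_def)
  have "?M *\<^sub>v x = vec n y"
    using assoc_mult_mat_vec[OF M B(1) vec_carrier[of n y]] B(2) by (simp add: x_def)
  have "(\<Sum>j<n. A i j * x $ j) = y i" if "i < n" for i
  proof -
    have "(?M *\<^sub>v x) $ i = y i" using that \<open>?M *\<^sub>v x = vec n y\<close> by simp
    then show ?thesis using that x by (simp add: scalar_prod_def atLeast0LessThan)
  qed
  then show ?thesis by blast
qed

text \<open>Zero rows make the system square. With only the trivial solution it would be solvable
  for the constant right-hand side 1, which a zero row forbids.\<close>

lemma underdetermined_nontrivial:
  fixes A :: "'i \<Rightarrow> nat \<Rightarrow> 'a::field"
  assumes "finite I" "card I < n"
  shows "\<exists>x. (\<forall>i\<in>I. (\<Sum>j<n. A i j * x j) = 0) \<and> (\<exists>j<n. x j \<noteq> 0)"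
proof (rule ccontr)
  assume neg: "\<nexists>x. (\<forall>i\<in>I. (\<Sum>j<n. A i j * x j) = 0) \<and> (\<exists>j<n. x j \<noteq> 0)"
  obtain h where h: "bij_betw h {..<card I} I"
    using ex_bij_betw_nat_finite[OF assms(1)] by (auto simp: atLeast0LessThan)
  define B where "B i j = (if i < card I then A (h i) j else 0)" for i j
  have "trivial_kernel n B"
    unfolding trivial_kernel_def
  proof (intro allI impI)
    fix w j assume w: "\<forall>i<n. (\<Sum>j<n. B i j * w j) = 0" "j < n"
    have "(\<Sum>j<n. A i j * w j) = 0" if "i \<in> I" for i
    proof -
      have "i \<in> h ` {..<card I}" using h \<open>i \<in> I\<close> by (simp add: bij_betw_def)
      then obtain l where l: "l < card I" "h l = i" by auto
      then show ?thesis using w(1)[rule_format, of l] assms(2) by (simp add: B_def)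
    qed
    then show "w j = 0" using neg w(2) by blast
  qed
  then obtain x where "\<forall>i<n. (\<Sum>j<n. B i j * x j) = 1"
    using trivial_kernel_solvable[of n B "\<lambda>_. 1"] by blast
  then show False using assms(2) by (auto simp: B_def dest!: spec[of _ "card I"])
qed

section \<open>Homogeneous polynomials\<close>

lemma hom_polys_0 [simp]: "0 \<in> hom_polys n e"
  by (simp add: hom_polys_def)

lemma hom_polys_add: "F \<in> hom_polys n e \<Longrightarrow> G \<in> hom_polys n e \<Longrightarrow> F + G \<in> hom_polys n e"
  using Poly_Mapping.keys_add[of F G] unfolding hom_polys_def by blast

lemma hom_polys_sum: "(\<And>i. i \<in> A \<Longrightarrow> F i \<in> hom_polys n e) \<Longrightarrow> sum F A \<in> hom_polys n e"
  by (induction A rule: infinite_finite_induct) (auto intro: hom_polys_add)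

lemma hom_polys_const: "Poly_Mapping.single 0 c \<in> hom_polys n 0"
  by (simp add: hom_polys_def)

lemma hom_polys_one: "1 \<in> hom_polys n 0"
  by (simp add: hom_polys_def)

lemma hom_polys_scale: "F \<in> hom_polys n e \<Longrightarrow> scale_poly c F \<in> hom_polys n e"
  using hom_polys_mult[OF hom_polys_const, of F n e c] by (simp add: scale_poly_def)

lemma hom_polys_prod:
  "(\<And>i. i \<in> A \<Longrightarrow> F i \<in> hom_polys n (e i)) \<Longrightarrow> prod F A \<in> hom_polys n (sum e A)"
  by (induction A rule: infinite_finite_induct) (auto intro: hom_polys_mult simp: hom_polys_one)

lemma hom_polys_power: "F \<in> hom_polys n e \<Longrightarrow> F ^ j \<in> hom_polys n (j * e)"
  by (induction j) (auto intro: hom_polys_mult simp: hom_polys_one)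

lemma eval_poly_scale_poly [simp]: "eval_poly (scale_poly c F) x = c * eval_poly F x"
  by (simp add: scale_poly_def eval_poly_mult eval_monom_def)

interpretation eval: comm_ring_hom "\<lambda>F. eval_poly F (x :: nat \<Rightarrow> 'a::comm_ring_1)"
  by unfold_locales (simp_all add: eval_poly_add eval_poly_mult)

text \<open>Homogeneity in each row is what makes the determinant homogeneous.\<close>

lemma hom_det_poly:
  fixes A :: "nat \<Rightarrow> nat \<Rightarrow> 'a::field mpoly"
  assumes "\<And>i j. i < n \<Longrightarrow> j < n \<Longrightarrow> A i j \<in> hom_polys d (e i)"
  shows "\<exists>D\<in>hom_polys d (\<Sum>i<n. e i). \<forall>x. eval_poly D x \<noteq> 0 \<longleftrightarrow>
            trivial_kernel n (\<lambda>i j. eval_poly (A i j) x)"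
proof -
  let ?M = "mat n n (\<lambda>(i, j). A i j)"
  have "det ?M \<in> hom_polys d (\<Sum>i<n. e i)"
  proof -
    have "signof p * (\<Prod>i = 0..<n. ?M $$ (i, p i)) \<in> hom_polys d (\<Sum>i<n. e i)"
      if p: "p permutes {0..<n}" for p
    proof -
      have "(\<Prod>i = 0..<n. ?M $$ (i, p i)) \<in> hom_polys d (\<Sum>i\<in>{0..<n}. e i)"
      proof (rule hom_polys_prod)
        fix i assume "i \<in> {0..<n}"
        moreover from this have "p i < n" using p permutes_in_image[of p "{0..<n}" i] by auto
        ultimately show "?M $$ (i, p i) \<in> hom_polys d (e i)" using assms by auto
      qed
      moreover have "(signof p :: 'a mpoly) \<in> hom_polys d 0"
        using hom_polys_const[of "-1 :: 'a" d] hom_polys_one[of d, where 'a = 'a]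
        by (simp add: sign_def single_uminus)
      ultimately show ?thesis using hom_polys_mult by (fastforce simp: atLeast0LessThan)
    qed
    then show ?thesis
      by (subst det_def') (auto intro!: hom_polys_sum)
  qed
  moreover have "eval_poly (det ?M) x = det (mat n n (\<lambda>(i, j). eval_poly (A i j) x))" for x
  proof -
    have "map_mat (\<lambda>F. eval_poly F x) ?M = mat n n (\<lambda>(i, j). eval_poly (A i j) x)"
      by (rule eq_matI) auto
    then show ?thesis using eval.hom_det[of x ?M] by simp
  qed
  ultimately show ?thesis
    by (intro bexI[of _ "det ?M"] allI) (simp_all add: trivial_kernel_iff_det)
qed

section \<open>Functionals on polynomials and their annihilators\<close>

text \<open>The functional with moments \<open>b\<close>. Coefficients of \<open>Q\<close> above
  degree \<open>d\<close> are dropped silently, hence the degree bounds in the statements about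
  products and values.\<close>

definition lam :: "nat \<Rightarrow> (nat \<Rightarrow> 'a) \<Rightarrow> 'a::comm_ring_1 poly \<Rightarrow> 'a" where
  "lam d b Q = (\<Sum>i\<le>d. coeff Q i * b i)"

lemma lam_0 [simp]: "lam d b 0 = 0"
  by (simp add: lam_def)

lemma lam_add: "lam d b (P + Q) = lam d b P + lam d b Q"
  by (simp add: lam_def sum.distrib algebra_simps)

lemma lam_smult: "lam d b (smult c P) = c * lam d b P"
  by (simp add: lam_def sum_distrib_left mult.assoc)

lemma lam_diff: "lam d b (P - Q) = lam d b P - lam d b Q"
  by (simp add: lam_def sum_subtractf algebra_simps)

lemma lam_sum: "lam d b (\<Sum>i\<in>I. P i) = (\<Sum>i\<in>I. lam d b (P i))"
  by (induction I rule: infinite_finite_induct) (auto simp: lam_add)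

lemma lam_cong: "(\<And>i. i \<le> d \<Longrightarrow> b i = b' i) \<Longrightarrow> lam d b Q = lam d b' Q"
  by (simp add: lam_def)

lemma lam_seq_add: "lam d (\<lambda>i. b i + b' i) Q = lam d b Q + lam d b' Q"
  by (simp add: lam_def sum.distrib algebra_simps)

lemma lam_seq_scale: "lam d (\<lambda>i. c * b i) Q = c * lam d b Q"
  by (simp add: lam_def sum_distrib_left algebra_simps)

lemma lam_seq_sum: "lam d (\<lambda>i. \<Sum>j\<in>J. B j i) Q = (\<Sum>j\<in>J. lam d (B j) Q)"
  unfolding lam_def sum_distrib_left by (rule sum.swap)

lemma lam_monom: "i \<le> d \<Longrightarrow> lam d b (monom c i) = c * b i"
  by (simp add: lam_def if_distrib[of "\<lambda>x. x * _"] cong: if_cong)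

lemma lam_0_seq [simp]: "lam d (\<lambda>i. 0) Q = 0"
  by (simp add: lam_def)

lemma poly_as_sum_atMost:
  assumes "degree Q \<le> d" shows "Q = (\<Sum>i\<le>d. monom (coeff Q i) i)"
  by (rule poly_eqI) (use assms in \<open>auto simp: coeff_sum coeff_eq_0\<close>)

text \<open>The pairing \<open>(P, R) \<mapsto> lam d b (P * R)\<close> has the Hankel matrix
  \<open>b (i + j)\<close>, the catalecticant of the form. The bound on \<open>m + n\<close> keeps
  all indices \<open>i + j\<close> within \<open>d\<close>.\<close>

lemma lam_mult_expand:
  assumes "degree P < m" "degree R < n" "m + n \<le> d + 2"
  shows "lam d b (P * R) = (\<Sum>i<m. coeff P i * (\<Sum>j<n. coeff R j * b (i + j)))"
proof -
  have P: "P = (\<Sum>i<m. monom (coeff P i) i)"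
    by (rule poly_eqI) (use assms in \<open>auto simp: coeff_sum coeff_eq_0\<close>)
  have R: "R = (\<Sum>i<n. monom (coeff R i) i)"
    by (rule poly_eqI) (use assms in \<open>auto simp: coeff_sum coeff_eq_0\<close>)
  have "P * R = (\<Sum>i<m. \<Sum>j<n. monom (coeff P i * coeff R j) (i + j))"
    by (subst P, subst R) (simp add: sum_product mult_monom)
  also have "lam d b \<dots> = (\<Sum>i<m. \<Sum>j<n. coeff P i * coeff R j * b (i + j))"
    using assms(3) by (simp add: lam_sum lam_monom)
  finally show ?thesis by (simp add: sum_distrib_left mult.assoc)
qed

text \<open>The derivative of order \<open>m\<close> of the moment curve, divided by
  \<open>m!\<close>. As a functional it reads the Taylor coefficient of order \<open>m\<close> at
  \<open>x\<close>.\<close>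

definition hasse_pt :: "'a::comm_ring_1 \<Rightarrow> nat \<Rightarrow> nat \<Rightarrow> 'a" where
  "hasse_pt x m i = of_nat (i choose m) * x ^ (i - m)"

lemma hasse_pt_0: "hasse_pt x 0 i = x ^ i"
  by (simp add: hasse_pt_def)

lemma coeff_translate_power: "coeff ([:x, 1:] ^ i) m = hasse_pt x m i"
proof (cases "m \<le> i")
  case False
  then show ?thesis by (simp add: hasse_pt_def coeff_eq_0 degree_linear_power binomial_eq_0)
qed (simp add: coeff_linear_poly_power hasse_pt_def)

lemma lam_hasse_pt:
  fixes Q :: "'a::comm_ring_1 poly"
  assumes "degree Q \<le> d"
  shows "lam d (hasse_pt x m) Q = coeff (pcompose Q [:x, 1:]) m"
proof -
  have "pcompose Q [:x, 1:] = (\<Sum>i\<le>d. smult (coeff Q i) ([:x, 1:] ^ i))"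
  proof -
    have "pcompose (monom c i) [:x, 1:] = smult c ([:x, 1:] ^ i)" for c i
      by (induction i) (simp_all add: monom_0 monom_Suc pcompose_pCons)
    then show ?thesis
      by (subst poly_as_sum_atMost[OF assms]) (simp add: pcompose_sum)
  qed
  then show ?thesis by (simp add: lam_def coeff_sum coeff_translate_power)
qed

lemma lam_power:
  assumes "degree Q \<le> d"
  shows "lam d (\<lambda>i. x ^ i) Q = poly Q x"
proof -
  have "lam d (\<lambda>i. x ^ i) Q = lam d (hasse_pt x 0) Q"
    by (simp add: hasse_pt_0 cong: lam_cong)
  then show ?thesis using assms by (simp add: lam_hasse_pt)
qed

text \<open>Apolarity, with the dual form taken in the actual degree of \<open>g\<close>, so that it
  has no zero at infinity. For \<open>degree g > d\<close> the condition is void.\<close>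

definition annihilates :: "nat \<Rightarrow> (nat \<Rightarrow> 'a) \<Rightarrow> 'a::field poly \<Rightarrow> bool" where
  "annihilates d b g \<longleftrightarrow> (\<forall>p. degree p + degree g \<le> d \<longrightarrow> lam d b (g * p) = 0)"

abbreviation roots_poly :: "'a::comm_ring_1 set \<Rightarrow> 'a poly" where
  "roots_poly T \<equiv> (\<Prod>x\<in>T. [:- x, 1:])"

lemma degree_roots_poly [simp]: "degree (roots_poly (T :: 'a::idom set)) = card T"
  by (induction T rule: infinite_finite_induct) (auto simp: degree_mult_eq simp del: mult_pCons_left)

lemma poly_roots_poly: "poly (roots_poly T) y = (\<Prod>x\<in>T. y - x)"
  by (simp add: poly_prod)

lemma roots_poly_dvd:
  fixes Q :: "'a::field poly"
  assumes "finite T" "\<And>x. x \<in> T \<Longrightarrow> poly Q x = 0"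
  shows "roots_poly T dvd Q"
  using assms
proof (induction T rule: finite_induct)
  case (insert x T)
  then obtain q where q: "Q = roots_poly T * q" by (auto elim: dvdE)
  have "poly (roots_poly T) x * poly q x = 0"
    using insert.prems[of x] q by (metis insertI1 poly_mult)
  then have "poly q x = 0" using insert.hyps by (auto simp: poly_roots_poly)
  then have "[:- x, 1:] dvd q" by (simp add: poly_eq_0_iff_dvd)
  then show ?case using insert.hyps q by (simp add: mult_dvd_mono mult.commute del: mult_pCons_left mult_pCons_right)
qed simp

text \<open>Lagrange interpolation: only the values at the roots matter.\<close>

lemma annihilates_roots_poly_decomp:
  fixes b :: "nat \<Rightarrow> 'a::field"
  assumes "finite T" "card T \<le> d + 1" "annihilates d b (roots_poly T)"
  shows "\<exists>e. \<forall>i\<le>d. b i = (\<Sum>x\<in>T. e x * x ^ i)"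
proof -
  define L where "L x = smult (1 / (\<Prod>y\<in>T - {x}. x - y)) (roots_poly (T - {x}))" for x
  have L: "poly (L x) y = (if x = y then 1 else 0)" if "x \<in> T" "y \<in> T" for x y
  proof (cases "x = y")
    case True
    have "(\<Prod>z\<in>T - {y}. y - z) \<noteq> 0" using assms(1) by simp
    then show ?thesis using True by (simp add: L_def poly_roots_poly)
  next
    case False
    have "(\<Prod>z\<in>T - {x}. y - z) = 0"
      by (rule prod_zero) (use assms(1) that False in auto)
    then show ?thesis using False by (simp add: L_def poly_roots_poly)
  qed
  have dL: "degree (L x) \<le> d" if "x \<in> T" for x
  proof -
    have "degree (L x) \<le> card (T - {x})"
      unfolding L_def by (rule order.trans[OF degree_smult_le]) simp
    also have "\<dots> \<le> d" using assms(1,2) that by simp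
    finally show ?thesis .
  qed
  have "b i = (\<Sum>x\<in>T. lam d b (L x) * x ^ i)" if "i \<le> d" for i
  proof -
    define Q where "Q = monom 1 i - (\<Sum>x\<in>T. smult (x ^ i) (L x))"
    have "degree (smult (x ^ i) (L x)) \<le> d" if "x \<in> T" for x
      by (rule order.trans[OF degree_smult_le dL[OF that]])
    then have dQ: "degree Q \<le> d"
      unfolding Q_def using that assms(1)
      by (intro degree_diff_le degree_sum_le) (simp_all add: degree_monom_eq)
    have "poly Q y = 0" if y: "y \<in> T" for y
    proof -
      have "poly Q y = y ^ i - (\<Sum>x\<in>T. x ^ i * poly (L x) y)"
        by (simp add: Q_def poly_monom poly_sum)
      also have "(\<Sum>x\<in>T. x ^ i * poly (L x) y) = (\<Sum>x\<in>T. if x = y then x ^ i else 0)"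
        using L y by (intro sum.cong) auto
      finally show ?thesis using y assms(1) by simp
    qed
    then obtain q where q: "Q = roots_poly T * q"
      using roots_poly_dvd[OF assms(1)] by (meson dvdE)
    have "lam d b Q = 0"
    proof (cases "q = 0")
      case False
      then have "degree Q = card T + degree q"
        using q by (simp add: degree_mult_eq assms(1))
      then have "degree q + degree (roots_poly T) \<le> d" using dQ by simp
      then show ?thesis using assms(3) unfolding q annihilates_def by blast
    qed (simp add: q)
    then show ?thesis
      using that by (simp add: Q_def lam_diff lam_sum lam_smult lam_monom mult.commute)
  qed
  then show ?thesis by (intro exI[of _ "\<lambda>x. lam d b (L x)"] allI impI)
qed

text \<open>At a multiple root of a member of the pencil the Wronskian of its generators vanishes,
  which determines the member up to finitely many choices.\<close>

lemma pencil_squarefree: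
  fixes N G :: "'a::{alg_closed_field,field_char_0} poly"
  assumes deg: "degree N < degree G" and cop: "\<And>x. poly N x = 0 \<Longrightarrow> poly G x \<noteq> 0"
  obtains t where "t \<noteq> 0" "rsquarefree (N + smult t G)" "degree (N + smult t G) = degree G"
proof -
  define W where "W = pderiv N * G - N * pderiv G"
  have "W \<noteq> 0"
  proof
    assume "W = 0"
    then have eq: "pderiv N * G = N * pderiv G" by (simp add: W_def)
    \<comment> \<open>At a root of \<open>G\<close> the derivative \<open>pderiv G\<close> vanishes
      to order one less than \<open>G\<close>, and \<open>N\<close> does not vanish, so the two
      sides of \<open>eq\<close> have different orders.\<close>
    obtain x where x: "poly G x = 0" using alg_closed_imp_poly_has_root[of G] deg by auto
    have N: "poly N x \<noteq> 0" using cop x by blast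
    have G': "pderiv G \<noteq> 0" using deg by (auto simp: pderiv_eq_0_iff)
    have G0: "G \<noteq> 0" and "N \<noteq> 0" using deg N by auto
    then have "N * pderiv G \<noteq> 0" using G' by simp
    moreover from this have "pderiv N \<noteq> 0" using eq by auto
    ultimately have "order x (pderiv N) + order x G = order x N + order x (pderiv G)"
      using eq by (simp flip: order_mult)
    moreover have "order x N = 0" using N by (simp add: order_root)
    moreover have "order x G = Suc (order x (pderiv G))"
      using G' G0 x by (intro order_pderiv) (auto simp: order_root)
    ultimately show False by simp
  qed
  define B where "B = insert 0 ((\<lambda>x. - poly N x / poly G x) ` {x. poly W x = 0})"
  have "finite B" using poly_roots_finite[OF \<open>W \<noteq> 0\<close>] by (simp add: B_def)
  then obtain t where t: "t \<notin> B" using ex_new_if_finite[OF infinite_UNIV_char_0] by blast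
  have "t \<noteq> 0" using t by (auto simp: B_def)
  have "rsquarefree (N + smult t G)"
    unfolding rsquarefree_roots
  proof (intro allI notI, elim conjE)
    fix x assume *: "poly (N + smult t G) x = 0" "poly (pderiv (N + smult t G)) x = 0"
    have N: "poly N x = - t * poly G x" using *(1) by (simp add: eq_neg_iff_add_eq_0)
    have N': "poly (pderiv N) x = - t * poly (pderiv G) x"
      using *(2) by (simp add: pderiv_add pderiv_smult eq_neg_iff_add_eq_0)
    have "poly W x = 0" by (simp add: W_def N N')
    moreover have "poly G x \<noteq> 0" using cop[of x] N by auto
    then have "t = - poly N x / poly G x" using N by simp
    ultimately show False using t by (auto simp: B_def)
  qed
  moreover have "degree (N + smult t G) = degree G"
    using deg \<open>t \<noteq> 0\<close> by (simp add: degree_add_eq_right)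
  ultimately show ?thesis using that \<open>t \<noteq> 0\<close> by blast
qed

lemma rsquarefree_imp_roots_poly:
  fixes P :: "'a::alg_closed_field poly"
  assumes "rsquarefree P"
  obtains T where "finite T" "card T = degree P" "P = smult (lead_coeff P) (roots_poly T)"
proof -
  have P0: "P \<noteq> 0" using assms by (simp add: rsquarefree_def)
  obtain A where A: "size A = degree P" "P = smult (lead_coeff P) (\<Prod>x\<in>#A. [:- x, 1:])"
    using alg_closed_imp_factorization[OF P0] by blast
  have le: "count A x \<le> 1" for x
  proof -
    have "proots P = A"
    proof -
      have "proots (\<Prod>x\<in>#A. [:- x, 1:]) = A"
      proof (induction A)
        case (add x A)
        have "(\<Prod>x\<in>#A. [:- x, 1 :: 'a:]) \<noteq> 0" by (auto simp: prod_mset_zero_iff)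
        then have "proots ([:- x, 1:] * (\<Prod>x\<in>#A. [:- x, 1:])) = {#x#} + A"
          using add.IH by (subst proots_mult) auto
        then show ?case by (simp del: mult_pCons_left)
      qed simp
      then show ?thesis using P0 by (subst A(2)) simp
    qed
    then have "count A x = order x P" using P0 by auto
    moreover have "order x P = 0 \<or> order x P = 1" using assms unfolding rsquarefree_def by blast
    ultimately show ?thesis by auto
  qed
  have cnt: "count A x = count (mset_set (set_mset A)) x" for x
  proof (cases "x \<in># A")
    case True
    then have "count A x > 0" by simp
    then have "count A x = 1" using le[of x] by linarith
    then show ?thesis using True by simp
  qed (simp add: not_in_iff)
  have A': "mset_set (set_mset A) = A" by (rule multiset_eqI, rule sym, rule cnt)
  then have *: "(\<Prod>x\<in>#A. [:- x, 1:]) = roots_poly (set_mset A)" "size A = card (set_mset A)"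
    using size_mset_set[of "set_mset A"] by (simp_all add: prod_unfold_prod_mset)
  show ?thesis
    by (rule that[of "set_mset A"]) (use A * in simp_all)
qed

lemma not_rsquarefree_imp_double_root:
  fixes g :: "'a::field_char_0 poly"
  assumes "g \<noteq> 0" "\<not> rsquarefree g"
  obtains x q where "g = [:- x, 1:] ^ 2 * q"
proof -
  obtain x where "order x g \<noteq> 0" "order x g \<noteq> 1"
    using assms by (auto simp: rsquarefree_def)
  then have "2 \<le> order x g" by simp
  then have "[:- x, 1:] ^ 2 dvd g" using order_divides[of x 2 g] by simp
  then show ?thesis using that by (auto elim: dvdE)
qed

section \<open>Multiples of annihilators and reduction modulo them\<close>

lemma annihilates_smult:
  assumes "annihilates d b (smult c g)" "c \<noteq> 0"
  shows "annihilates d b g"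
  using assms by (auto simp: annihilates_def lam_smult)

lemma annihilates_mult:
  assumes "annihilates d b g"
  shows "annihilates d b (g * h)"
  unfolding annihilates_def
proof (intro allI impI)
  fix p :: "'a poly" assume p: "degree p + degree (g * h) \<le> d"
  show "lam d b (g * h * p) = 0"
  proof (cases "g * h * p = 0")
    case False
    then have "degree (h * p) + degree g \<le> d"
      using p by (simp add: degree_mult_eq)
    then show ?thesis using assms by (simp add: annihilates_def mult.assoc)
  qed (auto simp del: mult_eq_0_iff)
qed

text \<open>Serves to pad an annihilator of too small degree to the degree that a recurrence
  requires; the added roots all lie at 0.\<close>

lemma monic_multiple:
  fixes q :: "'a::field poly"
  assumes "q \<noteq> 0" "degree q \<le> n"
  obtains w where "degree (q * w) = n" "lead_coeff (q * w) = 1"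
proof
  let ?w = "smult (1 / lead_coeff q) (monom 1 (n - degree q))"
  have w: "degree ?w = n - degree q" "?w \<noteq> 0" "lead_coeff ?w = 1 / lead_coeff q"
    using assms(1) by (simp_all add: degree_monom_eq)
  show "degree (q * ?w) = n" using assms w by (simp add: degree_mult_eq)
  show "lead_coeff (q * ?w) = 1" unfolding lead_coeff_mult w(3) using assms(1) by simp
qed

text \<open>The two arguments differ by a multiple of \<open>g\<close>: dividing \<open>p\<close> by
  \<open>g\<close> lowers the degree by exactly \<open>degree g\<close>, so the cofactor
  \<open>h * (p div g)\<close> stays within the range of \<open>annihilates\<close>.\<close>

lemma lam_mod:
  fixes b :: "nat \<Rightarrow> 'a::field"
  assumes "annihilates d b g" "degree (h * p) \<le> d" "h \<noteq> 0" "g \<noteq> 0" "degree h + degree g \<le> d + 1"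
  shows "lam d b (h * p) = lam d b (h * (p mod g))"
proof -
  have eq: "h * p = g * (h * (p div g)) + h * (p mod g)"
  proof -
    have "h * p = h * (p div g * g + p mod g)" by simp
    then show ?thesis by (simp only: distrib_left mult_ac)
  qed
  have "lam d b (g * (h * (p div g))) = 0"
  proof (cases "p div g = 0")
    case False
    then have "degree (p div g * g) = degree (p div g) + degree g"
      using assms(4) by (simp add: degree_mult_eq)
    moreover have "p mod g = 0 \<or> degree (p mod g) < degree g"
      using assms(4) by (rule degree_mod_less)
    ultimately have "degree p = degree (p div g) + degree g"
      using degree_add_eq_left[of "p mod g" "p div g * g"] by auto
    note dp = this
    then have "p \<noteq> 0" using False by auto
    then have "degree (h * (p div g)) + degree g \<le> d"
      using assms(2,3) False dp by (simp add: degree_mult_eq)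
    then show ?thesis using assms(1) by (simp add: annihilates_def)
  qed simp
  then show ?thesis by (subst eq) (simp add: lam_add)
qed

section \<open>The generic annihilator and changes of coordinates\<close>

lemma coeff_sum_monom_lessThan: "coeff (\<Sum>j<n. monom (w j) j) i = (if i < n then w i else 0)"
  by (simp add: coeff_sum)

lemma degree_sum_monom_lessThan: "0 < n \<Longrightarrow> degree (\<Sum>j<n. monom (w j) j) < n"
  by (rule degree_lessI) (simp_all add: coeff_sum_monom_lessThan)

text \<open>The annihilators of a binary form are generated in two complementary degrees,
  \<open>s\<close> and \<open>d + 2 - s\<close>. Minimality of \<open>s\<close> makes the Hankel
  matrix of size \<open>s\<close> invertible, and its solution \<open>N\<close> for the last unit
  vector represents the second generator. \<open>N\<close> and \<open>g\<close> have no common root,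
  so a generic member of the pencil they span, with \<open>g\<close> raised to degree
  \<open>d + 2 - s\<close>, is squarefree.\<close>

lemma many_point_annihilator:
  fixes b :: "nat \<Rightarrow> 'a::{alg_closed_field,field_char_0}"
  assumes g: "annihilates d b g" "g \<noteq> 0" "degree g = s" and s: "0 < s" "2 * s \<le> d + 2"
    and minimal: "\<And>h. h \<noteq> 0 \<Longrightarrow> degree h < s \<Longrightarrow> \<not> annihilates d b h"
  obtains T where "finite T" "card T = d + 2 - s" "annihilates d b (roots_poly T)"
proof -
  have expand: "lam d b ((\<Sum>j<s. monom (w j) j) * r) = (\<Sum>i<s. coeff r i * (\<Sum>j<s. b (i + j) * w j))"
    if "degree r < s" for r w
  proof -
    have "lam d b (r * (\<Sum>j<s. monom (w j) j)) = (\<Sum>i<s. coeff r i *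
        (\<Sum>j<s. coeff (\<Sum>j<s. monom (w j) j) j * b (i + j)))"
      using s that by (intro lam_mult_expand degree_sum_monom_lessThan) auto
    then show ?thesis by (simp add: coeff_sum_monom_lessThan mult.commute)
  qed
  \<comment> \<open>A kernel vector would be an annihilator of degree below \<open>s\<close>:
    reduction modulo \<open>g\<close> leaves only test polynomials of degree below \<open>s\<close>,
    and these are covered by the rows of the system.\<close>
  have "trivial_kernel s (\<lambda>i j. b (i + j))"
    unfolding trivial_kernel_def
  proof (intro allI impI)
    fix w j assume w: "\<forall>i<s. (\<Sum>j<s. b (i + j) * w j) = 0" and j: "j < s"
    define h where "h = (\<Sum>j<s. monom (w j) j)"
    have dh: "degree h < s" unfolding h_def by (rule degree_sum_monom_lessThan[OF s(1)])
    have "h = 0"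
    proof (rule ccontr)
      assume "h \<noteq> 0"
      have "annihilates d b h" unfolding annihilates_def
      proof (intro allI impI)
        fix p :: "'a poly" assume p: "degree p + degree h \<le> d"
        have "degree (h * p) \<le> d" using degree_mult_le[of h p] p by simp
        then have "lam d b (h * p) = lam d b (h * (p mod g))"
          using g dh s \<open>h \<noteq> 0\<close> by (intro lam_mod) auto
        also have "\<dots> = 0"
        proof -
          have "degree (p mod g) < s" using degree_mod_less[OF g(2), of p] g(3) s by auto
          then show ?thesis unfolding h_def using w by (simp add: expand)
        qed
        finally show "lam d b (h * p) = 0" .
      qed
      then show False using minimal[OF \<open>h \<noteq> 0\<close> dh] by blast
    qed
    then have "coeff h j = 0" by simp
    then show "w j = 0" using j by (simp add: h_def coeff_sum_monom_lessThan)
  qed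
  then obtain w where w: "\<forall>i<s. (\<Sum>j<s. b (i + j) * w j) = (if i = s - 1 then 1 else 0)"
    using trivial_kernel_solvable[of s "\<lambda>i j. b (i + j)" "\<lambda>i. if i = s - 1 then 1 else 0"] by blast
  define N where "N = (\<Sum>j<s. monom (w j) j)"
  have dN: "degree N < s" unfolding N_def by (rule degree_sum_monom_lessThan[OF s(1)])
  \<comment> \<open>Hence \<open>N\<close> kills every polynomial of degree below
    \<open>s - 1\<close>, the only ones against which an annihilator of degree
    \<open>d + 2 - s\<close> is tested.\<close>
  have lamN: "lam d b (N * r) = coeff r (s - 1)" if "degree r < s" for r
  proof -
    have "lam d b (N * r) = (\<Sum>i<s. coeff r i * (if i = s - 1 then 1 else 0))"
      unfolding N_def using that w by (simp add: expand)
    also have "\<dots> = (\<Sum>i<s. if i = s - 1 then coeff r i else 0)"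
      by (rule sum.cong) auto
    finally show ?thesis using s(1) by simp
  qed
  \<comment> \<open>A common root would give \<open>N * g' = g * N'\<close>; the right side is
    annihilated, while the left side pairs to the leading coefficient of \<open>g'\<close>.\<close>
  have cop: "poly g x \<noteq> 0" if "poly N x = 0" for x
  proof
    assume "poly g x = 0"
    then obtain g' where g': "g = [:- x, 1:] * g'" by (auto simp: poly_eq_0_iff_dvd elim: dvdE)
    obtain N' where N': "N = [:- x, 1:] * N'" using \<open>poly N x = 0\<close> by (auto simp: poly_eq_0_iff_dvd elim: dvdE)
    have "g' \<noteq> 0" using g(2) g' by auto
    then have dg': "s = degree g' + 1" using g(3) g' by (simp add: degree_mult_eq del: mult_pCons_left)
    have "N * g' = g * N'" unfolding g' N' by (simp only: mult_ac)
    moreover have "lam d b (g * N') = 0"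
    proof (cases "N' = 0")
      case False
      then have "degree N = degree N' + 1" using N' by (simp add: degree_mult_eq del: mult_pCons_left)
      then show ?thesis using g(1,3) dN s by (simp add: annihilates_def)
    qed simp
    moreover have "lam d b (N * g') = lead_coeff g'" using lamN[of g'] dg' by simp
    ultimately show False using \<open>g' \<noteq> 0\<close> by simp
  qed
  have "N \<noteq> 0"
    using lamN[of "monom 1 (s - 1)"] s(1) by (auto simp: degree_monom_eq)
  then have "finite {x. poly N x = 0}" by (rule poly_roots_finite)
  then obtain c where c: "poly N c \<noteq> 0" using ex_new_if_finite[OF infinite_UNIV_char_0] by blast
  \<comment> \<open>This factor brings \<open>g\<close> to degree \<open>d + 2 - s\<close>; its root
    \<open>c\<close> is not a root of \<open>N\<close>, which keeps the pair coprime.\<close>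
  define q where "q = [:- c, 1:] ^ (d + 2 - 2 * s)"
  have dq: "degree q = d + 2 - 2 * s" "q \<noteq> 0" by (simp_all add: q_def degree_linear_power)
  have dG: "degree (g * q) = d + 2 - s" using g dq s by (simp add: degree_mult_eq)
  obtain t where t: "t \<noteq> 0" "rsquarefree (N + smult t (g * q))"
    "degree (N + smult t (g * q)) = degree (g * q)"
  proof (rule pencil_squarefree[of N "g * q"])
    show "degree N < degree (g * q)" using dG dN s by simp
    show "poly (g * q) x \<noteq> 0" if "poly N x = 0" for x
      using cop[OF that] c that by (auto simp: q_def)
  qed
  obtain T where T: "finite T" "card T = d + 2 - s"
    "N + smult t (g * q) = smult (lead_coeff (N + smult t (g * q))) (roots_poly T)"
    using rsquarefree_imp_roots_poly[OF t(2)] t(3) dG by metis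
  have "annihilates d b (N + smult t (g * q))"
    unfolding annihilates_def
  proof (intro allI impI)
    fix p :: "'a poly" assume p: "degree p + degree (N + smult t (g * q)) \<le> d"
    then have p': "degree p + (d + 2 - s) \<le> d" using t(3) dG by simp
    have "lam d b (N * p) = 0" using lamN[of p] p' s by (simp add: coeff_eq_0)
    moreover have "lam d b (g * (q * p)) = 0"
    proof -
      have "degree (q * p) + degree g \<le> d" using degree_mult_le[of q p] dq p' g(3) s by simp
      then show ?thesis using g(1) unfolding annihilates_def by blast
    qed
    ultimately show "lam d b ((N + smult t (g * q)) * p) = 0"
      by (simp add: distrib_right lam_add lam_smult mult.assoc)
  qed
  then have "annihilates d b (roots_poly T)"
    using T(3) t(2) by (metis annihilates_smult leading_coeff_0_iff rsquarefree_def)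
  then show ?thesis using that T by blast
qed

text \<open>Changes of coordinates move the relevant points of \<open>P\<^sup>1\<close> away from infinity: the power with
  moments \<open>p\<^sup>i w\<^bsup>d-i\<^esup>\<close> becomes the one with moments \<open>p\<^sup>i (w + c p)\<^bsup>d-i\<^esup>\<close>.\<close>

definition chart_poly :: "nat \<Rightarrow> 'a \<Rightarrow> 'a::field poly \<Rightarrow> 'a poly" where
  "chart_poly d c Q = (\<Sum>i\<le>d. smult (coeff Q i) (monom 1 i * [:1, c:] ^ (d - i)))"

definition chart :: "nat \<Rightarrow> 'a \<Rightarrow> (nat \<Rightarrow> 'a::field) \<Rightarrow> nat \<Rightarrow> 'a" where
  "chart d c b i = lam d b (monom 1 i * [:1, c:] ^ (d - i))"

lemma lam_chart: "lam d (chart d c b) Q = lam d b (chart_poly d c Q)"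
  by (simp add: chart_poly_def lam_sum lam_smult) (simp add: lam_def chart_def)

lemma chart_add: "chart d c (\<lambda>i. b i + b' i) i = chart d c b i + chart d c b' i"
  by (simp add: chart_def lam_seq_add)

lemma chart_scale: "chart d c (\<lambda>i. k * b i) i = k * chart d c b i"
  by (simp add: chart_def lam_seq_scale)

lemma chart_sum: "chart d c (\<lambda>i. \<Sum>j\<in>J. B j i) i = (\<Sum>j\<in>J. chart d c (B j) i)"
  by (simp add: chart_def lam_seq_sum)

lemma chart_cong: "(\<And>i. i \<le> d \<Longrightarrow> b i = b' i) \<Longrightarrow> chart d c b = chart d c b'"
  unfolding chart_def by (intro ext lam_cong)

lemma degree_monom_mult_power_le: "i \<le> d \<Longrightarrow> degree (monom (1::'a::field) i * [:1, c:] ^ (d - i)) \<le> d"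
proof -
  assume "i \<le> d"
  have "degree ([:1, c:] ^ (d - i)) \<le> d - i"
    using degree_power_le[of "[:1, c:]" "d - i"] by (auto split: if_splits)
  then show ?thesis
    using degree_mult_le[of "monom (1::'a) i" "[:1, c:] ^ (d - i)"] \<open>i \<le> d\<close>
    by (simp add: degree_monom_eq)
qed

lemma degree_chart_poly: "degree (chart_poly d c Q) \<le> d"
  unfolding chart_poly_def
  by (intro degree_sum_le order.trans[OF degree_smult_le degree_monom_mult_power_le]) auto

text \<open>The substitution \<open>t \<mapsto> t / (1 + c * t)\<close> cleared of denominators.
  These values are available for all but at most one \<open>t\<close>, hence determine the
  polynomial; the algebra of charts below is checked on them.\<close>

lemma poly_chart_poly:
  assumes "degree Q \<le> d" "1 + c * t \<noteq> 0"
  shows "poly (chart_poly d c Q) t = (1 + c * t) ^ d * poly Q (t / (1 + c * t))"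
proof -
  have "poly (chart_poly d c Q) t = (\<Sum>i\<le>d. coeff Q i * (t ^ i * (1 + c * t) ^ (d - i)))"
    by (simp add: chart_poly_def poly_sum poly_monom mult.commute)
  also have "\<dots> = (\<Sum>i\<le>d. (1 + c * t) ^ d * (coeff Q i * (t / (1 + c * t)) ^ i))"
    using assms(2) by (intro sum.cong refl) (simp add: power_diff power_divide)
  also have "\<dots> = (1 + c * t) ^ d * poly Q (t / (1 + c * t))"
    unfolding lam_power[OF assms(1), symmetric] lam_def by (simp add: sum_distrib_left)
  finally show ?thesis .
qed

lemma poly_eqI_cofinite:
  fixes P Q :: "'a::field_char_0 poly"
  assumes "finite A" "\<And>t. t \<notin> A \<Longrightarrow> poly P t = poly Q t"
  shows "P = Q"
proof (rule ccontr)
  assume "P \<noteq> Q"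
  then have "finite {t. poly (P - Q) t = 0}" by (intro poly_roots_finite) simp
  moreover have "- A \<subseteq> {t. poly (P - Q) t = 0}" using assms(2) by auto
  ultimately have "finite (- A)" by (rule rev_finite_subset)
  then show False using assms(1) infinite_UNIV_char_0[where 'a = 'a] by (metis finite_compl)
qed

lemma chart_poly_eqI:
  fixes Q P :: "'a::field_char_0 poly"
  assumes "degree Q \<le> d"
    and "\<And>t. 1 + c * t \<noteq> 0 \<Longrightarrow> (1 + c * t) ^ d * poly Q (t / (1 + c * t)) = poly P t"
  shows "chart_poly d c Q = P"
proof (rule poly_eqI_cofinite)
  show "finite {t. poly [:1, c:] t = 0}" by (rule poly_roots_finite) simp
  show "poly (chart_poly d c Q) t = poly P t" if "t \<notin> {t. poly [:1, c:] t = 0}" for t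
  proof -
    have "1 + c * t \<noteq> 0" using that by (simp add: mult.commute)
    then show ?thesis using assms by (simp add: poly_chart_poly)
  qed
qed

lemma chart_poly_mult:
  fixes P Q :: "'a::field_char_0 poly"
  assumes "degree P \<le> m" "degree Q \<le> n"
  shows "chart_poly (m + n) c (P * Q) = chart_poly m c P * chart_poly n c Q"
proof (rule chart_poly_eqI)
  show "degree (P * Q) \<le> m + n" using degree_mult_le[of P Q] assms by simp
qed (use assms in \<open>simp add: poly_chart_poly power_add\<close>)

lemma chart_poly_neg:
  fixes Q :: "'a::field_char_0 poly"
  assumes "degree Q \<le> d"
  shows "chart_poly d c (chart_poly d (- c) Q) = Q"
proof (rule chart_poly_eqI[OF degree_chart_poly])
  fix t assume t: "1 + c * t \<noteq> 0"
  have *: "1 + - c * (t / (1 + c * t)) = 1 / (1 + c * t)" using t by (simp add: field_simps)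
  have "poly (chart_poly d (- c) Q) (t / (1 + c * t)) = (1 / (1 + c * t)) ^ d * poly Q (t / (1 + c * t) / (1 / (1 + c * t)))"
    using poly_chart_poly[OF assms, of "- c" "t / (1 + c * t)"] t unfolding * by simp
  then show "(1 + c * t) ^ d * poly (chart_poly d (- c) Q) (t / (1 + c * t)) = poly Q t"
    using t by (simp add: power_one_over)
qed

lemma chart_chart:
  fixes b :: "nat \<Rightarrow> 'a::field_char_0"
  assumes "i \<le> d"
  shows "chart d c' (chart d c b) i = chart d (c + c') b i"
proof -
  have "chart_poly d c (monom 1 i * [:1, c':] ^ (d - i)) = monom 1 i * [:1, c + c':] ^ (d - i)"
  proof (rule chart_poly_eqI[OF degree_monom_mult_power_le[OF assms]])
    fix t assume t: "1 + c * t \<noteq> 0"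
    have "(1 + c * t) ^ d = (1 + c * t) ^ i * (1 + c * t) ^ (d - i)"
      using assms by (simp flip: power_add)
    moreover have "(1 + c * t) ^ i * (t / (1 + c * t)) ^ i = t ^ i"
      using t by (simp add: power_divide)
    moreover have "(1 + c * t) ^ (d - i) * (1 + c' * (t / (1 + c * t))) ^ (d - i) = (1 + (c + c') * t) ^ (d - i)"
    proof -
      have "(1 + c * t) * (1 + c' * (t / (1 + c * t))) = 1 + c * t + (1 + c * t) * (c' * (t / (1 + c * t)))"
        by (simp only: distrib_left mult_1_right)
      also have "(1 + c * t) * (c' * (t / (1 + c * t))) = c' * t" using t by simp
      finally have "(1 + c * t) * (1 + c' * (t / (1 + c * t))) = 1 + (c + c') * t"
        by (simp add: distrib_right)
      then show ?thesis by (simp flip: power_mult_distrib)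
    qed
    ultimately show "(1 + c * t) ^ d * poly (monom 1 i * [:1, c':] ^ (d - i)) (t / (1 + c * t)) =
        poly (monom 1 i * [:1, c + c':] ^ (d - i)) t"
      by (simp add: poly_monom mult_ac)
  qed
  then show ?thesis by (simp add: chart_def[of d c'] lam_chart chart_def[of d "c + c'"])
qed

lemma chart_0: "i \<le> d \<Longrightarrow> chart d 0 b i = b i"
  by (simp add: chart_def lam_monom flip: one_pCons)

lemma chart_chart_neg:
  fixes b :: "nat \<Rightarrow> 'a::field_char_0"
  assumes "i \<le> d"
  shows "chart d c (chart d (- c) b) i = b i" "chart d (- c) (chart d c b) i = b i"
  using assms by (simp_all add: chart_chart chart_0)

lemma chart_power:
  assumes "i \<le> d"
  shows "chart d c (\<lambda>i. p ^ i * w ^ (d - i)) i = p ^ i * (w + c * p) ^ (d - i)"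
proof -
  have "chart d c (\<lambda>i. p ^ i * w ^ (d - i)) i =
      (\<Sum>j\<le>d. if j < i then 0 else coeff ([:1, c:] ^ (d - i)) (j - i) * (p ^ j * w ^ (d - j)))"
    unfolding chart_def lam_def by (intro sum.cong refl) (simp add: coeff_monom_mult)
  also have "\<dots> = (\<Sum>j\<in>{i..d}. coeff ([:1, c:] ^ (d - i)) (j - i) * (p ^ j * w ^ (d - j)))"
    by (rule sum.mono_neutral_cong_right) (use assms in auto)
  also have "\<dots> = (\<Sum>m\<le>d - i. coeff ([:1, c:] ^ (d - i)) m * (p ^ (i + m) * w ^ (d - i - m)))"
    by (rule sum.reindex_bij_witness[of _ "\<lambda>m. i + m" "\<lambda>j. j - i"]) (use assms in auto)
  also have "\<dots> = p ^ i * (\<Sum>m\<le>d - i. of_nat (d - i choose m) * (c * p) ^ m * w ^ (d - i - m))"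
    unfolding sum_distrib_left
    by (intro sum.cong refl) (simp add: coeff_linear_poly_power power_add power_mult_distrib mult_ac)
  also have "\<dots> = p ^ i * (w + c * p) ^ (d - i)"
    by (simp add: add.commute[of w] binomial_ring)
  finally show ?thesis .
qed

section \<open>Sums of powers\<close>

text \<open>Each summand is the moment sequence of \<open>(p j * u + q j * v) ^ d\<close>;
  \<open>q j = 0\<close> is the point at infinity of the chart.\<close>

definition decomp :: "nat \<Rightarrow> nat \<Rightarrow> (nat \<Rightarrow> 'a::field) \<Rightarrow> bool" where
  "decomp d r a \<longleftrightarrow> (\<exists>p q. \<forall>i\<le>d. a i = (\<Sum>j<r. p j ^ i * q j ^ (d - i)))"

lemma decomp_cong: "(\<And>i. i \<le> d \<Longrightarrow> a i = b i) \<Longrightarrow> decomp d r a \<longleftrightarrow> decomp d r b"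
  by (simp add: decomp_def)

lemma decomp_chart:
  assumes "decomp d r b" shows "decomp d r (chart d c b)"
proof -
  obtain p q where pq: "\<And>i. i \<le> d \<Longrightarrow> b i = (\<Sum>j<r. p j ^ i * q j ^ (d - i))"
    using assms unfolding decomp_def by blast
  have "chart d c b i = (\<Sum>j<r. p j ^ i * (q j + c * p j) ^ (d - i))" if "i \<le> d" for i
  proof -
    have "chart d c b = chart d c (\<lambda>i. \<Sum>j<r. p j ^ i * q j ^ (d - i))"
      by (rule chart_cong) (rule pq)
    then show ?thesis using that by (simp add: chart_sum chart_power)
  qed
  then show ?thesis
    unfolding decomp_def by (intro exI[of _ p] exI[of _ "\<lambda>j. q j + c * p j"] allI impI)
qed

lemma decomp_chart_iff:
  fixes b :: "nat \<Rightarrow> 'a::field_char_0"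
  shows "decomp d r (chart d c b) \<longleftrightarrow> decomp d r b"
proof
  assume "decomp d r (chart d c b)"
  then have "decomp d r (chart d (- c) (chart d c b))" by (rule decomp_chart)
  then show "decomp d r b" by (subst decomp_cong[of d b]) (simp_all add: chart_chart_neg)
qed (rule decomp_chart)

text \<open>Each weight has a \<open>d\<close>-th root, which is absorbed into the linear form.
  Missing summands are filled with the zero form, whose power vanishes because
  \<open>d > 0\<close>.\<close>

lemma decomp_points:
  fixes b :: "nat \<Rightarrow> 'a::alg_closed_field"
  assumes "finite T" "card T \<le> r" "d > 0" and b: "\<And>i. i \<le> d \<Longrightarrow> b i = (\<Sum>x\<in>T. e x * x ^ i)"
  shows "decomp d r b"
proof -
  obtain h where h: "bij_betw h {..<card T} T"
    using ex_bij_betw_nat_finite[OF assms(1)] by (auto simp: atLeast0LessThan)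
  have "\<exists>y. y ^ d = e x" for x using nth_root_exists[OF \<open>d > 0\<close>] by blast
  then obtain y where y: "\<And>x. y x ^ d = e x" by metis
  define q where "q j = (if j < card T then y (h j) else 0)" for j
  define p where "p j = (if j < card T then h j * y (h j) else 0)" for j
  have "b i = (\<Sum>j<r. p j ^ i * q j ^ (d - i))" if "i \<le> d" for i
  proof -
    have "(\<Sum>j<r. p j ^ i * q j ^ (d - i)) = (\<Sum>j<card T. p j ^ i * q j ^ (d - i))"
    proof (rule sum.mono_neutral_right)
      show "\<forall>j\<in>{..<r} - {..<card T}. p j ^ i * q j ^ (d - i) = 0"
        using \<open>d > 0\<close> that by (auto simp: p_def q_def power_0_left)
    qed (use assms(2) in auto)
    also have "\<dots> = (\<Sum>j<card T. e (h j) * h j ^ i)"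
    proof (rule sum.cong)
      fix j assume "j \<in> {..<card T}"
      moreover have "(h j * y (h j)) ^ i * y (h j) ^ (d - i) = h j ^ i * y (h j) ^ d"
        using that by (simp add: power_mult_distrib mult.assoc flip: power_add)
      ultimately show "p j ^ i * q j ^ (d - i) = e (h j) * h j ^ i"
        by (simp add: p_def q_def y mult.commute)
    qed simp
    also have "\<dots> = (\<Sum>x\<in>T. e x * x ^ i)" by (rule sum.reindex_bij_betw[OF h])
    finally show ?thesis using b that by simp
  qed
  then show ?thesis unfolding decomp_def by blast
qed

text \<open>A summand at infinity reads the coefficient of degree \<open>d\<close>. Its presence
  makes \<open>card T < r\<close>, and the degree condition then forces \<open>degree Q < d\<close>,
  so a single inequality covers finite points and infinity.\<close>

lemma decomp_imp_lam_eq_0: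
  assumes "decomp d r b"
  obtains T where "finite T" "card T \<le> r"
    "\<And>Q. (\<And>x. x \<in> T \<Longrightarrow> poly Q x = 0) \<Longrightarrow> degree Q + r \<le> d + card T \<Longrightarrow> lam d b Q = 0"
proof -
  obtain p q where pq: "\<And>i. i \<le> d \<Longrightarrow> b i = (\<Sum>j<r. p j ^ i * q j ^ (d - i))"
    using assms unfolding decomp_def by blast
  define J where "J = {j. j < r \<and> q j \<noteq> 0}"
  define T where "T = (\<lambda>j. p j / q j) ` J"
  have J: "J \<subseteq> {..<r}" by (auto simp: J_def)
  then have fJ: "finite J" by (rule finite_subset) simp
  have cT: "card T \<le> card J" unfolding T_def by (rule card_image_le[OF fJ])
  have cJ: "card J \<le> r" using card_mono[OF _ J] by simp
  have "lam d b Q = 0" if Q: "\<And>x. x \<in> T \<Longrightarrow> poly Q x = 0" "degree Q + r \<le> d + card T" for Q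
  proof -
    have dQ: "degree Q \<le> d" using Q(2) cT cJ by simp
    have "lam d (\<lambda>i. p j ^ i * q j ^ (d - i)) Q = 0" if j: "j < r" for j
    proof (cases "q j = 0")
      case True
      have "J \<subset> {..<r}" using J j True by (auto simp: J_def)
      then have "card J < r" using psubset_card_mono[of "{..<r}" J] by simp
      then have "coeff Q d = 0" using Q(2) cT by (intro coeff_eq_0) simp
      then show ?thesis
        unfolding lam_def by (intro sum.neutral) (auto simp: True power_0_left)
    next
      case False
      then have "poly Q (p j / q j) = 0" using j by (intro Q) (auto simp: T_def J_def)
      moreover have "lam d (\<lambda>i. p j ^ i * q j ^ (d - i)) Q = lam d (\<lambda>i. q j ^ d * (p j / q j) ^ i) Q"
        using False by (intro lam_cong) (simp add: power_diff power_divide)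
      ultimately show ?thesis by (simp add: lam_seq_scale lam_power[OF dQ])
    qed
    moreover have "lam d b Q = lam d (\<lambda>i. \<Sum>j<r. p j ^ i * q j ^ (d - i)) Q"
      by (rule lam_cong) (rule pq)
    ultimately show ?thesis by (simp add: lam_seq_sum)
  qed
  then show ?thesis using that[of T] cT cJ fJ by (simp add: T_def)
qed

section \<open>Ranks of sums of evaluations, with and without a derivative term\<close>

lemma coeff_translate_1:
  fixes Q :: "'a::idom poly"
  shows "coeff (pcompose Q [:x, 1:]) 1 = poly (pderiv Q) x"
proof -
  have "pderiv (pcompose Q [:x, 1:]) = pcompose (pderiv Q) [:x, 1:]"
    by (simp add: pderiv_pcompose pderiv_pCons)
  then have "coeff (pderiv (pcompose Q [:x, 1:])) 0 = poly (pderiv Q) x" by simp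
  then show ?thesis by (simp add: coeff_pderiv)
qed

lemma lam_tangent_seq:
  fixes Q :: "'a::field poly"
  assumes "degree Q \<le> d"
    and b: "\<And>i. i \<le> d \<Longrightarrow> b i = \<alpha> * hasse_pt x0 0 i + \<beta> * hasse_pt x0 1 i + (\<Sum>x\<in>S. e x * hasse_pt x 0 i)"
  shows "lam d b Q = \<alpha> * poly Q x0 + \<beta> * poly (pderiv Q) x0 + (\<Sum>x\<in>S. e x * poly Q x)"
proof -
  have "lam d b Q = lam d (\<lambda>i. \<alpha> * hasse_pt x0 0 i + \<beta> * hasse_pt x0 1 i + (\<Sum>x\<in>S. e x * hasse_pt x 0 i)) Q"
    by (rule lam_cong) (rule b)
  also have "\<dots> = \<alpha> * lam d (hasse_pt x0 0) Q + \<beta> * lam d (hasse_pt x0 1) Q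
      + (\<Sum>x\<in>S. e x * lam d (hasse_pt x 0) Q)"
    by (simp only: lam_seq_add lam_seq_scale lam_seq_sum)
  also have "\<dots> = \<alpha> * poly Q x0 + \<beta> * poly (pderiv Q) x0 + (\<Sum>x\<in>S. e x * poly Q x)"
    using assms(1) by (simp add: lam_hasse_pt coeff_translate_1 del: One_nat_def)
  finally show ?thesis .
qed

text \<open>A polynomial vanishing on \<open>S\<close> and on the points of a decomposition, with a
  simple zero at \<open>x0\<close>, pairs to 0 by the decomposition but to \<open>\<beta>\<close>
  times its derivative at \<open>x0\<close> by the formula for \<open>b\<close>.\<close>

lemma tangent_seq_no_decomp:
  fixes b :: "nat \<Rightarrow> 'a::field"
  assumes S: "finite S" "x0 \<notin> S" and \<beta>: "\<beta> \<noteq> 0"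
    and b: "\<And>i. i \<le> d \<Longrightarrow> b i = \<alpha> * hasse_pt x0 0 i + \<beta> * hasse_pt x0 1 i + (\<Sum>x\<in>S. e x * hasse_pt x 0 i)"
    and r: "r + card S < d"
  shows "\<not> decomp d r b"
proof
  assume "decomp d r b"
  then obtain T where T: "finite T" "card T \<le> r"
    "\<And>Q. (\<And>x. x \<in> T \<Longrightarrow> poly Q x = 0) \<Longrightarrow> degree Q + r \<le> d + card T \<Longrightarrow> lam d b Q = 0"
    by (rule decomp_imp_lam_eq_0) blast
  define R where "R = roots_poly (S \<union> (T - {x0}))"
  define Q where "Q = [:- x0, 1:] * R"
  have "R \<noteq> 0" using S T(1) by (simp add: R_def)
  have "card (S \<union> (T - {x0})) \<le> card S + card T"
    by (meson T(1) card_Un_le card_Diff1_le add_left_mono order.trans)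
  then have "degree R \<le> card S + card T" by (simp add: R_def)
  moreover have "degree Q = Suc (degree R)"
    unfolding Q_def using \<open>R \<noteq> 0\<close> by (subst degree_mult_eq) auto
  ultimately have dQ: "degree Q + r \<le> d + card T" "degree Q \<le> d" using r T(2) by auto
  have Q0: "poly Q x = 0" if "x \<in> insert x0 (S \<union> T)" for x
  proof (cases "x = x0")
    case False
    then have "poly R x = 0"
      using that S T(1) unfolding R_def poly_roots_poly by (intro prod_zero) auto
    then show ?thesis by (simp add: Q_def)
  qed (simp add: Q_def)
  have "lam d b Q = 0" by (rule T(3)) (use Q0 dQ in auto)
  moreover have "lam d b Q = \<beta> * poly (pderiv Q) x0"
    using Q0 by (subst lam_tangent_seq[OF dQ(2) b]) auto
  moreover have "poly (pderiv Q) x0 = poly R x0"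
    by (simp add: Q_def pderiv_mult pderiv_pCons del: mult_pCons_left)
  moreover have "poly R x0 \<noteq> 0" using S T(1) by (auto simp: R_def poly_roots_poly)
  ultimately show False using \<beta> by simp
qed

text \<open>Some \<open>x0 \<in> S\<close> lies outside the at most \<open>r\<close> points of a
  decomposition; a polynomial vanishing at all the other points isolates its weight.\<close>

lemma secant_seq_no_decomp:
  fixes b :: "nat \<Rightarrow> 'a::field"
  assumes S: "finite S" and e: "\<And>x. x \<in> S \<Longrightarrow> e x \<noteq> 0"
    and b: "\<And>i. i \<le> d \<Longrightarrow> b i = (\<Sum>x\<in>S. e x * hasse_pt x 0 i)"
    and r: "r < card S" "r + card S \<le> d + 1"
  shows "\<not> decomp d r b"
proof
  assume "decomp d r b"
  then obtain T where T: "finite T" "card T \<le> r"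
    "\<And>Q. (\<And>x. x \<in> T \<Longrightarrow> poly Q x = 0) \<Longrightarrow> degree Q + r \<le> d + card T \<Longrightarrow> lam d b Q = 0"
    by (rule decomp_imp_lam_eq_0) blast
  have "\<not> S \<subseteq> T" using card_mono[OF T(1), of S] T(2) r(1) by auto
  then obtain x0 where x0: "x0 \<in> S" "x0 \<notin> T" by blast
  define Q where "Q = roots_poly ((S - {x0}) \<union> T)"
  have "card ((S - {x0}) \<union> T) \<le> card S - 1 + card T"
    using card_Un_le[of "S - {x0}" T] x0(1) S by simp
  then have dQ: "degree Q + r \<le> d + card T" "degree Q \<le> d"
    using r T(2) by (auto simp: Q_def)
  have Q0: "poly Q x = 0" if "x \<in> (S - {x0}) \<union> T" for x
    using that S T(1) unfolding Q_def poly_roots_poly by (intro prod_zero) auto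
  have "lam d b Q = 0" by (rule T(3)) (use Q0 dQ in auto)
  moreover have "lam d b Q = (\<Sum>x\<in>S. e x * poly Q x)"
    by (subst lam_tangent_seq[OF dQ(2), of _ 0 0 0]) (use b in auto)
  moreover have "(\<Sum>x\<in>S. e x * poly Q x) = (\<Sum>x\<in>S. if x = x0 then e x * poly Q x else 0)"
    by (rule sum.cong) (use Q0 in auto)
  moreover have "\<dots> = e x0 * poly Q x0" using S x0 by simp
  moreover have "poly Q x0 \<noteq> 0" using S T(1) x0 by (auto simp: Q_def poly_roots_poly)
  ultimately show False using e x0 by simp
qed

lemma annihilates_roots_poly_imp_decomp:
  fixes b :: "nat \<Rightarrow> 'a::alg_closed_field"
  assumes "finite T" "card T \<le> d + 1" "annihilates d b (roots_poly T)" "d > 0"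
  shows "decomp d (card T) b"
proof -
  obtain e where "\<forall>i\<le>d. b i = (\<Sum>x\<in>T. e x * x ^ i)"
    using annihilates_roots_poly_decomp[OF assms(1-3)] by blast
  then show ?thesis using assms by (intro decomp_points[of T _ d b e]) auto
qed

text \<open>The annihilator of least degree is \<open>g\<close>, with a double root at
  \<open>x0\<close> and simple roots on \<open>S\<close>. Its degree is \<open>card S + 2\<close>,
  and the complementary degree \<open>d + 2 - (card S + 2)\<close> counts the points
  obtained.\<close>

lemma tangent_seq_decomp:
  fixes b :: "nat \<Rightarrow> 'a::{alg_closed_field,field_char_0}"
  assumes S: "finite S" "x0 \<notin> S" and \<beta>: "\<beta> \<noteq> 0" and e: "\<And>x. x \<in> S \<Longrightarrow> e x \<noteq> 0"
    and b: "\<And>i. i \<le> d \<Longrightarrow> b i = \<alpha> * hasse_pt x0 0 i + \<beta> * hasse_pt x0 1 i + (\<Sum>x\<in>S. e x * hasse_pt x 0 i)"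
    and d: "2 * card S + 2 \<le> d"
  shows "decomp d (d - card S) b"
proof -
  let ?R = "roots_poly S"
  define g where "g = [:- x0, 1:] ^ 2 * ?R"
  note lam = lam_tangent_seq[OF _ b]
  have R0: "?R \<noteq> 0" using S by simp
  have Rx0: "poly ?R x0 \<noteq> 0" using S by (auto simp: poly_roots_poly)
  have dg: "degree g = card S + 2" "g \<noteq> 0"
    using R0 by (simp_all add: g_def degree_mult_eq degree_linear_power)
  have Rx: "poly ?R x = 0" if "x \<in> S" for x
    using that S unfolding poly_roots_poly by (intro prod_zero) auto
  have ann: "annihilates d b g"
    unfolding annihilates_def
  proof (intro allI impI)
    fix p :: "'a poly" assume "degree p + degree g \<le> d"
    then have "degree (g * p) \<le> d" using degree_mult_le[of g p] by simp
    then show "lam d b (g * p) = 0"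
      by (subst lam) (auto simp: g_def Rx pderiv_mult pderiv_power pderiv_pCons power2_eq_square
          simp del: mult_pCons_left)
  qed
  \<comment> \<open>Test polynomials that isolate one term of the functional at a time give
    \<open>h\<close> a double zero at \<open>x0\<close> and zeros on \<open>S\<close>, so
    \<open>g\<close> divides \<open>h\<close>.\<close>
  have minimal: "\<not> annihilates d b h" if h: "h \<noteq> 0" "degree h < card S + 2" for h
  proof
    assume "annihilates d b h"
    then have h0: "lam d b (h * p) = 0" if "degree p \<le> card S + 1" for p
      using that h d by (simp add: annihilates_def)
    have lamh: "\<alpha> * poly (h * p) x0 + \<beta> * poly (pderiv (h * p)) x0 + (\<Sum>x\<in>S. e x * poly (h * p) x) = 0"
      if "degree p \<le> card S + 1" for p
    proof -
      have "degree (h * p) \<le> d" using degree_mult_le[of h p] that h d by simp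
      then show ?thesis using h0[OF that] by (simp add: lam)
    qed
    have hx0: "poly h x0 = 0"
    proof -
      have "degree ([:- x0, 1:] * ?R) \<le> card S + 1" using R0 by (subst degree_mult_eq) auto
      from lamh[OF this] show ?thesis using \<beta> Rx0
        by (simp add: Rx pderiv_mult pderiv_pCons del: mult_pCons_left)
    qed
    have "poly (pderiv h) x0 = 0"
    proof -
      have "degree ?R \<le> card S + 1" by simp
      from lamh[OF this] show ?thesis using \<beta> Rx0 hx0 by (simp add: Rx pderiv_mult)
    qed
    moreover have "poly h x = 0" if x: "x \<in> S" for x
    proof -
      let ?p = "[:- x0, 1:] ^ 2 * roots_poly (S - {x})"
      have "Suc (card (S - {x})) = card S" using S x by (intro card_Suc_Diff1)
      then have "degree ?p \<le> card S + 1"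
        using S by (subst degree_mult_eq) (auto simp: degree_linear_power)
      note * = lamh[OF this]
      have "poly (roots_poly (S - {x})) y = 0" if "y \<in> S" "y \<noteq> x" for y
        using that S unfolding poly_roots_poly by (intro prod_zero) auto
      then have "(\<Sum>y\<in>S. e y * poly (h * ?p) y) = (\<Sum>y\<in>S. if y = x then e x * poly (h * ?p) x else 0)"
        by (intro sum.cong) auto
      then have "e x * poly (h * ?p) x = 0"
        using * S x by (simp add: hx0 pderiv_mult pderiv_power pderiv_pCons power2_eq_square del: mult_pCons_left)
      moreover have "poly ?p x \<noteq> 0" using S x by (auto simp: poly_roots_poly)
      ultimately show ?thesis using e[OF x] by simp
    qed
    ultimately have "roots_poly (insert x0 S) dvd h" 
      using S hx0 by (intro roots_poly_dvd) auto
    then obtain q where q: "h = [:- x0, 1:] * (?R * q)"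
      using S by (auto simp: mult.assoc elim!: dvdE simp del: mult_pCons_left)
    have "poly (pderiv h) x0 = poly ?R x0 * poly q x0"
      by (simp add: q pderiv_mult pderiv_pCons del: mult_pCons_left)
    then have "poly q x0 = 0" using \<open>poly (pderiv h) x0 = 0\<close> Rx0 by simp
    then obtain q' where q': "q = [:- x0, 1:] * q'" by (auto simp: poly_eq_0_iff_dvd elim: dvdE)
    have "h = g * q'" unfolding q q' g_def power2_eq_square by (simp only: mult_ac)
    then have "degree h \<ge> degree g" using h(1) by (auto simp: degree_mult_eq)
    then show False using h(2) dg by simp
  qed
  obtain T where T: "finite T" "card T = d + 2 - (card S + 2)" "annihilates d b (roots_poly T)"
    by (rule many_point_annihilator[OF ann dg(2,1)]) (use d minimal in auto)
  have "decomp d (card T) b"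
    using T d by (intro annihilates_roots_poly_imp_decomp) auto
  then show ?thesis using T(2) by simp
qed

text \<open>A nonzero form has at most \<open>s \<le> d\<close> zeros, so one of \<open>d + 1\<close> translations moves none of
  them to infinity.\<close>

lemma exact_degree_annihilator:
  fixes a :: "nat \<Rightarrow> 'a::field_char_0"
  assumes g: "g \<noteq> 0" "degree g \<le> s" "s \<le> d" and ann: "\<And>p. degree p + s \<le> d \<Longrightarrow> lam d a (g * p) = 0"
  obtains c g' where "c \<in> of_nat ` {..d}" "degree g' = s" "g' \<noteq> 0" "annihilates d (chart d (- c) a) g'"
proof -
  \<comment> \<open>The reversed polynomial: \<open>poly R c\<close> is the coefficient of degree
    \<open>s\<close> of \<open>chart_poly s c g\<close>, so a \<open>c\<close> with
    \<open>poly R c \<noteq> 0\<close> makes the degree exactly \<open>s\<close>.\<close>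
  define R where "R = (\<Sum>i\<le>s. monom (coeff g i) (s - i))"
  have "coeff R (s - degree g) = (\<Sum>i\<le>s. if i = degree g then coeff g i else 0)"
    unfolding R_def coeff_sum using g by (intro sum.cong) auto
  then have "coeff R (s - degree g) = lead_coeff g" using g(2) by simp
  then have "R \<noteq> 0" using g(1) by auto
  have "degree R \<le> s" unfolding R_def
    by (intro degree_sum_le order.trans[OF degree_monom_le]) auto
  have "\<exists>c\<in>of_nat ` {..d}. poly R c \<noteq> 0"
  proof (rule ccontr)
    assume "\<not> ?thesis"
    then have "of_nat ` {..d} \<subseteq> {c. poly R c = 0}" by auto
    then have "card (of_nat ` {..d} :: 'a set) \<le> card {c. poly R c = 0}"
      by (rule card_mono[OF poly_roots_finite[OF \<open>R \<noteq> 0\<close>]])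
    also have "\<dots> \<le> degree R" by (rule card_poly_roots_bound[OF \<open>R \<noteq> 0\<close>])
    finally show False using \<open>degree R \<le> s\<close> g(3) by (simp add: card_image inj_on_def)
  qed
  then obtain c where c: "c \<in> of_nat ` {..d}" "poly R c \<noteq> 0" by blast
  define g' where "g' = chart_poly s c g"
  have "coeff g' s = (\<Sum>i\<le>s. coeff g i * c ^ (s - i))"
    unfolding g'_def chart_poly_def coeff_sum
    by (intro sum.cong refl) (simp add: coeff_monom_mult coeff_linear_poly_power)
  also have "\<dots> = poly R c" by (simp add: R_def poly_sum poly_monom)
  finally have lc: "coeff g' s \<noteq> 0" using c by simp
  then have dg': "degree g' = s" unfolding g'_def
    using degree_chart_poly[of s c g] by (metis le_degree order.antisym)
  have "annihilates d (chart d (- c) a) g'"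
    unfolding annihilates_def dg'
  proof (intro allI impI)
    fix p :: "'a poly" assume p: "degree p + s \<le> d"
    define p' where "p' = chart_poly (d - s) (- c) p"
    have dp': "degree p' \<le> d - s" unfolding p'_def by (rule degree_chart_poly)
    have "g' * p = chart_poly s c g * chart_poly (d - s) c p'"
      unfolding g'_def p'_def using p by (simp add: chart_poly_neg)
    also have "\<dots> = chart_poly d c (g * p')"
      using chart_poly_mult[OF g(2) dp', of c] g(3) by simp
    finally have "lam d (chart d (- c) a) (g' * p) = lam d (chart d c (chart d (- c) a)) (g * p')"
      by (simp add: lam_chart)
    also have "\<dots> = lam d a (g * p')" by (rule lam_cong) (rule chart_chart_neg)
    also have "\<dots> = 0" using dp' g(3) by (intro ann) simp
    finally show "lam d (chart d (- c) a) (g' * p) = 0" .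
  qed
  moreover have "g' \<noteq> 0" using lc by auto
  ultimately show ?thesis using that c(1) dg' by blast
qed

text \<open>Sylvester's dichotomy: an annihilator of least degree \<open>s\<close> bounds the rank
  by \<open>s\<close> if it is squarefree, and by \<open>d + 2 - s\<close> in any case. The first is
  impossible because \<open>s \<le> d div 2 + 1 < r\<close>, whence the double root; the second
  gives \<open>s \<le> d + 2 - r\<close>.\<close>

lemma high_rank_double_root:
  fixes a :: "nat \<Rightarrow> 'a::{alg_closed_field,field_char_0}"
  assumes d: "d > 0" and nz: "\<exists>i\<le>d. a i \<noteq> 0" and r: "d div 2 + 1 < r"
    and nodec: "\<And>r'. r' < r \<Longrightarrow> \<not> decomp d r' a"
  obtains c x q where "c \<in> of_nat ` {..d}" "q \<noteq> 0" "degree ([:- x, 1:] ^ 2 * q) + r \<le> d + 2"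
    "annihilates d (chart d (- c) a) ([:- x, 1:] ^ 2 * q)"
proof -
  \<comment> \<open>Minimality refers to all \<open>d + 1\<close> charts at once, since the degree
    of an annihilator may be exact only in some of them.\<close>
  define P where "P s \<longleftrightarrow> (\<exists>c\<in>of_nat ` {..d}. \<exists>g. g \<noteq> 0 \<and> degree g = s \<and> annihilates d (chart d (- c) a) g)" for s
  define s0 where "s0 = d div 2 + 1"
  have s0: "s0 \<le> d" "d < 2 * s0" "2 * s0 \<le> d + 2" using d by (auto simp: s0_def)
  have "P s0"
  proof -
    \<comment> \<open>A dual form of degree \<open>s0\<close> has to satisfy
      \<open>d - s0 + 1\<close> equations in \<open>s0 + 1\<close> unknowns, fewer equations than
      unknowns because \<open>d < 2 * s0\<close>.\<close>
    have "card {..d - s0} < s0 + 1" using s0 by simp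
    from underdetermined_nontrivial[OF finite_atMost this, of "\<lambda>i j. a (i + j)"]
    obtain w where w': "(\<forall>i\<in>{..d - s0}. (\<Sum>j<s0 + 1. a (i + j) * w j) = 0) \<and> (\<exists>j<s0 + 1. w j \<noteq> 0)"
      by (rule exE)
    note w = w'[THEN conjunct1] w'[THEN conjunct2]
    define g where "g = (\<Sum>j<s0 + 1. monom (w j) j)"
    have cg: "coeff g j = (if j < s0 + 1 then w j else 0)" for j
      unfolding g_def by (rule coeff_sum_monom_lessThan)
    have g0: "g \<noteq> 0" using w(2) cg by (metis coeff_0)
    have dg: "degree g < s0 + 1" unfolding g_def by (rule degree_sum_monom_lessThan) simp
    have lam0: "lam d a (g * p) = 0" if "degree p + s0 \<le> d" for p
    proof -
      have "lam d a (p * g) = (\<Sum>i<d - s0 + 1. coeff p i * (\<Sum>j<s0 + 1. coeff g j * a (i + j)))"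
        using that dg s0 by (intro lam_mult_expand) auto
      also have "\<dots> = 0"
        using w(1) by (intro sum.neutral) (simp add: cg mult.commute[of "a _"] del: sum.lessThan_Suc)
      finally show ?thesis by (simp add: mult.commute)
    qed
    obtain c g' where "c \<in> of_nat ` {..d}" "degree g' = s0" "g' \<noteq> 0" "annihilates d (chart d (- c) a) g'"
      by (rule exact_degree_annihilator[OF g0 _ s0(1) lam0]) (use dg in auto)
    then show ?thesis unfolding P_def by blast
  qed
  define s where "s = (LEAST s. P s)"
  have "P s" unfolding s_def using \<open>P s0\<close> by (rule LeastI)
  have s: "s \<le> s0" unfolding s_def using \<open>P s0\<close> by (rule Least_le)
  obtain c g where cg: "c \<in> of_nat ` {..d}" "g \<noteq> 0" "degree g = s" "annihilates d (chart d (- c) a) g"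
    using \<open>P s\<close> unfolding P_def by blast
  let ?b = "chart d (- c) a"
  have minimal: "\<not> annihilates d ?b h" if "h \<noteq> 0" "degree h < s" for h
  proof -
    have "\<not> P (degree h)" using that(2) not_less_Least[of "degree h" P] by (simp add: s_def)
    then show ?thesis using that(1) cg(1) unfolding P_def by blast
  qed
  have ann_dec: "decomp d (card T) a" if "finite T" "card T \<le> d + 1" "annihilates d ?b (roots_poly T)" for T
    using annihilates_roots_poly_imp_decomp[OF that d] by (simp add: decomp_chart_iff)
  have "s \<noteq> 0"
  proof
    assume "s = 0"
    then obtain k where k: "g = [:k:]" using cg(3) degree_eq_zeroE by blast
    have "?b i = 0" if "i \<le> d" for i
    proof -
      have "lam d ?b (g * monom 1 i) = 0"
        using cg(3,4) \<open>s = 0\<close> that by (simp add: annihilates_def degree_monom_eq)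
      then show ?thesis using k cg(2) that by (simp add: smult_monom lam_monom)
    qed
    then have "chart d c ?b = chart d c (\<lambda>i. 0)" by (intro chart_cong)
    then have "a i = 0" if "i \<le> d" for i
      using chart_chart_neg(1)[OF that, of c a] by (simp add: chart_def)
    then show False using nz by blast
  qed
  have "\<not> rsquarefree g"
  proof
    assume "rsquarefree g"
    then obtain T where T: "finite T" "card T = degree g" "g = smult (lead_coeff g) (roots_poly T)"
      by (rule rsquarefree_imp_roots_poly)
    have "annihilates d ?b (roots_poly T)"
      using cg(2,4) T(3) by (metis annihilates_smult leading_coeff_0_iff)
    then have "decomp d s a" using ann_dec[OF T(1)] T(2) cg(3) s s0 by simp
    then show False using nodec s r s0_def by simp
  qed
  then obtain x q where q: "g = [:- x, 1:] ^ 2 * q"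
    using not_rsquarefree_imp_double_root cg(2) by blast
  obtain T where T: "finite T" "card T = d + 2 - s" "annihilates d ?b (roots_poly T)"
    by (rule many_point_annihilator[OF cg(4,2,3)]) (use s s0 minimal \<open>s \<noteq> 0\<close> in auto)
  have "decomp d (d + 2 - s) a" using ann_dec[OF T(1) _ T(3)] T(2) \<open>s \<noteq> 0\<close> by simp
  then have "r \<le> d + 2 - s" using nodec not_le by blast
  then have "degree g + r \<le> d + 2" using s s0 cg(3) by simp
  then show ?thesis using that[of c q x] cg q by auto
qed

section \<open>Binary forms and their moments\<close>

definition uv_monom :: "nat \<Rightarrow> nat \<Rightarrow> nat \<Rightarrow>\<^sub>0 nat" where
  "uv_monom a b = Poly_Mapping.single 0 a + Poly_Mapping.single 1 b"

lemma lookup_uv_monom: "lookup (uv_monom a b) i = (if i = 0 then a else if i = 1 then b else 0)"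
  by (simp add: uv_monom_def lookup_add lookup_single when_def)

lemma uv_monom_eq_iff: "uv_monom a b = uv_monom a' b' \<longleftrightarrow> a = a' \<and> b = b'"
proof
  assume eq: "uv_monom a b = uv_monom a' b'"
  show "a = a' \<and> b = b'"
    using arg_cong[OF eq, of "\<lambda>m. lookup m 0"] arg_cong[OF eq, of "\<lambda>m. lookup m 1"]
    by (simp add: lookup_uv_monom)
qed simp

lemma binary_form_key:
  assumes "f \<in> binary_forms d" "m \<in> keys f"
  obtains i where "i \<le> d" "m = uv_monom (d - i) i"
proof -
  have m: "keys m \<subseteq> {..1}" "(\<Sum>i\<in>keys m. lookup m i) = d"
    using assms unfolding hom_polys_def by auto
  have "(\<Sum>i\<in>keys m. lookup m i) = (\<Sum>i\<le>1. lookup m i)"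
    by (rule sum.mono_neutral_left) (use m in \<open>auto simp: in_keys_iff\<close>)
  then have d: "lookup m 0 + lookup m 1 = d" using m(2) by simp
  have "lookup m i = 0" if "i \<noteq> 0" "i \<noteq> 1" for i
    using m(1) that by (metis One_nat_def atMost_iff in_keys_iff le_Suc_eq le_zero_eq subsetD)
  then have "m = uv_monom (d - lookup m 1) (lookup m 1)"
    using d by (intro poly_mapping_eqI) (auto simp: lookup_uv_monom)
  then show ?thesis using that d by (metis le_add2)
qed

definition form_of_coords :: "nat \<Rightarrow> (nat \<Rightarrow> 'a::field) \<Rightarrow> 'a mpoly" where
  "form_of_coords d x = (\<Sum>i\<le>d. Poly_Mapping.single (uv_monom (d - i) i) (x i))"

lemma form_coords_uv: "form_coords d f i = lookup f (uv_monom (d - i) i)"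
  by (simp add: form_coords_def uv_monom_def)

lemma form_coords_zero: "form_coords d 0 i = 0"
  by (simp add: form_coords_uv)

lemma form_coords_sum: "form_coords d (\<Sum>j\<in>J. f j) i = (\<Sum>j\<in>J. form_coords d (f j) i)"
  by (simp add: form_coords_uv lookup_sum)

lemma form_of_coords_in: "form_of_coords d x \<in> binary_forms d"
  unfolding form_of_coords_def
proof (rule hom_polys_sum)
  fix i assume "i \<in> {..d}"
  have k: "keys (uv_monom (d - i) i) \<subseteq> {..1}"
    by (auto simp: in_keys_iff lookup_uv_monom split: if_splits)
  have "(\<Sum>j\<in>keys (uv_monom (d - i) i). lookup (uv_monom (d - i) i) j) =
      (\<Sum>j\<le>1. lookup (uv_monom (d - i) i) j)"
    by (rule sum.mono_neutral_left) (use k in \<open>auto simp: in_keys_iff\<close>)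
  also have "\<dots> = d" using \<open>i \<in> {..d}\<close> by (simp add: lookup_uv_monom)
  finally show "Poly_Mapping.single (uv_monom (d - i) i) (x i) \<in> binary_forms d"
    using k by (simp add: hom_polys_def)
qed

lemma form_coords_gt: "f \<in> binary_forms d \<Longrightarrow> i > d \<Longrightarrow> form_coords d f i = 0"
  by (metis binary_form_key form_coords_uv in_keys_iff not_le uv_monom_eq_iff)

lemma form_coords_form_of_coords: "form_coords d (form_of_coords d x) i = (if i \<le> d then x i else 0)"
proof (cases "i \<le> d")
  case True
  have "form_coords d (form_of_coords d x) i = (\<Sum>j\<le>d. x j when uv_monom (d - j) j = uv_monom (d - i) i)"
    by (simp add: form_coords_uv form_of_coords_def lookup_sum lookup_single)
  also have "\<dots> = (\<Sum>j\<le>d. if j = i then x j else 0)"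
    by (intro sum.cong) (auto simp: uv_monom_eq_iff when_def)
  finally show ?thesis using True by simp
qed (simp add: form_coords_gt[OF form_of_coords_in])

lemma form_of_coords_form_coords:
  assumes "f \<in> binary_forms d" shows "form_of_coords d (form_coords d f) = f"
proof (rule poly_mapping_eqI)
  fix m
  show "lookup (form_of_coords d (form_coords d f)) m = lookup f m"
  proof (cases "\<exists>i\<le>d. m = uv_monom (d - i) i")
    case True
    then show ?thesis
      using form_coords_form_of_coords[of d "form_coords d f"] by (auto simp: form_coords_uv)
  next
    case False
    then have "m \<notin> keys f" "m \<notin> keys (form_of_coords d (form_coords d f))"
      using binary_form_key[OF assms] binary_form_key[OF form_of_coords_in] by metis+
    then show ?thesis by (simp add: in_keys_iff)
  qed
qed

text \<open>Moments: with the binomial coefficients divided out, the powers of linear forms become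
  the points of the rational normal curve. The order of the moments is opposite to that of the
  coordinates.\<close>

definition crd :: "nat \<Rightarrow> (nat \<Rightarrow> 'a::field) \<Rightarrow> nat \<Rightarrow> 'a" where
  "crd d a i = (if i \<le> d then of_nat (d choose i) * a (d - i) else 0)"

definition form_of :: "nat \<Rightarrow> (nat \<Rightarrow> 'a::field) \<Rightarrow> 'a mpoly" where
  "form_of d a = form_of_coords d (crd d a)"

definition pt :: "nat \<Rightarrow> (nat \<Rightarrow> 'a::field) \<Rightarrow> 'a form_point" where
  "pt d a = form_class (form_of d a)"

lemma crd_add: "crd d (\<lambda>i. a i + b i) i = crd d a i + crd d b i"
  by (simp add: crd_def algebra_simps)

lemma crd_scale: "crd d (\<lambda>i. c * a i) i = c * crd d a i"
  by (simp add: crd_def)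

lemma crd_sum: "crd d (\<lambda>i. \<Sum>j\<in>J. B j i) i = (\<Sum>j\<in>J. crd d (B j) i)"
  by (simp add: crd_def sum_distrib_left)

lemma crd_cong: "(\<And>i. i \<le> d \<Longrightarrow> a i = b i) \<Longrightarrow> crd d a = crd d b"
  by (auto simp: crd_def)

lemma form_coords_form_of: "form_coords d (form_of d a) = crd d a"
  by (rule ext) (simp add: form_of_def form_coords_form_of_coords crd_def)

lemma form_of_in: "form_of d a \<in> binary_forms d"
  unfolding form_of_def by (rule form_of_coords_in)

lemma crd_eq_0_iff:
  fixes a :: "nat \<Rightarrow> 'a::field_char_0"
  shows "(\<forall>i\<le>d. crd d a i = 0) \<longleftrightarrow> (\<forall>i\<le>d. a i = 0)"
proof
  assume *: "\<forall>i\<le>d. crd d a i = 0"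
  show "\<forall>i\<le>d. a i = 0"
  proof (intro allI impI)
    fix i assume "i \<le> d"
    then show "a i = 0" using *[rule_format, of "d - i"] by (auto simp: crd_def)
  qed
qed (simp add: crd_def)

lemma form_of_eq_0_iff:
  fixes a :: "nat \<Rightarrow> 'a::field_char_0"
  shows "form_of d a = 0 \<longleftrightarrow> (\<forall>i\<le>d. a i = 0)"
proof
  assume "form_of d a = 0"
  then have "crd d a = (\<lambda>i. 0)" by (metis form_coords_form_of form_coords_zero)
  then show "\<forall>i\<le>d. a i = 0" using crd_eq_0_iff[of d a] by simp
next
  assume "\<forall>i\<le>d. a i = 0"
  then have "crd d a = (\<lambda>i. 0)" by (auto simp: crd_def)
  then show "form_of d a = 0" by (simp add: form_of_def form_of_coords_def)
qed

lemma form_of_surj: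
  fixes f :: "'a::field_char_0 mpoly"
  assumes "f \<in> binary_forms d"
  obtains a where "f = form_of d a"
proof
  let ?a = "\<lambda>i. form_coords d f (d - i) / of_nat (d choose i)"
  have "crd d ?a i = form_coords d f i" for i
  proof (cases "i \<le> d")
    case True
    then show ?thesis by (simp add: crd_def binomial_symmetric[of i d])
  qed (simp add: crd_def form_coords_gt[OF assms])
  then have "crd d ?a = form_coords d f" by (rule ext)
  then show "f = form_of d ?a" by (simp add: form_of_def form_of_coords_form_coords[OF assms])
qed

lemma uv_monom_add: "uv_monom a b + uv_monom a' b' = uv_monom (a + a') (b + b')"
  by (intro poly_mapping_eqI) (simp add: lookup_add lookup_uv_monom)

lemma single_uv_monom_power:
  fixes c :: "'a::comm_ring_1"
  shows "Poly_Mapping.single (uv_monom a b) c ^ n = Poly_Mapping.single (uv_monom (n * a) (n * b)) (c ^ n)"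
proof (induction n)
  case 0
  then show ?case by (simp add: uv_monom_def)
qed (simp add: mult_single uv_monom_add)

lemma linear_form_power:
  fixes p q :: "'a::field_char_0"
  shows "(form_of 1 (\<lambda>i. p ^ i * q ^ (1 - i))) ^ d = form_of d (\<lambda>i. p ^ i * q ^ (d - i))"
proof -
  have lin: "form_of 1 (\<lambda>i. p ^ i * q ^ (1 - i)) =
      Poly_Mapping.single (uv_monom 1 0) p + Poly_Mapping.single (uv_monom 0 1) q"
    by (simp add: form_of_def form_of_coords_def crd_def)
  have nat: "of_nat n * Poly_Mapping.single m c = Poly_Mapping.single m (of_nat n * c)" for n and m :: "nat \<Rightarrow>\<^sub>0 nat" and c :: 'a
    by (induction n) (simp_all add: distrib_right single_add)
  have "(form_of 1 (\<lambda>i. p ^ i * q ^ (1 - i))) ^ d =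
      (\<Sum>k\<le>d. Poly_Mapping.single (uv_monom k (d - k)) (of_nat (d choose k) * (p ^ k * q ^ (d - k))))"
    unfolding lin binomial_ring
    by (simp add: single_uv_monom_power mult_single uv_monom_add nat mult.assoc)
  also have "\<dots> = (\<Sum>k\<le>d. Poly_Mapping.single (uv_monom (d - k) k) (of_nat (d choose k) * (p ^ (d - k) * q ^ k)))"
    by (rule sum.reindex_bij_witness[of _ "\<lambda>k. d - k" "\<lambda>k. d - k"]) (auto simp: binomial_symmetric[symmetric])
  also have "\<dots> = form_of d (\<lambda>i. p ^ i * q ^ (d - i))"
    unfolding form_of_def form_of_coords_def by (intro sum.cong refl) (simp add: crd_def)
  finally show ?thesis .
qed

lemma form_of_add: "form_of d (\<lambda>i. a i + b i) = form_of d a + form_of d b"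
  by (simp add: form_of_def form_of_coords_def crd_add single_add sum.distrib)

lemma form_of_diff: "form_of d (\<lambda>i. a i - b i) = form_of d a - form_of d b"
  using form_of_add[of d "\<lambda>i. a i - b i" b] by simp

lemma form_of_sum: "form_of d (\<lambda>i. \<Sum>j\<in>J. B j i) = (\<Sum>j\<in>J. form_of d (B j))"
proof (induction J rule: infinite_finite_induct)
  case (insert j J)
  then show ?case by (simp add: form_of_add)
qed (simp_all add: form_of_def form_of_coords_def crd_def)

section \<open>The Waring rank in terms of moments\<close>

lemma waring_iff_decomp:
  fixes a :: "nat \<Rightarrow> 'a::field_char_0"
  shows "(\<exists>l :: nat \<Rightarrow> 'a mpoly. (\<forall>i<r. l i \<in> binary_forms 1) \<and> form_of d a = (\<Sum>i<r. l i ^ d)) \<longleftrightarrow> decomp d r a"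
    (is "?L \<longleftrightarrow> ?R")
proof -
  have sum: "form_of d a = (\<Sum>j<r. form_of d (\<lambda>i. p j ^ i * q j ^ (d - i))) \<longleftrightarrow>
      (\<forall>i\<le>d. a i = (\<Sum>j<r. p j ^ i * q j ^ (d - i)))" for p q :: "nat \<Rightarrow> 'a"
    by (subst right_minus_eq[symmetric])
      (simp only: form_of_sum[symmetric] form_of_diff[symmetric] form_of_eq_0_iff right_minus_eq)
  show ?thesis
  proof
    assume ?L
    then obtain l :: "nat \<Rightarrow> 'a mpoly" where l: "\<And>j. j < r \<Longrightarrow> l j \<in> binary_forms 1" "form_of d a = (\<Sum>j<r. l j ^ d)"
      by blast
    have "\<exists>p q. l j = form_of 1 (\<lambda>i. p ^ i * q ^ (1 - i))" if j: "j < r" for j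
    proof -
      obtain b where b: "l j = form_of 1 b" using form_of_surj[OF l(1)[OF j]] .
      have "form_of 1 b = form_of 1 (\<lambda>i. (b 1) ^ i * (b 0) ^ (1 - i))"
        unfolding form_of_def by (intro arg_cong[where f = "form_of_coords 1"] crd_cong) (auto simp: le_Suc_eq)
      then show ?thesis unfolding b by (intro exI)
    qed
    then have "\<forall>j. \<exists>p q. j < r \<longrightarrow> l j = form_of 1 (\<lambda>i. p ^ i * q ^ (1 - i))" by blast
    from choice[OF this] obtain p where "\<forall>j. \<exists>q. j < r \<longrightarrow> l j = form_of 1 (\<lambda>i. p j ^ i * q ^ (1 - i))" ..
    from choice[OF this] obtain q where pq: "\<forall>j. j < r \<longrightarrow> l j = form_of 1 (\<lambda>i. p j ^ i * q j ^ (1 - i))" ..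
    have "form_of d a = (\<Sum>j<r. form_of d (\<lambda>i. p j ^ i * q j ^ (d - i)))"
      unfolding l(2) by (intro sum.cong refl) (simp only: pq lessThan_iff linear_form_power)
    then show ?R unfolding sum decomp_def by (intro exI)
  next
    assume ?R
    then obtain p q where "form_of d a = (\<Sum>j<r. form_of d (\<lambda>i. p j ^ i * q j ^ (d - i)))"
      unfolding decomp_def sum[symmetric] by (elim exE)
    then show ?L
      by (intro exI[of _ "\<lambda>j. form_of 1 (\<lambda>i. p j ^ i * q j ^ (1 - i))"])
        (simp only: linear_form_power form_of_in simp_thms)
  qed
qed

definition exact_rank :: "nat \<Rightarrow> nat \<Rightarrow> (nat \<Rightarrow> 'a::field) \<Rightarrow> bool" where
  "exact_rank d r a \<longleftrightarrow> (\<exists>i\<le>d. a i \<noteq> 0) \<and> decomp d r a \<and> (\<forall>r'<r. \<not> decomp d r' a)"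

text \<open>Makes the \<open>LEAST\<close> in \<open>waring_rank\<close> meaningful. Without any
  decomposition, \<open>high_rank_double_root\<close> would apply with \<open>r = d + 2\<close> and
  yield a nonzero polynomial of degree 0 with a double root.\<close>

lemma decomp_exists:
  fixes a :: "nat \<Rightarrow> 'a::{alg_closed_field,field_char_0}"
  assumes "d > 0" "\<exists>i\<le>d. a i \<noteq> 0"
  shows "\<exists>r. decomp d r a"
proof (rule ccontr)
  assume no: "\<nexists>r. decomp d r a"
  show False
  proof (rule high_rank_double_root[OF assms, of "d + 2"])
    fix x :: 'a and q
    assume "q \<noteq> 0" "degree ([:- x, 1:] ^ 2 * q) + (d + 2) \<le> d + 2"
    then show False by (simp add: degree_mult_eq degree_linear_power)
  qed (use no in auto)
qed

lemma waring_rank_iff: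
  fixes a :: "nat \<Rightarrow> 'a::{alg_closed_field,field_char_0}"
  assumes "d > 0" "\<exists>i\<le>d. a i \<noteq> 0"
  shows "waring_rank d (form_of d a) = r \<longleftrightarrow> exact_rank d r a"
proof -
  obtain r0 where r0: "decomp d r0 a" using decomp_exists[OF assms] by blast
  have "waring_rank d (form_of d a) = (LEAST r. decomp d r a)"
    unfolding waring_rank_def waring_iff_decomp ..
  moreover have "(LEAST r. decomp d r a) = r \<longleftrightarrow> exact_rank d r a"
  proof
    assume "(LEAST r. decomp d r a) = r"
    then show "exact_rank d r a"
      using assms(2) LeastI[of "\<lambda>r. decomp d r a", OF r0] not_less_Least[of _ "\<lambda>r. decomp d r a"]
      unfolding exact_rank_def by blast
  next
    assume "exact_rank d r a"
    then show "(LEAST r. decomp d r a) = r"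
      unfolding exact_rank_def by (intro Least_equality) (auto simp: not_less[symmetric])
  qed
  ultimately show ?thesis by simp
qed

lemma proj_forms_pt: "proj_forms d = pt d ` {a :: nat \<Rightarrow> 'a::field_char_0. \<exists>i\<le>d. a i \<noteq> 0}"
proof -
  have "binary_forms d - {0} = form_of d ` {a :: nat \<Rightarrow> 'a. \<exists>i\<le>d. a i \<noteq> 0}"
  proof (intro equalityI subsetI)
    fix f :: "'a mpoly" assume f: "f \<in> binary_forms d - {0}"
    obtain a where a: "f = form_of d a" using form_of_surj f by blast
    then have "\<exists>i\<le>d. a i \<noteq> 0" using f form_of_eq_0_iff[of d a] by simp
    then show "f \<in> form_of d ` {a. \<exists>i\<le>d. a i \<noteq> 0}" unfolding a by (intro imageI CollectI)
  next
    fix f :: "'a mpoly" assume "f \<in> form_of d ` {a. \<exists>i\<le>d. a i \<noteq> 0}"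
    then obtain a where a: "f = form_of d a" "\<exists>i\<le>d. a i \<noteq> 0" by (elim imageE CollectE)
    then show "f \<in> binary_forms d - {0}" using form_of_in[of d a] form_of_eq_0_iff[of d a] by simp
  qed
  then show ?thesis unfolding proj_forms_def pt_def by (simp only: image_image)
qed

lemma rank_locus_pt:
  assumes "d > 0"
  shows "rank_locus d r = pt d ` {a :: nat \<Rightarrow> 'a::{alg_closed_field,field_char_0}. exact_rank d r a}"
proof -
  have "{f \<in> binary_forms d - {0}. waring_rank d f = r} = form_of d ` {a :: nat \<Rightarrow> 'a. exact_rank d r a}"
  proof (intro equalityI subsetI)
    fix f :: "'a mpoly" assume f: "f \<in> {f \<in> binary_forms d - {0}. waring_rank d f = r}"
    obtain a where a: "f = form_of d a" using form_of_surj f by blast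
    then have "\<exists>i\<le>d. a i \<noteq> 0" using f form_of_eq_0_iff[of d a] by simp
    then have "exact_rank d r a" using waring_rank_iff[OF assms, of a r] f a by simp
    then show "f \<in> form_of d ` {a. exact_rank d r a}" unfolding a by (intro imageI CollectI)
  next
    fix f :: "'a mpoly" assume "f \<in> form_of d ` {a. exact_rank d r a}"
    then obtain a where a: "f = form_of d a" "exact_rank d r a" by (elim imageE CollectE)
    then have nz: "\<exists>i\<le>d. a i \<noteq> 0" unfolding exact_rank_def by (elim conjE)
    then show "f \<in> {f \<in> binary_forms d - {0}. waring_rank d f = r}"
      using form_of_in[of d a] form_of_eq_0_iff[of d a] waring_rank_iff[OF assms nz, of r] a by simp
  qed
  then show ?thesis unfolding rank_locus_def pt_def by (simp only: image_image)
qed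

lemma rank_locus_subset: "rank_locus d r \<subseteq> proj_forms d"
  by (auto simp: rank_locus_def proj_forms_def)

lemma vanishes_at_pt:
  assumes "F \<in> hom_polys d e"
  shows "vanishes_at d F (pt d a) \<longleftrightarrow> eval_poly F (crd d a) = 0"
  using vanishes_at_class[OF assms] by (simp add: pt_def form_coords_form_of)

lemma closure_of_zariski:
  fixes S :: "'a::field form_point set"
  assumes "S \<subseteq> proj_forms d"
  shows "p \<in> zariski d closure_of S \<longleftrightarrow> p \<in> proj_forms d \<and>
     (\<forall>e. \<forall>F\<in>hom_polys d e. (\<forall>q\<in>S. vanishes_at d F q) \<longrightarrow> vanishes_at d F p)" (is "_ \<longleftrightarrow> ?R")
proof
  assume p: "p \<in> zariski d closure_of S"
  have "vanishes_at d F p" if F: "F \<in> hom_polys d e" "\<forall>q\<in>S. vanishes_at d F q" for e F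
  proof -
    have "closedin (zariski d) (zero_locus d {F})"
      unfolding closedin_zariski using F(1) by (intro exI[of _ "{F}"]) auto
    moreover have "S \<subseteq> zero_locus d {F}" using assms F(2) by (auto simp: zero_locus_def)
    ultimately have "zariski d closure_of S \<subseteq> zero_locus d {F}" by (intro closure_of_minimal)
    then have "p \<in> zero_locus d {F}" using p by (rule subsetD)
    then show ?thesis by (simp add: zero_locus_def)
  qed
  moreover have "p \<in> proj_forms d"
    using subsetD[OF closure_of_subset_topspace p] by (simp add: topspace_zariski)
  ultimately show ?R by (intro conjI allI ballI impI)
next
  assume R: ?R
  have "closedin (zariski d) (zariski d closure_of S)" by simp
  then obtain T where T: "T \<subseteq> (\<Union>e. hom_polys d e)" "zariski d closure_of S = zero_locus d T"
    unfolding closedin_zariski by (elim exE conjE)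
  have S: "S \<subseteq> zero_locus d T"
    using closure_of_subset[of S "zariski d"] assms unfolding T(2) topspace_zariski .
  have "vanishes_at d F p" if F: "F \<in> T" for F
  proof -
    obtain e where "F \<in> hom_polys d e" using F T(1) by blast
    moreover have "\<forall>q\<in>S. vanishes_at d F q" using S F by (auto simp: zero_locus_def)
    ultimately show ?thesis by (rule R[THEN conjunct2, THEN spec, THEN bspec, THEN mp])
  qed
  then show "p \<in> zariski d closure_of S"
    unfolding T(2) zero_locus_def using conjunct1[OF R] by simp
qed

section \<open>Dimension by counting functions\<close>

lemma vanishes_at_mult: "vanishes_at d F p \<Longrightarrow> vanishes_at d (F * G) p"
  by (simp add: vanishes_at_def eval_poly_mult)

lemma closedin_zariski_subset: "closedin (zariski d) Z \<Longrightarrow> Z \<subseteq> proj_forms d"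
  using closedin_subset topspace_zariski by metis

text \<open>\<open>Z\<close> is the union of its intersections with the two hypersurfaces, so one of
  them is all of \<open>Z\<close>.\<close>

lemma irreducible_vanishing_prime:
  assumes irr: "irreducible_closedin (zariski d) Z"
    and F: "F \<in> hom_polys d a" and G: "G \<in> hom_polys d b"
    and FG: "\<forall>p\<in>Z. vanishes_at d (F * G) p"
  shows "(\<forall>p\<in>Z. vanishes_at d F p) \<or> (\<forall>p\<in>Z. vanishes_at d G p)"
proof -
  have Z: "closedin (zariski d) Z" using irr by (simp add: irreducible_closedin_def)
  have cl: "closedin (zariski d) (zero_locus d {H})" if "H \<in> hom_polys d e" for H e
    unfolding closedin_zariski using that by (intro exI[of _ "{H}"]) auto
  have "zero_locus d {F} \<union> zero_locus d {G} = zero_locus d {F' * G' | F' G'. F' \<in> {F} \<and> G' \<in> {G}}"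
    using F G by (intro zero_locus_Un) auto
  moreover have "{F' * G' | F' G'. F' \<in> {F} \<and> G' \<in> {G}} = {F * G}" by auto
  moreover have "Z \<subseteq> zero_locus d {F * G}"
    using FG closedin_zariski_subset[OF Z] by (auto simp: zero_locus_def)
  ultimately have "Z = (Z \<inter> zero_locus d {F}) \<union> (Z \<inter> zero_locus d {G})" by auto
  moreover have "closedin (zariski d) (Z \<inter> zero_locus d {F})" "closedin (zariski d) (Z \<inter> zero_locus d {G})"
    using Z cl[OF F] cl[OF G] by (auto intro: closedin_Int)
  ultimately have "Z = Z \<inter> zero_locus d {F} \<or> Z = Z \<inter> zero_locus d {G}"
    using irr unfolding irreducible_closedin_def by (elim conjE allE) (rule mp, assumption, intro conjI)
  then show ?thesis
  proof
    assume "Z = Z \<inter> zero_locus d {F}"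
    then have "Z \<subseteq> zero_locus d {F}" by (metis inf.cobounded2)
    then show ?thesis by (auto simp: zero_locus_def)
  next
    assume "Z = Z \<inter> zero_locus d {G}"
    then have "Z \<subseteq> zero_locus d {G}" by (metis inf.cobounded2)
    then show ?thesis by (auto simp: zero_locus_def)
  qed
qed

definition indep_family :: "nat \<Rightarrow> 'a::field form_point set \<Rightarrow> nat \<Rightarrow> nat \<Rightarrow> bool" where
  \<comment> \<open>the degree \<open>e\<close> part of the homogeneous coordinate ring of \<open>Z\<close> has dimension at least \<open>N\<close>\<close>
  "indep_family d Z e N \<longleftrightarrow> (\<exists>G. (\<forall>i<N. G i \<in> hom_polys d e) \<and>
     (\<forall>x. (\<forall>p\<in>Z. vanishes_at d (\<Sum>i<N. scale_poly (x i) (G i)) p) \<longrightarrow> (\<forall>i<N. x i = 0)))"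

lemma indep_family_mono:
  assumes "indep_family d Z e N" "Z \<subseteq> Y"
  shows "indep_family d Y e N"
proof -
  obtain G where G: "\<forall>i<N. G i \<in> hom_polys d e"
    "\<forall>x. (\<forall>p\<in>Z. vanishes_at d (\<Sum>i<N. scale_poly (x i) (G i)) p) \<longrightarrow> (\<forall>i<N. x i = 0)"
    using assms(1) unfolding indep_family_def by (elim exE conjE)
  show ?thesis
    unfolding indep_family_def
  proof (intro exI conjI allI impI)
    fix i assume "i < N"
    then show "G i \<in> hom_polys d e" using G(1) by simp
  next
    fix x i assume x: "\<forall>p\<in>Y. vanishes_at d (\<Sum>i<N. scale_poly (x i) (G i)) p" and i: "i < N"
    have "\<forall>p\<in>Z. vanishes_at d (\<Sum>i<N. scale_poly (x i) (G i)) p"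
      using x assms(2) by (intro ballI) (rule bspec, assumption, erule subsetD)
    then show "x i = 0" using G(2)[THEN spec, THEN mp] i by simp
  qed
qed

lemma indep_family_single:
  assumes "F \<in> hom_polys d e" "p \<in> Z" "p \<in> proj_forms d" "\<not> vanishes_at d F p"
  shows "indep_family d Z e 1"
proof -
  have "x = 0" if "vanishes_at d (scale_poly x F) p" for x
  proof (rule ccontr)
    assume "x \<noteq> 0"
    then have "vanishes_at d F p" using that by (simp add: vanishes_at_def)
    then show False using assms by blast
  qed
  then show ?thesis
    unfolding indep_family_def using assms by (intro exI[of _ "\<lambda>_. F"]) auto
qed

lemma sum_lessThan_add: "(\<Sum>i<m + n. f i) = (\<Sum>i<m. f i) + (\<Sum>i<n. f (m + i :: nat))"
  for f :: "nat \<Rightarrow> 'b::comm_monoid_add"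
  by (induction n) (simp_all add: add.assoc)

text \<open>Restriction to \<open>Z\<close> kills the multiples of \<open>F\<close>, so lifts of the
  family on \<open>Z\<close> are independent of them; irreducibility of \<open>Y\<close> makes
  multiplication by \<open>F\<close> injective on the functions on \<open>Y\<close>.\<close>

lemma indep_family_step:
  assumes Y: "irreducible_closedin (zariski d) Y" and "Z \<subseteq> Y"
    and F: "F \<in> hom_polys d A" "\<forall>p\<in>Z. vanishes_at d F p" "\<not> (\<forall>p\<in>Y. vanishes_at d F p)"
    and Z: "indep_family d Z (A + e) M" and YN: "indep_family d Y e N"
  shows "indep_family d Y (A + e) (M + N)"
proof -
  obtain G where G0: "\<forall>i<M. G i \<in> hom_polys d (A + e)"
    "\<forall>x. (\<forall>p\<in>Z. vanishes_at d (\<Sum>i<M. scale_poly (x i) (G i)) p) \<longrightarrow> (\<forall>i<M. x i = 0)"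
    using Z unfolding indep_family_def by (elim exE conjE)
  note G = G0(1)[THEN spec, THEN mp] G0(2)[THEN spec, THEN mp]
  obtain H where H0: "\<forall>i<N. H i \<in> hom_polys d (e)"
    "\<forall>x. (\<forall>p\<in>Y. vanishes_at d (\<Sum>i<N. scale_poly (x i) (H i)) p) \<longrightarrow> (\<forall>i<N. x i = 0)"
    using YN unfolding indep_family_def by (elim exE conjE)
  note H = H0(1)[THEN spec, THEN mp] H0(2)[THEN spec, THEN mp]
  define K where "K i = (if i < M then G i else F * H (i - M))" for i
  have K: "K i \<in> hom_polys d (A + e)" if "i < M + N" for i
    using that G(1) hom_polys_mult[OF F(1) H(1)] by (auto simp: K_def)
  have "\<forall>i<M + N. x i = 0" if x: "\<forall>p\<in>Y. vanishes_at d (\<Sum>i<M + N. scale_poly (x i) (K i)) p" for x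
  proof -
    let ?g = "\<Sum>i<M. scale_poly (x i) (G i)" and ?h = "\<Sum>i<N. scale_poly (x (M + i)) (H i)"
    have eq: "(\<Sum>i<M + N. scale_poly (x i) (K i)) = ?g + F * ?h"
      by (simp add: sum_lessThan_add K_def sum_distrib_left scale_poly_def mult.left_commute)
    have "\<forall>p\<in>Z. vanishes_at d ?g p"
    proof
      fix p assume p: "p \<in> Z"
      have "vanishes_at d (?g + F * ?h) p" using x p \<open>Z \<subseteq> Y\<close> unfolding eq by blast
      moreover have "vanishes_at d (F * ?h) p" using F(2) p by (simp add: vanishes_at_mult)
      ultimately show "vanishes_at d ?g p" by (simp add: vanishes_at_def eval_poly_add)
    qed
    then have x0: "\<forall>i<M. x i = 0" by (rule G(2))
    then have "?g = 0" by (simp add: scale_poly_def)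
    then have "\<forall>p\<in>Y. vanishes_at d (F * ?h) p" using x unfolding eq by simp
    moreover have "?h \<in> hom_polys d e" using H(1) by (intro hom_polys_sum hom_polys_scale) auto
    ultimately have "\<forall>p\<in>Y. vanishes_at d ?h p"
      using irreducible_vanishing_prime[OF Y F(1)] F(3) by blast
    then have x1: "\<forall>i<N. x (M + i) = 0" by (rule H(2))
    show ?thesis
    proof (intro allI impI)
      fix i assume "i < M + N"
      show "x i = 0"
      proof (cases "i < M")
        case False
        then show ?thesis using x1[rule_format, of "i - M"] \<open>i < M + N\<close> by simp
      qed (use x0 in simp)
    qed
  qed
  then show ?thesis unfolding indep_family_def using K by (intro exI[of _ K] conjI allI impI) simp_all
qed

lemma closedin_separate:
  assumes "closedin (zariski d) Z" "p \<notin> Z" "p \<in> proj_forms d"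
  obtains F e where "F \<in> hom_polys d e" "\<forall>q\<in>Z. vanishes_at d F q" "\<not> vanishes_at d F p"
proof -
  obtain T where T: "T \<subseteq> (\<Union>e. hom_polys d e)" "Z = zero_locus d T"
    using assms(1) unfolding closedin_zariski by (elim exE conjE)
  then obtain F where F: "F \<in> T" "\<not> vanishes_at d F p" using assms(2,3) by (auto simp: zero_locus_def)
  then obtain e where "F \<in> hom_polys d e" using T(1) by blast
  then show ?thesis using that F T(2) by (auto simp: zero_locus_def)
qed

definition var :: "nat \<Rightarrow> 'a::comm_semiring_1 mpoly" where
  "var j = Poly_Mapping.single (Poly_Mapping.single j 1) 1"

lemma var_in: "j \<le> d \<Longrightarrow> var j \<in> hom_polys d 1"
  by (simp add: var_def hom_polys_def)

lemma eval_poly_var [simp]: "eval_poly (var j) x = x j"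
  by (simp add: var_def eval_monom_def)

lemma coordinate_not_vanishing:
  fixes p :: "'a::field form_point"
  assumes "p \<in> proj_forms d"
  obtains j where "j \<le> d" "\<And>e. \<not> vanishes_at d (var j ^ e) p"
proof -
  obtain f where f: "f \<in> binary_forms d" "f \<noteq> 0" "p = form_class f" using assms by (auto simp: proj_forms_def)
  have "\<exists>j\<le>d. form_coords d f j \<noteq> 0"
  proof (rule ccontr)
    assume "\<not> ?thesis"
    then have "form_of_coords d (form_coords d f) = 0" by (simp add: form_of_coords_def)
    then show False using f form_of_coords_form_coords by metis
  qed
  then obtain j where j: "j \<le> d" "form_coords d f j \<noteq> 0" by blast
  have "\<not> vanishes_at d (var j ^ e) p" for e
    using vanishes_at_class[OF hom_polys_power[OF var_in[OF j(1)]], of d e f] j(2) f(3)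
    by (simp add: eval.hom_power)
  then show ?thesis using that j(1) by blast
qed

text \<open>Shows that the number of functions supplied by a chain of length \<open>k\<close> grows
  at least like \<open>m ^ k\<close>.\<close>

lemma power_le_binomial_fact: "(m + 1) ^ k \<le> (m + k choose k) * fact k"
proof (induction k)
  case (Suc k)
  have "(m + Suc k choose Suc k) * fact (Suc k) = (Suc k * (Suc (m + k) choose Suc k)) * fact k"
    by (simp only: add_Suc_right fact_Suc of_nat_id mult_ac)
  also have "Suc k * (Suc (m + k) choose Suc k) = (m + k + 1) * (m + k choose k)"
    using Suc_times_binomial_eq[of "m + k" k] by (simp only: mult.commute Suc_eq_plus1)
  finally have eq: "(m + Suc k choose Suc k) * fact (Suc k) = (m + k + 1) * ((m + k choose k) * fact k)"
    by (simp only: mult.assoc)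
  have "(m + 1) ^ Suc k \<le> (m + k + 1) * ((m + k choose k) * fact k)"
    unfolding power_Suc by (rule mult_le_mono[OF _ Suc.IH]) simp
  then show ?case unfolding eq .
qed simp

text \<open>Pascal's rule matches the two ways of producing functions of degree \<open>A(m + 1)\<close> on \<open>Z\<^sub>i\<^sub>+\<^sub>1\<close>:
  lift those from \<open>Z\<^sub>i\<close>, or multiply those of degree \<open>A m\<close> by an equation of \<open>Z\<^sub>i\<close>.\<close>

lemma chain_indep_family:
  fixes Z :: "nat \<Rightarrow> 'a::field form_point set"
  assumes Z: "\<And>i. i \<le> n \<Longrightarrow> irreducible_closedin (zariski d) (Z i)" and p: "\<And>i. i \<le> n \<Longrightarrow> p \<in> Z i"
    and chain: "\<And>i. i < n \<Longrightarrow> Z i \<subset> Z (Suc i)"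
  obtains A where "\<And>m. indep_family d (Z n) (A * m) (m + n choose n)"
proof -
  have sub: "Z i \<subseteq> proj_forms d" if "i \<le> n" for i
    using Z[OF that] closedin_zariski_subset by (auto simp: irreducible_closedin_def)
  have "\<exists>F e. F \<in> hom_polys d e \<and> (\<forall>q\<in>Z i. vanishes_at d F q) \<and> \<not> (\<forall>q\<in>Z (Suc i). vanishes_at d F q)"
    if i: "i < n" for i
  proof -
    obtain q where q: "q \<in> Z (Suc i)" "q \<notin> Z i" using chain[OF i] by blast
    have "closedin (zariski d) (Z i)" using Z[of i] i by (simp add: irreducible_closedin_def)
    moreover have "q \<in> proj_forms d" using q(1) sub[of "Suc i"] i by auto
    ultimately obtain F e where "F \<in> hom_polys d e" "\<forall>q\<in>Z i. vanishes_at d F q" "\<not> vanishes_at d F q"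
      using q(2) by (metis closedin_separate)
    then show ?thesis using q(1) by blast
  qed
  then have "\<forall>i. \<exists>Fe. i < n \<longrightarrow> fst Fe \<in> hom_polys d (snd Fe) \<and> (\<forall>q\<in>Z i. vanishes_at d (fst Fe) q) \<and>
      \<not> (\<forall>q\<in>Z (Suc i). vanishes_at d (fst Fe) q)"
    by (intro allI) (metis fst_conv snd_conv)
  from choice[OF this] obtain Fe where Fe: "\<And>i. i < n \<Longrightarrow> fst (Fe i) \<in> hom_polys d (snd (Fe i))"
    "\<And>i. i < n \<Longrightarrow> \<forall>q\<in>Z i. vanishes_at d (fst (Fe i)) q"
    "\<And>i. i < n \<Longrightarrow> \<not> (\<forall>q\<in>Z (Suc i). vanishes_at d (fst (Fe i)) q)"
    by blast
  define A where "A = (\<Sum>i<n. snd (Fe i))"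
  have pp: "p \<in> proj_forms d" using p[of 0] sub[of 0] by auto
  obtain j where j: "j \<le> d" "\<And>e. \<not> vanishes_at d (var j ^ e) p" using coordinate_not_vanishing[OF pp] by blast
  have varpow: "var j ^ e \<in> hom_polys d e" for e
    using hom_polys_power[OF var_in[OF j(1)], of e] by simp
  \<comment> \<open>The equations are padded to the common degree \<open>A\<close> by powers of a
    coordinate that is nonzero at \<open>p\<close>. As \<open>p\<close> lies on every
    \<open>Z i\<close>, primality keeps the padded equation from vanishing on
    \<open>Z (Suc i)\<close>.\<close>
  define F where "F i = fst (Fe i) * var j ^ (A - snd (Fe i))" for i
  have F: "F i \<in> hom_polys d A" "\<forall>q\<in>Z i. vanishes_at d (F i) q" "\<not> (\<forall>q\<in>Z (Suc i). vanishes_at d (F i) q)"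
    if i: "i < n" for i
  proof -
    have "snd (Fe i) \<le> A" unfolding A_def using i by (intro member_le_sum) auto
    then show "F i \<in> hom_polys d A"
      using hom_polys_mult[OF Fe(1)[OF i] varpow[of "A - snd (Fe i)"]] by (simp add: F_def)
    show "\<forall>q\<in>Z i. vanishes_at d (F i) q" using Fe(2)[OF i] by (simp add: F_def vanishes_at_mult)
    show "\<not> (\<forall>q\<in>Z (Suc i). vanishes_at d (F i) q)"
    proof
      assume "\<forall>q\<in>Z (Suc i). vanishes_at d (F i) q"
      then have "(\<forall>q\<in>Z (Suc i). vanishes_at d (fst (Fe i)) q) \<or> (\<forall>q\<in>Z (Suc i). vanishes_at d (var j ^ (A - snd (Fe i))) q)"
        unfolding F_def using i by (intro irreducible_vanishing_prime[OF Z Fe(1) varpow]) auto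
      then show False using Fe(3)[OF i] j(2) p[of "Suc i"] i by auto
    qed
  qed
  have "\<forall>m. indep_family d (Z i) (A * m) (m + i choose i)" if "i \<le> n" for i
    using that
  proof (induction i)
    case 0
    then show ?case
      using indep_family_single[OF varpow p pp j(2), of 0] by simp
  next
    case (Suc i)
    then have i: "i < n" and IH: "\<forall>m. indep_family d (Z i) (A * m) (m + i choose i)" by simp_all
    show ?case
    proof
      fix m show "indep_family d (Z (Suc i)) (A * m) (m + Suc i choose Suc i)"
      proof (induction m)
        case 0
        then show ?case
          using indep_family_single[OF varpow p pp j(2), of "Suc i" 0] i by simp
      next
        case (Suc m)
        have "indep_family d (Z i) (A + A * m) (Suc m + i choose i)"
          using IH[rule_format, of "Suc m"] by simp
        from indep_family_step[OF Z _ F[OF i] this Suc.IH] chain[OF i] i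
        have "indep_family d (Z (Suc i)) (A + A * m) ((Suc m + i choose i) + (m + Suc i choose Suc i))"
          by auto
        then show ?case by simp
      qed
    qed
  qed
  then show ?thesis using that[of A] by blast
qed

text \<open>A chain with \<open>n + 1\<close> steps would produce families in degree
  \<open>A * m\<close> growing like \<open>m ^ (n + 1)\<close>, against a bound of order
  \<open>m ^ n\<close>.\<close>

lemma local_dim_le:
  fixes X :: "'a::field form_point set"
  assumes bound: "\<And>e N. indep_family d X e N \<Longrightarrow> N \<le> C * (e + 1) ^ n"
  shows "local_dim (zariski d) X p \<le> enat n"
  unfolding local_dim_def
proof (rule Sup_least, elim CollectE exE conjE)
  fix x n' Z
  assume x: "x = enat n'" and Z: "\<forall>i\<le>n'. irreducible_closedin (zariski d) (Z i) \<and> p \<in> Z i \<and> Z i \<subseteq> X"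
    "\<forall>i<n'. Z i \<subset> Z (Suc i)"
  have "n' \<le> n"
  proof (rule ccontr)
    assume "\<not> n' \<le> n"
    then have n: "n + 1 \<le> n'" by simp
    obtain A where A: "\<And>m. indep_family d (Z (n + 1)) (A * m) (m + (n + 1) choose (n + 1))"
      by (rule chain_indep_family[of "n + 1" d Z p]) (use Z n in auto)
    \<comment> \<open>Chosen to absorb all constants: the comparison becomes
      \<open>(m + 1) ^ (n + 1) \<le> m * (m + 1) ^ n\<close>.\<close>
    define m where "m = C * (A + 1) ^ n * fact (n + 1)"
    have "indep_family d X (A * m) (m + (n + 1) choose (n + 1))"
      using indep_family_mono[OF A] Z(1) n by blast
    then have "(m + (n + 1) choose (n + 1)) \<le> C * (A * m + 1) ^ n" by (rule bound)
    also have "\<dots> \<le> C * ((A + 1) * (m + 1)) ^ n" by (intro mult_left_mono power_mono) auto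
    finally have "(m + (n + 1) choose (n + 1)) * fact (n + 1) \<le> C * ((A + 1) * (m + 1)) ^ n * fact (n + 1)"
      by (rule mult_le_mono1)
    also have "\<dots> = C * (A + 1) ^ n * fact (n + 1) * (m + 1) ^ n"
      by (simp only: power_mult_distrib mult_ac)
    also have "\<dots> = m * (m + 1) ^ n" unfolding m_def[symmetric] ..
    finally have "(m + (n + 1) choose (n + 1)) * fact (n + 1) \<le> m * (m + 1) ^ n" .
    then have "(m + 1) ^ (n + 1) \<le> m * (m + 1) ^ n"
      using power_le_binomial_fact[of m "n + 1"] by linarith
    then show False by simp
  qed
  then show "x \<le> enat n" using x by simp
qed

section \<open>Parametrization of the forms of high rank\<close>

text \<open>Parameter layout: indices 0 to \<open>k + 1\<close> are initial values,
  \<open>k + 2\<close> is the double root, \<open>k + 3\<close> to \<open>2 * k + 2\<close> are the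
  lower coefficients of the cofactor. The ring is left open so that the same formulas serve for
  scalars and for the variables \<open>var\<close>.\<close>

definition hco :: "nat \<Rightarrow> (nat \<Rightarrow> 'r::comm_ring_1) \<Rightarrow> nat \<Rightarrow> 'r" where
  "hco k t j = (if j < k then t (k + 3 + j) else if j = k then 1 else 0)"

text \<open>The coefficients of \<open>(x - \<rho>)\<^sup>2 h\<close> for \<open>h\<close> monic of degree \<open>k\<close>, where \<open>\<rho>\<close> is the parameter with
  index \<open>k + 2\<close> and the lower coefficients of \<open>h\<close> are the subsequent ones.\<close>

definition gco :: "nat \<Rightarrow> (nat \<Rightarrow> 'r::comm_ring_1) \<Rightarrow> nat \<Rightarrow> 'r" where
  "gco k t j = (if 2 \<le> j then hco k t (j - 2) else 0) -
     2 * t (k + 2) * (if 1 \<le> j then hco k t (j - 1) else 0) + t (k + 2) * t (k + 2) * hco k t j"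

text \<open>Sequences with a monic characteristic polynomial of degree \<open>n\<close> whose lower
  coefficients are \<open>g\<close>. Monicity avoids division, so the recurrence also makes sense
  over polynomial rings.\<close>

function linrec :: "nat \<Rightarrow> (nat \<Rightarrow> 'r::comm_ring_1) \<Rightarrow> (nat \<Rightarrow> 'r) \<Rightarrow> nat \<Rightarrow> 'r" where
  "linrec n g b i = (if i < n then b i else - (\<Sum>j<n. g j * linrec n g b (i - n + j)))"
  by auto
termination by (relation "measure (\<lambda>(n, g, b, i). i)") auto

declare linrec.simps [simp del]

definition recb :: "nat \<Rightarrow> (nat \<Rightarrow> 'r::comm_ring_1) \<Rightarrow> nat \<Rightarrow> 'r" where
  "recb k t = linrec (k + 2) (gco k t) t"

lemma recb_simps:
  "recb k t i = (if i < k + 2 then t i else - (\<Sum>j<k + 2. gco k t j * recb k t (i - (k + 2) + j)))"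
  unfolding recb_def by (rule linrec.simps)

lemma coeff_double_root_mult:
  fixes q :: "'a::comm_ring_1 poly"
  shows "coeff ([:- x, 1:] ^ 2 * q) j = (if 2 \<le> j then coeff q (j - 2) else 0) -
     2 * x * (if 1 \<le> j then coeff q (j - 1) else 0) + x * x * coeff q j"
proof -
  have "[:- x, 1:] ^ 2 * q = pCons 0 (pCons 0 q) - smult (2 * x) (pCons 0 q) + smult (x * x) q"
    by (simp add: power2_eq_square algebra_simps smult_add_right)
  then show ?thesis
    by (cases j; cases "j - 1") (auto simp: coeff_pCons split: nat.splits)
qed

text \<open>Annihilation of \<open>g * monom 1 (i - n)\<close> is the recurrence at index
  \<open>i\<close>.\<close>

lemma linrec_eq:
  fixes b :: "nat \<Rightarrow> 'a::field"
  assumes ann: "annihilates d b g" and g: "degree g = n" "lead_coeff g = 1"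
    and \<gamma>: "\<And>j. j < n \<Longrightarrow> \<gamma> j = coeff g j" and b0: "\<And>i. i < n \<Longrightarrow> b0 i = b i"
  shows "i \<le> d \<Longrightarrow> linrec n \<gamma> b0 i = b i"
proof (induction i rule: less_induct)
  case (less i)
  show ?case
  proof (cases "i < n")
    case True
    then show ?thesis by (subst linrec.simps) (simp add: b0)
  next
    case False
    have "lam d b (g * monom 1 (i - n)) = 0"
      using ann False less.prems g by (simp add: annihilates_def degree_monom_eq)
    then have "0 = lam d b (monom 1 (i - n) * g)" by (simp only: mult.commute)
    also have "\<dots> = (\<Sum>l<i - n + 1. coeff (monom 1 (i - n)) l * (\<Sum>j<n + 1. coeff g j * b (l + j)))"
      using g False less.prems by (intro lam_mult_expand) (auto simp: degree_monom_eq)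
    also have "\<dots> = (\<Sum>l<i - n + 1. if l = i - n then (\<Sum>j<n + 1. coeff g j * b (l + j)) else 0)"
      by (intro sum.cong) auto
    also have "\<dots> = (\<Sum>j<n + 1. coeff g j * b (i - n + j))" by simp
    also have "\<dots> = (\<Sum>j<n. coeff g j * b (i - n + j)) + 1 * b i"
      using False g by simp
    finally have z: "0 = (\<Sum>j<n. coeff g j * b (i - n + j)) + 1 * b i" .
    have "b i = - (\<Sum>j<n. coeff g j * b (i - n + j))"
      unfolding eq_neg_iff_add_eq_0 add.commute[of "b i"] using z[symmetric] by (simp only: mult_1_left)
    also have "(\<Sum>j<n. coeff g j * b (i - n + j)) = (\<Sum>j<n. \<gamma> j * linrec n \<gamma> b0 (i - n + j))"
      using False less by (intro sum.cong) (auto simp: \<gamma>)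
    also have "- \<dots> = linrec n \<gamma> b0 i" using False by (subst (2) linrec.simps) simp
    finally show ?thesis by simp
  qed
qed

lemma linrec_annihilates:
  fixes g :: "'a::field poly"
  assumes g: "degree g = n" "lead_coeff g = 1"
  shows "annihilates d (linrec n (coeff g) b0) g"
  unfolding annihilates_def
proof (intro allI impI)
  fix p :: "'a poly" assume p: "degree p + degree g \<le> d"
  let ?b = "linrec n (coeff g) b0"
  have "lam d ?b (p * g) = (\<Sum>i<d - n + 1. coeff p i * (\<Sum>j<n + 1. coeff g j * ?b (i + j)))"
    using p g by (intro lam_mult_expand) auto
  also have "\<dots> = 0"
  proof (intro sum.neutral ballI)
    fix i
    have "?b (i + n) = - (\<Sum>j<n. coeff g j * ?b (i + j))" by (subst linrec.simps) simp
    then show "coeff p i * (\<Sum>j<n + 1. coeff g j * ?b (i + j)) = 0" using g by simp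
  qed
  finally show "lam d ?b (g * p) = 0" by (simp only: mult.commute)
qed

lemma recb_eq:
  fixes b :: "nat \<Rightarrow> 'a::field"
  assumes ann: "annihilates d b ([:- x, 1:] ^ 2 * q)" and q: "degree q = k" "lead_coeff q = 1"
    and t: "t = (\<lambda>i. if i < k + 2 then b i else if i = k + 2 then x else coeff q (i - (k + 3)))"
    and i: "i \<le> d"
  shows "recb k t i = b i"
  unfolding recb_def
proof (rule linrec_eq[OF ann _ _ _ _ i])
  have "q \<noteq> 0" using q by auto
  then show "degree ([:- x, 1:] ^ 2 * q) = k + 2" using q by (simp add: degree_mult_eq degree_linear_power)
  show "lead_coeff ([:- x, 1:] ^ 2 * q) = 1"
    unfolding lead_coeff_mult lead_coeff_power using q by simp
  have h: "hco k t j = coeff q j" for j using q by (auto simp: hco_def t coeff_eq_0)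
  then show "gco k t j = coeff ([:- x, 1:] ^ 2 * q) j" for j
    unfolding gco_def coeff_double_root_mult by (simp add: t)
qed (simp add: t)

text \<open>Polynomials in the parameters that are homogeneous of degree \<open>\<alpha>\<close> in the initial values
  and of degree at most \<open>\<beta>\<close> in each remaining parameter.\<close>

definition param_exps :: "nat \<Rightarrow> nat \<Rightarrow> nat \<Rightarrow> (nat \<Rightarrow>\<^sub>0 nat) set" where
  "param_exps k \<alpha> \<beta> = {m. keys m \<subseteq> {..2 * k + 2} \<and>
     (\<Sum>i<k + 2. lookup m i) = \<alpha> \<and> (\<forall>i\<ge>k + 2. lookup m i \<le> \<beta>)}"

definition param_polys :: "nat \<Rightarrow> nat \<Rightarrow> nat \<Rightarrow> 'a::zero mpoly set" where
  "param_polys k \<alpha> \<beta> = {G. keys G \<subseteq> param_exps k \<alpha> \<beta>}"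

lemma param_polys_0 [simp]: "0 \<in> param_polys k \<alpha> \<beta>"
  by (simp add: param_polys_def)

lemma param_polys_mono:
  assumes "G \<in> param_polys k \<alpha> \<beta>" "\<beta> \<le> \<beta>'"
  shows "G \<in> param_polys k \<alpha> \<beta>'"
proof -
  have "param_exps k \<alpha> \<beta> \<subseteq> param_exps k \<alpha> \<beta>'"
    unfolding param_exps_def using assms(2) by (intro Collect_mono impI) (blast intro: le_trans)
  then show ?thesis using assms(1) unfolding param_polys_def by blast
qed

lemma param_polys_add: "F \<in> param_polys k \<alpha> \<beta> \<Longrightarrow> G \<in> param_polys k \<alpha> \<beta> \<Longrightarrow> F + G \<in> param_polys k \<alpha> \<beta>"
  using Poly_Mapping.keys_add[of F G] unfolding param_polys_def by blast

lemma param_polys_uminus: "G \<in> param_polys k \<alpha> \<beta> \<Longrightarrow> - G \<in> param_polys k \<alpha> \<beta>"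
  for G :: "'a::ab_group_add mpoly"
  unfolding param_polys_def by (simp add: keys_def)

lemma param_polys_sum: "(\<And>i. i \<in> I \<Longrightarrow> G i \<in> param_polys k \<alpha> \<beta>) \<Longrightarrow> sum G I \<in> param_polys k \<alpha> \<beta>"
  by (induction I rule: infinite_finite_induct) (auto intro: param_polys_add)

lemma param_polys_const: "Poly_Mapping.single 0 c \<in> param_polys k 0 \<beta>"
  by (auto simp: param_polys_def param_exps_def)

lemma param_polys_one: "1 \<in> param_polys k 0 \<beta>"
  by (auto simp: param_polys_def param_exps_def)

lemma param_polys_mult:
  assumes "F \<in> param_polys k \<alpha> \<beta>" "G \<in> param_polys k \<alpha>' \<beta>'"
  shows "F * G \<in> param_polys k (\<alpha> + \<alpha>') (\<beta> + \<beta>')"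
  unfolding param_polys_def
proof (intro CollectI subsetI)
  fix m assume "m \<in> keys (F * G)"
  then obtain p q where pq: "m = p + q" "p \<in> keys F" "q \<in> keys G"
    using keys_mult[of F G] by auto
  have p: "p \<in> param_exps k \<alpha> \<beta>" and q: "q \<in> param_exps k \<alpha>' \<beta>'"
    using assms pq by (auto simp: param_polys_def)
  have "keys m \<subseteq> {..2 * k + 2}"
    using Poly_Mapping.keys_add[of p q] p q pq(1) unfolding param_exps_def by blast
  then show "m \<in> param_exps k (\<alpha> + \<alpha>') (\<beta> + \<beta>')"
    using p q pq(1) by (auto simp: param_exps_def lookup_add sum.distrib add_mono simp del: sum.lessThan_Suc)
qed

lemma param_polys_power: "F \<in> param_polys k \<alpha> \<beta> \<Longrightarrow> F ^ n \<in> param_polys k (n * \<alpha>) (n * \<beta>)"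
  by (induction n) (auto intro: param_polys_mult simp: param_polys_one)

lemma param_polys_prod:
  "(\<And>i. i \<in> I \<Longrightarrow> G i \<in> param_polys k (\<alpha> i) (\<beta> i)) \<Longrightarrow> prod G I \<in> param_polys k (sum \<alpha> I) (sum \<beta> I)"
  by (induction I rule: infinite_finite_induct) (auto intro: param_polys_mult simp: param_polys_one)

lemma var_param_linear: "i < k + 2 \<Longrightarrow> var i \<in> param_polys k 1 \<beta>"
  by (auto simp: var_def param_polys_def param_exps_def lookup_single when_def)

lemma var_param: "k + 2 \<le> i \<Longrightarrow> i \<le> 2 * k + 2 \<Longrightarrow> var i \<in> param_polys k 0 1"
  by (auto simp: var_def param_polys_def param_exps_def lookup_single when_def)

lemma hco_param: "hco k (var :: nat \<Rightarrow> 'a::comm_ring_1 mpoly) j \<in> param_polys k 0 1"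
  using var_param[of k "k + 3 + j", where 'a = 'a] by (simp add: hco_def param_polys_one)

text \<open>Degree bounds add under multiplication: 2 for the squared double root and 1 for a
  coefficient of the cofactor.\<close>

lemma gco_param: "gco k (var :: nat \<Rightarrow> 'a::comm_ring_1 mpoly) j \<in> param_polys k 0 3"
proof -
  have r: "(var (k + 2) :: 'a mpoly) \<in> param_polys k 0 1" by (rule var_param) auto
  have h: "(if P then hco k var i else 0 :: 'a mpoly) \<in> param_polys k 0 1" for P i
    using hco_param[of k i, where 'a = 'a] by simp
  have two: "(2 :: 'a mpoly) \<in> param_polys k 0 0"
  proof -
    have "(1 + 1 :: 'a mpoly) \<in> param_polys k 0 0" by (intro param_polys_add param_polys_one)
    then show ?thesis by (simp only: one_add_one)
  qed
  have "(if 2 \<le> j then hco k var (j - 2) else 0 :: 'a mpoly) \<in> param_polys k 0 3"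
    using h by (rule param_polys_mono) simp
  moreover have "2 * var (k + 2) * (if 1 \<le> j then hco k var (j - 1) else 0 :: 'a mpoly) \<in> param_polys k 0 3"
  proof (rule param_polys_mono)
    show "2 * var (k + 2) * (if 1 \<le> j then hco k var (j - 1) else 0 :: 'a mpoly) \<in> param_polys k 0 2"
      using param_polys_mult[OF param_polys_mult[OF two r] h] by (simp only: add_0_left one_add_one)
  qed simp
  moreover have "var (k + 2) * var (k + 2) * (hco k var j :: 'a mpoly) \<in> param_polys k 0 3"
    using param_polys_mult[OF param_polys_mult[OF r r] hco_param] by (simp add: numeral_3_eq_3)
  ultimately show ?thesis
    unfolding gco_def diff_conv_add_uminus by (intro param_polys_add param_polys_uminus)
qed

text \<open>One application of the recurrence lowers the index by at least one and costs one
  coefficient, hence 3 in the degree; the initial values enter linearly throughout.\<close>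

lemma recb_param: "recb k (var :: nat \<Rightarrow> 'a::comm_ring_1 mpoly) i \<in> param_polys k 1 (3 * i)"
proof (induction i rule: less_induct)
  case (less i)
  show ?case
  proof (cases "i < k + 2")
    case True
    then show ?thesis using var_param_linear[OF True] by (subst recb_simps) simp
  next
    case False
    have "gco k var j * recb k (var :: nat \<Rightarrow> 'a mpoly) (i - (k + 2) + j) \<in> param_polys k 1 (3 * i)" if "j < k + 2" for j
    proof -
      have lt: "i - (k + 2) + j < i" using that False by simp
      have "gco k var j * recb k (var :: nat \<Rightarrow> 'a mpoly) (i - (k + 2) + j) \<in>
          param_polys k (0 + 1) (3 + 3 * (i - (k + 2) + j))"
        by (rule param_polys_mult[OF gco_param less[OF lt]])
      then show ?thesis using lt by (simp add: param_polys_mono)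
    qed
    then have "- (\<Sum>j<k + 2. gco k var j * recb k (var :: nat \<Rightarrow> 'a mpoly) (i - (k + 2) + j)) \<in> param_polys k 1 (3 * i)"
      by (intro param_polys_uminus param_polys_sum) simp
    then show ?thesis using False by (subst recb_simps) simp
  qed
qed

lemma eval_recb: "eval_poly (recb k var i) t = recb k (t :: nat \<Rightarrow> 'a::comm_ring_1) i"
proof (induction i rule: less_induct)
  case (less i)
  have h: "eval_poly (hco k var j) t = hco k t j" for j by (simp add: hco_def)
  have two: "eval_poly (2 :: 'a mpoly) t = 2" by (metis eval.hom_add eval_poly_one one_add_one)
  have g: "eval_poly (gco k var j) t = gco k t j" for j
    by (simp add: gco_def h two eval.hom_add eval.hom_minus eval.hom_mult if_distrib[of "\<lambda>F. eval_poly F t"])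
  show ?case
  proof (cases "i < k + 2")
    case False
    then have "eval_poly (recb k var i) t = - (\<Sum>j<k + 2. gco k t j * eval_poly (recb k var (i - (k + 2) + j)) t)"
      by (subst recb_simps) (simp add: eval.hom_uminus eval_poly_sum eval_poly_mult g del: sum.lessThan_Suc)
    also have "\<dots> = - (\<Sum>j<k + 2. gco k t j * recb k t (i - (k + 2) + j))"
      using less False by simp
    finally show ?thesis using False by (subst (2) recb_simps) simp
  qed (subst (1 2) recb_simps, simp)
qed

section \<open>Pullback of forms to the parameters and the count of monomials\<close>

definition comp_poly :: "'a::comm_ring_1 mpoly \<Rightarrow> (nat \<Rightarrow> 'a mpoly) \<Rightarrow> 'a mpoly" where
  "comp_poly F G = (\<Sum>m\<in>keys F. Poly_Mapping.single 0 (lookup F m) *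
     (\<Prod>i\<in>keys m. G i ^ lookup m i))"

lemma eval_comp_poly: "eval_poly (comp_poly F G) t = eval_poly F (\<lambda>i. eval_poly (G i) t)"
  by (simp add: comp_poly_def eval_poly_sum eval_poly_mult eval_monom_def eval.hom_prod eval.hom_power)
    (simp add: eval_poly_def eval_monom_def)

lemma comp_poly_param:
  assumes F: "F \<in> hom_polys d e" and G: "\<And>i. i \<le> d \<Longrightarrow> G i \<in> param_polys k 1 B"
  shows "comp_poly F G \<in> param_polys k e (e * B)"
  unfolding comp_poly_def
proof (rule param_polys_sum)
  fix m assume "m \<in> keys F"
  then have m: "keys m \<subseteq> {..d}" "(\<Sum>i\<in>keys m. lookup m i) = e"
    using F unfolding hom_polys_def by auto
  have "(\<Prod>i\<in>keys m. G i ^ lookup m i) \<in>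
     param_polys k (\<Sum>i\<in>keys m. lookup m i * 1) (\<Sum>i\<in>keys m. lookup m i * B)"
    using m(1) by (intro param_polys_prod param_polys_power G) auto
  also have "\<dots> = param_polys k e (e * B)" using m(2) by (simp flip: sum_distrib_right)
  finally show "Poly_Mapping.single 0 (lookup F m) *
      (\<Prod>i\<in>keys m. G i ^ lookup m i) \<in> param_polys k e (e * B)"
    using param_polys_mult[OF param_polys_const[of _ k 0]] by fastforce
qed

text \<open>Homogeneity in the initial values determines the exponent of variable 0 from the others,
  so only \<open>2 * k + 2\<close> of the \<open>2 * k + 3\<close> exponents are free. The saved one
  is the step from the affine cone to the projective variety.\<close>

lemma card_param_exps:
  "finite (param_exps k \<alpha> \<beta>)" "card (param_exps k \<alpha> \<beta>) \<le> (\<alpha> + \<beta> + 1) ^ (2 * k + 2)"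
proof -
  let ?I = "{1..2 * k + 2}"
  define f where "f m = restrict (lookup m) ?I" for m :: "nat \<Rightarrow>\<^sub>0 nat"
  let ?T = "PiE ?I (\<lambda>_. {..\<alpha> + \<beta>})"
  have sum0: "(\<Sum>i<k + 2. g i) = g 0 + (\<Sum>i\<in>{1..<k + 2}. g i)" for g :: "nat \<Rightarrow> nat"
    by (simp add: lessThan_atLeast0 sum.atLeast_Suc_lessThan del: sum.op_ivl_Suc)
  have "inj_on f (param_exps k \<alpha> \<beta>)"
  proof (rule inj_onI)
    fix m m' assume m: "m \<in> param_exps k \<alpha> \<beta>" and m': "m' \<in> param_exps k \<alpha> \<beta>" and eq: "f m = f m'"
    have I: "lookup m i = lookup m' i" if "i \<in> ?I" for i
      using fun_cong[OF eq, of i] that by (simp add: f_def)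
    then have "(\<Sum>i\<in>{1..<k + 2}. lookup m i) = (\<Sum>i\<in>{1..<k + 2}. lookup m' i)"
      by (intro sum.cong) auto
    moreover have "(\<Sum>i<k + 2. lookup m i) = (\<Sum>i<k + 2. lookup m' i)"
      using m m' by (simp add: param_exps_def)
    ultimately have "lookup m 0 = lookup m' 0" unfolding sum0 by simp
    moreover have "lookup m i = 0 \<and> lookup m' i = 0" if "i > 2 * k + 2" for i
    proof -
      have "i \<notin> keys m" "i \<notin> keys m'"
        using m m' that by (auto simp: param_exps_def)
      then show ?thesis by (simp add: in_keys_iff)
    qed
    ultimately show "m = m'"
      using I by (intro poly_mapping_eqI) (metis One_nat_def Suc_leI atLeastAtMost_iff not_gr_zero not_le)
  qed
  moreover have "f ` param_exps k \<alpha> \<beta> \<subseteq> ?T"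
  proof (intro image_subsetI)
    fix m assume m: "m \<in> param_exps k \<alpha> \<beta>"
    have "lookup m i \<le> \<alpha> + \<beta>" for i
    proof (cases "i < k + 2")
      case True
      then have "lookup m i \<le> (\<Sum>i<k + 2. lookup m i)"
        by (intro member_le_sum) auto
      then show ?thesis using m by (simp add: param_exps_def)
    next
      case False
      then show ?thesis using m by (simp add: param_exps_def trans_le_add2)
    qed
    then show "f m \<in> ?T" by (simp add: f_def)
  qed
  moreover have "finite ?T" by (intro finite_PiE) auto
  ultimately show "finite (param_exps k \<alpha> \<beta>)" "card (param_exps k \<alpha> \<beta>) \<le> (\<alpha> + \<beta> + 1) ^ (2 * k + 2)"
    using inj_on_finite[of f _ ?T] card_inj_on_le[of f _ ?T] by (auto simp: card_PiE)
qed

lemma closure_of_zariskiD: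
  assumes "S \<subseteq> proj_forms d" "p \<in> zariski d closure_of S" "F \<in> hom_polys d e"
    and "\<And>q. q \<in> S \<Longrightarrow> vanishes_at d F q"
  shows "vanishes_at d F p"
proof -
  have "\<forall>e. \<forall>F\<in>hom_polys d e. (\<forall>q\<in>S. vanishes_at d F q) \<longrightarrow> vanishes_at d F p"
    using assms(2) unfolding closure_of_zariski[OF assms(1)] by (rule conjunct2)
  then show ?thesis using assms(3,4) by blast
qed

text \<open>Pulled back to the parameters, forms of degree \<open>e\<close> become coefficient
  vectors, with one block for each of the \<open>d + 1\<close> charts. More forms than coordinates
  would admit a nontrivial combination with zero pullback in every chart, and the charts cover the
  locus.\<close>

lemma indep_family_rank_locus_bound:
  fixes d k :: nat
  assumes d: "d > 0" and k: "k + 2 \<le> d" "d div 2 + 1 < d - k"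
    and indep: "indep_family d (rank_locus d (d - k) :: 'a::{alg_closed_field,field_char_0} form_point set) e N"
  shows "N \<le> (d + 1) * (3 * d + 1) ^ (2 * k + 2) * (e + 1) ^ (2 * k + 2)"
proof -
  obtain G :: "nat \<Rightarrow> 'a mpoly" where G0: "\<forall>i<N. G i \<in> hom_polys d e"
    "\<forall>x. (\<forall>p\<in>rank_locus d (d - k). vanishes_at d (\<Sum>i<N. scale_poly (x i) (G i)) p) \<longrightarrow> (\<forall>i<N. x i = 0)"
    using indep unfolding indep_family_def by (elim exE conjE)
  define \<kappa> :: "'a \<Rightarrow> nat \<Rightarrow> nat \<Rightarrow> 'a" where
    "\<kappa> c i j = of_nat (d choose i) * coeff (monom 1 (d - i) * [:1, c:] ^ (d - (d - i))) j" for c i j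
  define co :: "'a \<Rightarrow> nat \<Rightarrow> 'a mpoly" where
    "co c i = (if i \<le> d then \<Sum>j\<le>d. Poly_Mapping.single 0 (\<kappa> c i j) * recb k var j else 0)" for c i
  have co_param: "co c i \<in> param_polys k 1 (3 * d)" for c i
  proof -
    have "Poly_Mapping.single 0 (\<kappa> c i j) * recb k var j \<in> param_polys k 1 (3 * d)" if "j \<le> d" for j
    proof (rule param_polys_mono)
      show "Poly_Mapping.single 0 (\<kappa> c i j) * recb k var j \<in> param_polys k 1 (3 * j)"
        using param_polys_mult[OF param_polys_const[of _ k 0] recb_param] by (metis add_0)
    qed (use that in simp)
    then show ?thesis unfolding co_def by (auto intro: param_polys_sum)
  qed
  have eval_co: "eval_poly (co c i) t = crd d (chart d c (recb k t)) i" for c i t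
    by (simp add: co_def eval_poly_sum eval_poly_mult eval_recb crd_def chart_def lam_def \<kappa>_def eval_monom_def
        sum_distrib_left mult.assoc)
  define K where "K c i = comp_poly (G i) (co c)" for c i
  have K: "K c i \<in> param_polys k e (e * (3 * d))" if "i < N" for c i
    unfolding K_def using G0(1) that by (intro comp_poly_param[of _ d] co_param) auto
  define M where "M = param_exps k e (e * (3 * d))"
  define I where "I = (of_nat ` {..d} :: 'a set) \<times> M"
  have fM: "finite M" unfolding M_def by (rule card_param_exps)
  have fI: "finite I" unfolding I_def using fM by simp
  have "card I \<le> (d + 1) * (e + e * (3 * d) + 1) ^ (2 * k + 2)"
    unfolding I_def card_cartesian_product M_def
    using card_image_le[of "{..d}" "of_nat :: nat \<Rightarrow> 'a"] by (intro mult_le_mono card_param_exps) simp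
  also have "\<dots> \<le> (d + 1) * ((3 * d + 1) * (e + 1)) ^ (2 * k + 2)"
    by (intro mult_le_mono2 power_mono) (auto simp: algebra_simps)
  finally have cI: "card I \<le> (d + 1) * (3 * d + 1) ^ (2 * k + 2) * (e + 1) ^ (2 * k + 2)"
    by (simp only: power_mult_distrib mult.assoc)
  have "N \<le> card I"
  proof (rule ccontr)
    assume "\<not> N \<le> card I"
    then have "card I < N" by simp
    from underdetermined_nontrivial[OF fI this, of "\<lambda>(c, m) i. lookup (K c i) m"]
    obtain x where x': "(\<forall>l\<in>I. (\<Sum>i<N. (case l of (c, m) \<Rightarrow> \<lambda>i. lookup (K c i) m) i * x i) = 0) \<and> (\<exists>i<N. x i \<noteq> 0)"
      by (rule exE)
    have x: "(\<Sum>i<N. lookup (K c i) m * x i) = 0" if "c \<in> of_nat ` {..d}" "m \<in> M" for c m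
      using x'[THEN conjunct1, THEN bspec, of "(c, m)"] that by (simp add: I_def)
    have K0: "(\<Sum>i<N. scale_poly (x i) (K c i)) = 0" if c: "c \<in> of_nat ` {..d}" for c
    proof (rule poly_mapping_eqI)
      fix m
      have lk: "lookup (scale_poly a F) m = a * lookup F m" for a :: 'a and F
        by (simp add: scale_poly_def flip: mult_map_scale_conv_mult)
          (simp add: Poly_Mapping.map.rep_eq when_def)
      show "lookup (\<Sum>i<N. scale_poly (x i) (K c i)) m = lookup 0 m"
      proof (cases "m \<in> M")
        case True
        then show ?thesis using x[OF c True] by (simp add: lookup_sum lk mult.commute)
      next
        case False
        have "lookup (K c i) m = 0" if "i < N" for i
          using K[OF that, of c] False unfolding param_polys_def M_def by (auto simp: in_keys_iff)
        then show ?thesis by (simp add: lookup_sum lk)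
      qed
    qed
    have "\<forall>p\<in>rank_locus d (d - k). vanishes_at d (\<Sum>i<N. scale_poly (x i) (G i)) p"
    proof
      fix p :: "'a form_point" assume "p \<in> rank_locus d (d - k)"
      then obtain a where a: "p = pt d a" "exact_rank d (d - k) a"
        unfolding rank_locus_pt[OF d] by (elim imageE CollectE)
      have nz: "\<exists>i\<le>d. a i \<noteq> 0" and nodec: "\<And>r'. r' < d - k \<Longrightarrow> \<not> decomp d r' a"
        using a(2) by (auto simp: exact_rank_def)
      obtain c y q where c: "c \<in> of_nat ` {..d}" "q \<noteq> 0" "degree ([:- y, 1:] ^ 2 * q) + (d - k) \<le> d + 2"
        "annihilates d (chart d (- c) a) ([:- y, 1:] ^ 2 * q)"
        by (rule high_rank_double_root[OF d nz k(2) nodec])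
      have dq: "degree q \<le> k" using c(2,3) k by (simp add: degree_mult_eq degree_linear_power)
      obtain w where dq': "degree (q * w) = k" and lq': "lead_coeff (q * w) = 1"
        by (rule monic_multiple[OF c(2) dq])
      have ann: "annihilates d (chart d (- c) a) ([:- y, 1:] ^ 2 * (q * w))"
        unfolding mult.assoc[symmetric] by (rule annihilates_mult[OF c(4)])
      \<comment> \<open>The parameters of the given point: its initial moments in the chart, the
        double root, and the lower coefficients of the monic cofactor.\<close>
      define t where "t = (\<lambda>i. if i < k + 2 then chart d (- c) a i else if i = k + 2 then y else coeff (q * w) (i - (k + 3)))"
      note t = recb_eq[OF ann dq' lq' t_def]
      have "crd d (chart d c (recb k t)) = crd d (chart d c (chart d (- c) a))"
        using chart_cong[of d "recb k t" "chart d (- c) a" c, OF t] by simp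
      also have "\<dots> = crd d a" by (rule crd_cong) (rule chart_chart_neg)
      finally have crd: "crd d a = (\<lambda>i. eval_poly (co c i) t)" unfolding eval_co by simp
      have "eval_poly (\<Sum>i<N. scale_poly (x i) (G i)) (crd d a) = eval_poly (\<Sum>i<N. scale_poly (x i) (K c i)) t"
        unfolding crd by (simp add: eval_poly_sum K_def eval_comp_poly)
      also have "\<dots> = 0" using K0[OF c(1)] by simp
      finally have "eval_poly (\<Sum>i<N. scale_poly (x i) (G i)) (crd d a) = 0" .
      moreover have "(\<Sum>i<N. scale_poly (x i) (G i)) \<in> hom_polys d e"
        using G0(1) by (intro hom_polys_sum hom_polys_scale) auto
      ultimately show "vanishes_at d (\<Sum>i<N. scale_poly (x i) (G i)) p"
        unfolding a(1) by (simp add: vanishes_at_pt)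
    qed
    then have "\<forall>i<N. x i = 0" by (rule G0(2)[THEN spec, THEN mp])
    then show False using x'[THEN conjunct2] by auto
  qed
  then show ?thesis using cI by (rule le_trans)
qed

abbreviation (input) rank_closure :: "nat \<Rightarrow> nat \<Rightarrow> 'a::field form_point set" where
  "rank_closure d r \<equiv> zariski d closure_of rank_locus d r"

lemma local_dim_closure_rank_locus:
  fixes d k :: nat
  assumes d: "d > 0" and k: "k + 2 \<le> d" "d div 2 + 1 < d - k"
  shows "local_dim (zariski d) (rank_closure d (d - k) :: 'a::{alg_closed_field,field_char_0} form_point set) p
    \<le> enat (2 * k + 2)"
proof (rule local_dim_le)
  fix e N
  let ?S = "rank_locus d (d - k) :: 'a form_point set"
  assume "indep_family d (zariski d closure_of ?S) e N"
  then obtain G :: "nat \<Rightarrow> 'a mpoly" where G: "\<forall>i<N. G i \<in> hom_polys d e"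
    "\<forall>x. (\<forall>p\<in>zariski d closure_of ?S. vanishes_at d (\<Sum>i<N. scale_poly (x i) (G i)) p) \<longrightarrow> (\<forall>i<N. x i = 0)"
    unfolding indep_family_def by (elim exE conjE)
  have "indep_family d ?S e N"
    unfolding indep_family_def
  proof (intro exI conjI)
    show "\<forall>i<N. G i \<in> hom_polys d e" by (rule G(1))
    show "\<forall>x. (\<forall>p\<in>?S. vanishes_at d (\<Sum>i<N. scale_poly (x i) (G i)) p) \<longrightarrow> (\<forall>i<N. x i = 0)"
    proof (intro allI impI, rule G(2)[THEN spec, THEN mp, THEN spec, THEN mp])
      fix x i assume x: "\<forall>p\<in>?S. vanishes_at d (\<Sum>i<N. scale_poly (x i) (G i)) p"
      have h: "(\<Sum>i<N. scale_poly (x i) (G i)) \<in> hom_polys d e"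
        using G(1) by (intro hom_polys_sum hom_polys_scale) auto
      show "\<forall>p\<in>zariski d closure_of ?S. vanishes_at d (\<Sum>i<N. scale_poly (x i) (G i)) p"
      proof
        fix p assume "p \<in> zariski d closure_of ?S"
        then show "vanishes_at d (\<Sum>i<N. scale_poly (x i) (G i)) p"
          by (rule closure_of_zariskiD[OF rank_locus_subset]) (use h x in auto)
      qed
    qed
  qed
  then show "N \<le> (d + 1) * (3 * d + 1) ^ (2 * k + 2) * (e + 1) ^ (2 * k + 2)"
    by (rule indep_family_rank_locus_bound[OF d k])
qed

section \<open>Tangent vectors along curves\<close>

definition poly_eval :: "'a::comm_ring_1 mpoly \<Rightarrow> (nat \<Rightarrow> 'a poly) \<Rightarrow> 'a poly" where
  "poly_eval F P = (\<Sum>m\<in>keys F. smult (lookup F m)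
     (\<Prod>i\<in>keys m. P i ^ lookup m i))"

lemma poly_poly_eval: "poly (poly_eval F P) t = eval_poly F (\<lambda>i. poly (P i) t)"
  by (simp add: poly_eval_def eval_poly_def eval_monom_def poly_sum poly_prod)

text \<open>On polynomials without terms of positive degree up to \<open>n/2\<close> the coefficient of degree \<open>n\<close>
  is a derivation over the constant term, since two nonconstant terms never multiply to degree
  \<open>n\<close>.\<close>

definition flat :: "nat \<Rightarrow> 'a::zero poly \<Rightarrow> bool" where
  "flat n P \<longleftrightarrow> (\<forall>j. 0 < j \<and> 2 * j \<le> n \<longrightarrow> coeff P j = 0)"

lemma flat_mult:
  fixes P Q :: "'a::comm_ring_1 poly"
  assumes P: "flat n P" and Q: "flat n Q" and n: "0 < n"
  shows "flat n (P * Q)" "coeff (P * Q) n = coeff P 0 * coeff Q n + coeff P n * coeff Q 0"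
proof -
  show "flat n (P * Q)"
    unfolding flat_def
  proof (intro allI impI, elim conjE)
    fix j assume j: "0 < j" "2 * j \<le> n"
    have "coeff P i * coeff Q (j - i) = 0" if "i \<le> j" for i
      using P Q j that by (cases "i = 0") (auto simp: flat_def)
    then show "coeff (P * Q) j = 0" by (simp add: coeff_mult)
  qed
  have z: "coeff P i * coeff Q (n - i) = 0" if "i \<in> {0<..<n}" for i
  proof (cases "2 * i \<le> n")
    case True
    then show ?thesis using P that by (simp add: flat_def)
  next
    case False
    then have "coeff Q (n - i) = 0" using Q that by (simp add: flat_def)
    then show ?thesis by simp
  qed
  have "{..n} = insert 0 (insert n {0<..<n})" using n by auto
  then have "coeff (P * Q) n = coeff P 0 * coeff Q n + (coeff P n * coeff Q 0 + (\<Sum>i\<in>{0<..<n}. coeff P i * coeff Q (n - i)))"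
    using n by (simp add: coeff_mult)
  also have "(\<Sum>i\<in>{0<..<n}. coeff P i * coeff Q (n - i)) = 0" by (intro sum.neutral ballI z)
  finally show "coeff (P * Q) n = coeff P 0 * coeff Q n + coeff P n * coeff Q 0" by simp
qed

lemma flat_one: "flat n 1"
  by (simp add: flat_def)

lemma flat_power:
  fixes P :: "'a::comm_ring_1 poly"
  assumes "flat n P" "0 < n"
  shows "flat n (P ^ l) \<and> coeff (P ^ l) n = of_nat l * coeff P 0 ^ (l - 1) * coeff P n"
proof (induction l)
  case 0
  then show ?case using assms(2) by (simp add: flat_one)
next
  case (Suc l)
  have c0: "coeff (P ^ l) 0 = coeff P 0 ^ l"
    by (induction l) (simp_all add: coeff_mult_0)
  have "coeff (P ^ Suc l) n = coeff P 0 * coeff (P ^ l) n + coeff P n * coeff (P ^ l) 0"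
    using flat_mult[OF assms(1) _ assms(2)] Suc by simp
  also have "\<dots> = coeff P 0 * (of_nat l * coeff P 0 ^ (l - 1) * coeff P n) + coeff P n * coeff P 0 ^ l"
    unfolding c0 conjunct2[OF Suc] ..
  also have "\<dots> = of_nat (Suc l) * coeff P 0 ^ (Suc l - 1) * coeff P n"
    by (cases l) (simp_all add: algebra_simps)
  finally show ?case using flat_mult(1)[OF assms(1) _ assms(2)] Suc by simp
qed

lemma coeff_0_prod: "coeff (\<Prod>i\<in>I. P i) 0 = (\<Prod>i\<in>I. coeff (P i) (0::nat))"
  for P :: "'i \<Rightarrow> 'a::comm_ring_1 poly"
  by (induction I rule: infinite_finite_induct) (simp_all add: coeff_mult_0)

lemma flat_prod:
  fixes P :: "'i \<Rightarrow> 'a::comm_ring_1 poly"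
  assumes "finite I" "\<And>i. i \<in> I \<Longrightarrow> flat n (P i)" "0 < n"
  shows "flat n (\<Prod>i\<in>I. P i) \<and>
    coeff (\<Prod>i\<in>I. P i) n = (\<Sum>i\<in>I. coeff (P i) n * (\<Prod>j\<in>I - {i}. coeff (P j) 0))"
  using assms(1,2)
proof (induction I rule: finite_induct)
  case empty
  then show ?case using assms(3) by (simp add: flat_one)
next
  case (insert i I)
  have IH: "flat n (\<Prod>i\<in>I. P i)" "coeff (\<Prod>i\<in>I. P i) n = (\<Sum>i\<in>I. coeff (P i) n * (\<Prod>j\<in>I - {i}. coeff (P j) 0))"
    using insert by auto
  have "coeff (P i * (\<Prod>i\<in>I. P i)) n =
      coeff (P i) 0 * (\<Sum>l\<in>I. coeff (P l) n * (\<Prod>j\<in>I - {l}. coeff (P j) 0)) + coeff (P i) n * (\<Prod>j\<in>I. coeff (P j) 0)"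
    using flat_mult(2)[OF _ IH(1) assms(3), of "P i"] insert.prems unfolding IH(2) coeff_0_prod by simp
  also have "coeff (P i) 0 * (\<Sum>l\<in>I. coeff (P l) n * (\<Prod>j\<in>I - {l}. coeff (P j) 0)) =
      (\<Sum>l\<in>I. coeff (P l) n * (\<Prod>j\<in>insert i I - {l}. coeff (P j) 0))"
    unfolding sum_distrib_left
  proof (rule sum.cong)
    fix l assume l: "l \<in> I"
    then have "insert i I - {l} = insert i (I - {l})" using insert.hyps by auto
    then show "coeff (P i) 0 * (coeff (P l) n * (\<Prod>j\<in>I - {l}. coeff (P j) 0)) =
        coeff (P l) n * (\<Prod>j\<in>insert i I - {l}. coeff (P j) 0)"
      using insert.hyps by (simp add: mult.left_commute)
  qed simp
  finally have "coeff (\<Prod>i\<in>insert i I. P i) n =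
      (\<Sum>l\<in>I. coeff (P l) n * (\<Prod>j\<in>insert i I - {l}. coeff (P j) 0)) + coeff (P i) n * (\<Prod>j\<in>I. coeff (P j) 0)"
    using insert.hyps by simp
  moreover have "insert i I - {i} = I" using insert.hyps by auto
  ultimately show ?case
    using insert.hyps flat_mult(1)[OF _ IH(1) assms(3), of "P i"] insert.prems by (simp add: add.commute)
qed

lemma eval_partial_deriv:
  "eval_poly (partial_deriv i F) x = (\<Sum>m\<in>keys F.
     of_nat (lookup m i) * lookup F m * eval_monom (m - Poly_Mapping.single i 1) x)"
  by (simp add: partial_deriv_def eval_poly_sum)

text \<open>The chain rule: under flatness only the coefficients of degree 0 and \<open>n\<close> of
  the curve contribute. For \<open>n = 1\<close> flatness is void and this is the usual tangent
  vector.\<close>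

lemma coeff_poly_eval:
  assumes F: "F \<in> hom_polys d e" and P: "\<And>i. i \<le> d \<Longrightarrow> flat n (P i)" and n: "0 < n"
  shows "coeff (poly_eval F P) n =
    (\<Sum>i\<le>d. eval_poly (partial_deriv i F) (\<lambda>i. coeff (P i) 0) * coeff (P i) n)"
proof -
  let ?x = "\<lambda>i. coeff (P i) 0"
  have mono: "coeff (\<Prod>i\<in>keys m. P i ^ lookup m i) n =
      (\<Sum>i\<le>d. of_nat (lookup m i) * eval_monom (m - Poly_Mapping.single i 1) ?x * coeff (P i) n)"
    if "m \<in> keys F" for m
  proof -
    have K: "keys m \<subseteq> {..d}" using F that unfolding hom_polys_def by auto
    have "coeff (\<Prod>i\<in>keys m. P i ^ lookup m i) n =
        (\<Sum>i\<in>keys m. coeff (P i ^ lookup m i) n *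
          (\<Prod>j\<in>keys m - {i}. coeff (P j ^ lookup m j) 0))"
    proof (rule conjunct2[OF flat_prod])
      show "flat n (P i ^ lookup m i)" if "i \<in> keys m" for i
        using K that by (intro flat_power[OF P n, THEN conjunct1]) auto
    qed (use n in auto)
    also have "\<dots> = (\<Sum>i\<in>keys m. of_nat (lookup m i) *
        eval_monom (m - Poly_Mapping.single i 1) ?x * coeff (P i) n)"
    proof (rule sum.cong)
      fix i assume i: "i \<in> keys m"
      have "keys (m - Poly_Mapping.single i 1) \<subseteq> keys m"
        by (auto simp: in_keys_iff lookup_minus)
      then have "eval_monom (m - Poly_Mapping.single i 1) ?x =
          (\<Prod>j\<in>keys m. ?x j ^ lookup (m - Poly_Mapping.single i 1) j)"
        by (intro eval_monom_mono) auto
      also have "\<dots> = ?x i ^ (lookup m i - 1) *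
          (\<Prod>j\<in>keys m - {i}. ?x j ^ lookup (m - Poly_Mapping.single i 1) j)"
        using i by (subst prod.remove[of _ i]) (auto simp: lookup_minus lookup_single)
      also have "(\<Prod>j\<in>keys m - {i}. ?x j ^ lookup (m - Poly_Mapping.single i 1) j) =
          (\<Prod>j\<in>keys m - {i}. coeff (P j ^ lookup m j) 0)"
        by (intro prod.cong) (auto simp: lookup_minus lookup_single coeff_0_power)
      finally have em: "eval_monom (m - Poly_Mapping.single i 1) ?x = ?x i ^ (lookup m i - 1) *
          (\<Prod>j\<in>keys m - {i}. coeff (P j ^ lookup m j) 0)" .
      have "coeff (P i ^ lookup m i) n =
          of_nat (lookup m i) * ?x i ^ (lookup m i - 1) * coeff (P i) n"
        using flat_power[OF P n] K i by auto
      then show "coeff (P i ^ lookup m i) n *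
          (\<Prod>j\<in>keys m - {i}. coeff (P j ^ lookup m j) 0) =
          of_nat (lookup m i) * eval_monom (m - Poly_Mapping.single i 1) ?x * coeff (P i) n"
        unfolding em by (simp only: mult_ac)
    qed simp
    also have "\<dots> = (\<Sum>i\<le>d. of_nat (lookup m i) *
        eval_monom (m - Poly_Mapping.single i 1) ?x * coeff (P i) n)"
      by (rule sum.mono_neutral_left) (use K in \<open>auto simp: in_keys_iff\<close>)
    finally show ?thesis .
  qed
  have "coeff (poly_eval F P) n = (\<Sum>m\<in>keys F. lookup F m *
      (\<Sum>i\<le>d. of_nat (lookup m i) * eval_monom (m - Poly_Mapping.single i 1) ?x * coeff (P i) n))"
    by (simp add: poly_eval_def coeff_sum mono)
  also have "\<dots> = (\<Sum>i\<le>d. \<Sum>m\<in>keys F. lookup F m *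
      (of_nat (lookup m i) * eval_monom (m - Poly_Mapping.single i 1) ?x * coeff (P i) n))"
    unfolding sum_distrib_left by (rule sum.swap)
  also have "\<dots> = (\<Sum>i\<le>d. eval_poly (partial_deriv i F) ?x * coeff (P i) n)"
    unfolding eval_partial_deriv sum_distrib_right by (intro sum.cong refl) (simp only: mult_ac)
  finally show ?thesis .
qed

section \<open>Tangent vectors of curves of moment sequences\<close>

abbreviation (input) differential :: "nat \<Rightarrow> 'a mpoly \<Rightarrow> (nat \<Rightarrow> 'a) \<Rightarrow> (nat \<Rightarrow> 'a::comm_ring_1) \<Rightarrow> 'a" where
  "differential d F x w \<equiv> (\<Sum>i\<le>d. eval_poly (partial_deriv i F) x * w i)"

definition tangent :: "nat \<Rightarrow> 'a::field mpoly \<Rightarrow> (nat \<Rightarrow> 'a) \<Rightarrow> (nat \<Rightarrow> 'a) \<Rightarrow> bool" where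
  "tangent d F a w \<longleftrightarrow> differential d F (crd d a) (crd d w) = 0"

lemma crd_diff: "crd d (\<lambda>i. a i - b i) i = crd d a i - crd d b i"
  by (simp add: crd_def algebra_simps)

lemma tangent_diff: "tangent d F a v \<Longrightarrow> tangent d F a w \<Longrightarrow> tangent d F a (\<lambda>i. v i - w i)"
  by (simp add: tangent_def crd_diff right_diff_distrib sum_subtractf)

lemma tangent_scale: "c \<noteq> 0 \<Longrightarrow> tangent d F a (\<lambda>i. c * w i) \<Longrightarrow> tangent d F a w"
  by (simp add: tangent_def crd_scale mult.left_commute flip: sum_distrib_left)

lemma crd_chart_linear: "\<exists>\<kappa>. \<forall>b i. crd d (chart d c b) i = (\<Sum>j\<le>d. \<kappa> i j * b j)"
proof -
  define \<kappa> where "\<kappa> i j = (if i \<le> d then of_nat (d choose i) * coeff (monom 1 (d - i) * [:1, c:] ^ (d - (d - i))) j else 0)" for i j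
  have "crd d (chart d c b) i = (\<Sum>j\<le>d. \<kappa> i j * b j)" for b i
    by (simp add: crd_def chart_def lam_def \<kappa>_def sum_distrib_left mult.assoc)
  then show ?thesis by (intro exI allI)
qed

text \<open>Along a polynomial curve \<open>F\<close> becomes a polynomial with cofinitely many
  zeros, hence 0; so its value at an excluded \<open>t\<close> and its coefficient of degree
  \<open>n\<close> vanish as well.\<close>

lemma curve_vanishing:
  fixes p :: "nat \<Rightarrow> 'a::field_char_0 poly"
  assumes F: "F \<in> hom_polys d e" and B: "finite B"
    and van: "\<And>t. t \<notin> B \<Longrightarrow> eval_poly F (crd d (chart d c (\<lambda>j. poly (p j) t))) = 0"
  shows "eval_poly F (crd d (chart d c (\<lambda>j. poly (p j) t))) = 0"
    and "0 < n \<Longrightarrow> (\<And>j. j \<le> d \<Longrightarrow> flat n (p j)) \<Longrightarrow>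
      tangent d F (chart d c (\<lambda>j. coeff (p j) 0)) (chart d c (\<lambda>j. coeff (p j) n))"
proof -
  obtain \<kappa> where \<kappa>: "\<And>b i. crd d (chart d c b) i = (\<Sum>j\<le>d. \<kappa> i j * b j)"
    using crd_chart_linear[of d c] by (elim exE) simp
  define P where "P i = (\<Sum>j\<le>d. smult (\<kappa> i j) (p j))" for i
  have poly: "(\<lambda>i. poly (P i) t) = crd d (chart d c (\<lambda>j. poly (p j) t))" for t
    by (rule ext) (simp add: P_def poly_sum \<kappa>)
  have coeff: "coeff (P i) l = crd d (chart d c (\<lambda>j. coeff (p j) l)) i" for i l
    by (simp add: P_def coeff_sum \<kappa>)
  have zero: "poly_eval F P = 0"
  proof (rule poly_eqI_cofinite[OF B])
    fix t assume "t \<notin> B"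
    then show "poly (poly_eval F P) t = poly 0 t" using van by (simp add: poly_poly_eval poly)
  qed
  show "eval_poly F (crd d (chart d c (\<lambda>j. poly (p j) t))) = 0"
    using zero poly_poly_eval[of F P t] unfolding poly by simp
  assume n: "0 < n" and flat: "\<And>j. j \<le> d \<Longrightarrow> flat n (p j)"
  have "flat n (P i)" for i
    using flat unfolding flat_def P_def by (auto simp: coeff_sum)
  then have "0 = (\<Sum>i\<le>d. eval_poly (partial_deriv i F) (\<lambda>i. coeff (P i) 0) * coeff (P i) n)"
    using coeff_poly_eval[OF F _ n, of P] zero by simp
  then show "tangent d F (chart d c (\<lambda>j. coeff (p j) 0)) (chart d c (\<lambda>j. coeff (p j) n))"
    unfolding tangent_def coeff by simp
qed

lemma exact_rankI:
  fixes b :: "nat \<Rightarrow> 'a::field_char_0"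
  assumes "decomp d r b" "\<And>r'. r' < r \<Longrightarrow> \<not> decomp d r' b" "0 < r"
  shows "exact_rank d r (chart d c b)"
proof -
  have "\<exists>i\<le>d. chart d c b i \<noteq> 0"
  proof (rule ccontr)
    assume "\<not> ?thesis"
    then have "decomp d 0 (chart d c b)" by (simp add: decomp_def)
    then show False using assms(2,3) by (simp add: decomp_chart_iff)
  qed
  then show ?thesis using assms(1,2) by (simp add: exact_rank_def decomp_chart_iff)
qed

lemma tangent_seq_exact:
  fixes b :: "nat \<Rightarrow> 'a::{alg_closed_field,field_char_0}"
  assumes "finite S" "x0 \<notin> S" "\<beta> \<noteq> 0" "\<And>x. x \<in> S \<Longrightarrow> e x \<noteq> 0"
    and b: "\<And>i. i \<le> d \<Longrightarrow> b i = \<alpha> * hasse_pt x0 0 i + \<beta> * hasse_pt x0 1 i + (\<Sum>x\<in>S. e x * hasse_pt x 0 i)"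
    and d: "2 * card S + 2 \<le> d"
  shows "exact_rank d (d - card S) (chart d c b)"
proof (rule exact_rankI)
  show "decomp d (d - card S) b" by (rule tangent_seq_decomp[OF assms])
  show "\<not> decomp d r' b" if "r' < d - card S" for r'
    using that by (intro tangent_seq_no_decomp[OF assms(1-3) b]) auto
qed (use d in simp)

lemma secant_seq_exact:
  fixes b :: "nat \<Rightarrow> 'a::{alg_closed_field,field_char_0}"
  assumes "finite S" "\<And>x. x \<in> S \<Longrightarrow> e x \<noteq> 0" "S \<noteq> {}"
    and b: "\<And>i. i \<le> d \<Longrightarrow> b i = (\<Sum>x\<in>S. e x * hasse_pt x 0 i)"
    and d: "2 * card S \<le> d"
  shows "exact_rank d (card S) (chart d c b)"
proof (rule exact_rankI)
  have "card S > 0" using assms(1,3) by (simp add: card_gt_0_iff)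
  then show "0 < card S" .
  show "decomp d (card S) b"
    using assms(1) b d \<open>card S > 0\<close> by (intro decomp_points[of S _ d b e]) (auto simp: hasse_pt_0)
  show "\<not> decomp d r' b" if "r' < card S" for r'
    using that d by (intro secant_seq_no_decomp[OF assms(1,2) b]) auto
qed

lemma secant_tangents:
  fixes b :: "nat \<Rightarrow> 'a::{alg_closed_field,field_char_0}"
  assumes F: "F \<in> hom_polys d e'" and van: "\<And>a. exact_rank d (d - k) a \<Longrightarrow> eval_poly F (crd d a) = 0"
    and S: "finite S" "card S = k + 1" and e: "\<And>x. x \<in> S \<Longrightarrow> e x \<noteq> 0"
    and b: "b = (\<lambda>i. \<Sum>x\<in>S. e x * hasse_pt x 0 i)"
    and d: "2 * k + 2 \<le> d" and x: "x \<in> S"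
  shows "eval_poly F (crd d (chart d c b)) = 0"
    and "m < 4 \<Longrightarrow> tangent d F (chart d c b) (chart d c (hasse_pt x m))"
proof -
  let ?S = "S - {x}"
  have S': "finite ?S" "x \<notin> ?S" "card ?S = k" using S x by auto
  have bx: "b i = e x * hasse_pt x 0 i + (\<Sum>y\<in>?S. e y * hasse_pt y 0 i)" for i
    unfolding b using S x by (simp add: sum.remove)
  have van': "eval_poly F (crd d (chart d c b')) = 0"
    if "z \<notin> ?S" "\<beta> \<noteq> 0" "\<And>i. b' i = \<alpha> * hasse_pt z 0 i + \<beta> * hasse_pt z 1 i + (\<Sum>y\<in>?S. e y * hasse_pt y 0 i)"
    for b' z \<alpha> \<beta>
    using tangent_seq_exact[of ?S z \<beta> e d b' \<alpha> c] that S' d e by (intro van) auto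
  \<comment> \<open>Adding \<open>t\<close> times the derivative at \<open>x\<close> gives a form of
    rank \<open>d - k\<close> for \<open>t \<noteq> 0\<close>. A multiple \<open>\<alpha>\<close> of
    the evaluation at \<open>x\<close> may be added freely; the cases 0 and 1 separate the two
    directions.\<close>
  have line: "eval_poly F (crd d (chart d c b)) = 0 \<and> tangent d F (chart d c b) (chart d c (\<lambda>i. \<alpha> * hasse_pt x 0 i + hasse_pt x 1 i))" for \<alpha>
  proof -
    define p where "p i = [:b i, \<alpha> * hasse_pt x 0 i + hasse_pt x 1 i:]" for i
    have p: "eval_poly F (crd d (chart d c (\<lambda>j. poly (p j) t))) = 0" if "t \<notin> {0}" for t
      using that by (intro van'[of x t _ "e x + t * \<alpha>"]) (auto simp: p_def bx algebra_simps)
    have fin: "finite {0 :: 'a}" by simp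
    have "flat 1 (p j)" for j by (auto simp: flat_def)
    then show ?thesis
      using curve_vanishing(1)[OF F fin p, where t = 0] curve_vanishing(2)[OF F fin p, of 1]
      by (simp add: p_def)
  qed
  show "eval_poly F (crd d (chart d c b)) = 0" using line by blast
  have t1: "tangent d F (chart d c b) (chart d c (hasse_pt x 1))"
    using line[of 0] by simp
  have t0: "tangent d F (chart d c b) (chart d c (hasse_pt x 0))"
  proof -
    have "tangent d F (chart d c b) (\<lambda>i. chart d c (\<lambda>i. 1 * hasse_pt x 0 i + hasse_pt x 1 i) i - chart d c (hasse_pt x 1) i)"
      using line[of 1] t1 by (intro tangent_diff) auto
    then show ?thesis by (simp add: chart_add)
  qed
  \<comment> \<open>The point \<open>x\<close> moves to \<open>x + t\<close>, and the derivative
    term with weight \<open>- t * e x\<close> cancels the change of first order.\<close>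
  define p where "p i = [:\<Sum>y\<in>?S. e y * hasse_pt y 0 i:] + smult (e x) ([:x, 1:] ^ i - pCons 0 (pderiv ([:x, 1:] ^ i)))" for i
  have p_poly: "poly (p i) t = e x * hasse_pt (x + t) 0 i + (- t * e x) * hasse_pt (x + t) 1 i + (\<Sum>y\<in>?S. e y * hasse_pt y 0 i)" for i t
    by (simp add: p_def hasse_pt_def pderiv_power pderiv_pCons poly_power algebra_simps)
  have p: "eval_poly F (crd d (chart d c (\<lambda>j. poly (p j) t))) = 0" if "t \<notin> insert 0 ((\<lambda>y. y - x) ` ?S)" for t
  proof (rule van')
    show "x + t \<notin> ?S"
    proof
      assume "x + t \<in> ?S"
      then have "t \<in> (\<lambda>y. y - x) ` ?S" by (intro image_eqI[of _ _ "x + t"]) auto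
      then show False using that by blast
    qed
    show "- t * e x \<noteq> 0" using that e x by auto
  qed (rule p_poly)
  have p0: "coeff (p i) 0 = b i" for i by (simp add: p_def bx coeff_translate_power hasse_pt_0)
  \<comment> \<open>The factor \<open>- of_nat l\<close> vanishes for \<open>l = 0\<close>, which is
    the cusp, and is nonzero for \<open>l = 1, 2\<close> in characteristic zero.\<close>
  have pn: "coeff (p i) (Suc l) = - of_nat l * e x * hasse_pt x (Suc l) i" for i l
    by (simp add: p_def coeff_translate_power coeff_pderiv algebra_simps)
  \<comment> \<open>For \<open>n = 2, 3\<close> only the coefficient of degree 1 has to vanish;
    \<open>n = 4\<close> would also require that of degree 2, whence the bound
    \<open>m < 4\<close>.\<close>
  have flat: "flat n (p i)" if "n < 4" for n i
    unfolding flat_def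
  proof (intro allI impI)
    fix j assume "0 < j \<and> 2 * j \<le> n"
    then have "j = Suc 0" using that by simp
    then show "coeff (p i) j = 0" by (simp only: pn) simp
  qed
  have fin: "finite (insert 0 ((\<lambda>y. y - x) ` ?S))" using S'(1) by simp
  have t23: "tangent d F (chart d c b) (chart d c (hasse_pt x (Suc l)))" if l: "l \<noteq> 0" "Suc l < 4" for l
  proof -
    have "tangent d F (chart d c (\<lambda>j. coeff (p j) 0)) (chart d c (\<lambda>j. coeff (p j) (Suc l)))"
      by (rule curve_vanishing(2)[OF F fin p]) (use l flat in simp_all)
    then have "tangent d F (chart d c b) (\<lambda>i. (- of_nat l * e x) * chart d c (hasse_pt x (Suc l)) i)"
      unfolding p0 pn chart_scale[abs_def] .
    then show ?thesis by (rule tangent_scale[rotated]) (use l e x in auto)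
  qed
  show "tangent d F (chart d c b) (chart d c (hasse_pt x m))" if "m < 4"
  proof (cases m)
    case 0
    then show ?thesis using t0 by simp
  next
    case (Suc l)
    then show ?thesis using t1 t23[of l] that by (cases "l = 0") auto
  qed
qed

section \<open>Semicontinuity of the tangent space\<close>

text \<open>Hermite interpolation: if \<open>n\<close> is the highest order with a nonzero
  coefficient at \<open>x\<close>, a polynomial vanishing to order exactly \<open>n\<close> at
  \<open>x\<close> and to order \<open>\<mu> y\<close> at the other points \<open>y\<close> isolates
  that coefficient. Its degree is below the sum of the multiplicities, hence at most
  \<open>d\<close>.\<close>

lemma hasse_pt_independent:
  fixes \<mu> :: "'a::field \<Rightarrow> nat"
  assumes S: "finite S" and \<mu>: "(\<Sum>x\<in>S. \<mu> x) \<le> d + 1"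
    and zero: "\<And>i. i \<le> d \<Longrightarrow> (\<Sum>x\<in>S. \<Sum>m<\<mu> x. c x m * hasse_pt x m i) = 0"
  shows "\<forall>x\<in>S. \<forall>m<\<mu> x. c x m = 0"
proof (rule ccontr)
  assume "\<not> ?thesis"
  then obtain x m0 where x: "x \<in> S" "m0 < \<mu> x" "c x m0 \<noteq> 0" by blast
  define n where "n = (GREATEST m. m < \<mu> x \<and> c x m \<noteq> 0)"
  have n: "n < \<mu> x \<and> c x n \<noteq> 0"
    unfolding n_def by (rule GreatestI_nat[where b = "\<mu> x"]) (use x in auto)
  have gt: "c x l = 0" if "n < l" "l < \<mu> x" for l
  proof (rule ccontr)
    assume "c x l \<noteq> 0"
    then have "l \<le> n" unfolding n_def by (intro Greatest_le_nat[where b = "\<mu> x"]) (use that in auto)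
    then show False using that by simp
  qed
  define R where "R = (\<Prod>y\<in>S - {x}. [:- y, 1:] ^ \<mu> y)"
  define Q where "Q = [:- x, 1:] ^ n * R"
  have "degree R = (\<Sum>y\<in>S - {x}. \<mu> y)"
    unfolding R_def by (subst degree_prod_eq_sum_degree) (auto simp: degree_linear_power)
  then have "degree Q \<le> n + (\<Sum>y\<in>S - {x}. \<mu> y)"
    unfolding Q_def by (intro order.trans[OF degree_mult_le]) (simp add: degree_linear_power)
  also have "\<dots> < \<mu> x + (\<Sum>y\<in>S - {x}. \<mu> y)" using n by simp
  also have "\<dots> = (\<Sum>y\<in>S. \<mu> y)" using S x(1) by (simp add: sum.remove)
  finally have dQ: "degree Q \<le> d" using \<mu> by simp
  have trans: "coeff (pcompose ([:- y, 1:] ^ l * T) [:y, 1:]) j = (if j < l then 0 else coeff (pcompose T [:y, 1:]) (j - l))"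
    for y :: 'a and l j T
  proof -
    have lin: "pcompose [:- y, 1:] [:y, 1:] = [:0, 1:]" by (simp add: pcompose_pCons)
    have "pcompose ([:- y, 1:] ^ l) [:y, 1:] = monom 1 l"
    proof (induction l)
      case (Suc l)
      show ?case unfolding power_Suc pcompose_mult lin Suc by (simp add: monom_Suc)
    qed (simp add: pcompose_1)
    then show ?thesis by (simp add: pcompose_mult coeff_monom_mult)
  qed
  have other: "lam d (hasse_pt y j) Q = 0" if "y \<in> S" "y \<noteq> x" "j < \<mu> y" for y j
  proof -
    have "Q = [:- y, 1:] ^ \<mu> y * ([:- x, 1:] ^ n * (\<Prod>z\<in>S - {x} - {y}. [:- z, 1:] ^ \<mu> z))"
      unfolding Q_def R_def using S that by (subst prod.remove[of _ y]) (auto simp: mult_ac)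
    then have "coeff (pcompose Q [:y, 1:]) j = 0" using that(3) by (simp only: trans if_True)
    then show ?thesis using dQ by (simp add: lam_hasse_pt)
  qed
  have self: "lam d (hasse_pt x j) Q = (if j < n then 0 else coeff (pcompose R [:x, 1:]) (j - n))" for j
    using dQ unfolding Q_def by (simp add: lam_hasse_pt trans)
  have "0 = lam d (\<lambda>i. \<Sum>y\<in>S. \<Sum>j<\<mu> y. c y j * hasse_pt y j i) Q"
    using lam_cong[of d "\<lambda>i. \<Sum>y\<in>S. \<Sum>j<\<mu> y. c y j * hasse_pt y j i" "\<lambda>i. 0" Q] zero by simp
  also have "\<dots> = (\<Sum>y\<in>S. \<Sum>j<\<mu> y. c y j * lam d (hasse_pt y j) Q)"
    by (simp only: lam_seq_sum lam_seq_scale)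
  also have "\<dots> = (\<Sum>y\<in>S. if y = x then \<Sum>j<\<mu> x. c x j * lam d (hasse_pt x j) Q else 0)"
    by (intro sum.cong) (auto simp: other)
  also have "\<dots> = (\<Sum>j<\<mu> x. c x j * lam d (hasse_pt x j) Q)" using S x(1) by simp
  also have "\<dots> = (\<Sum>j<\<mu> x. if j = n then c x n * poly R x else 0)"
  proof (intro sum.cong refl)
    fix j assume "j \<in> {..<\<mu> x}"
    then show "c x j * lam d (hasse_pt x j) Q = (if j = n then c x n * poly R x else 0)"
      using gt[of j] unfolding self by (cases j n rule: linorder_cases) auto
  qed
  also have "\<dots> = c x n * poly R x" using n by simp
  finally have "c x n * poly R x = 0" by simp
  moreover have "poly R x \<noteq> 0" using S by (auto simp: R_def poly_prod)
  ultimately show False using n by simp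
qed

lemma partial_deriv_in:
  assumes "F \<in> hom_polys d e" "i \<le> d"
  shows "partial_deriv i F \<in> hom_polys d (e - 1)"
  unfolding partial_deriv_def
proof (rule hom_polys_sum)
  fix m assume m: "m \<in> keys F"
  let ?m = "m - Poly_Mapping.single i 1"
  have K: "keys m \<subseteq> {..d}" "(\<Sum>j\<in>keys m. lookup m j) = e"
    using assms(1) m unfolding hom_polys_def by auto
  have K': "keys ?m \<subseteq> {..d}"
  proof
    fix x assume "x \<in> keys ?m"
    then have "x \<in> keys m" by (auto simp: in_keys_iff lookup_minus)
    then show "x \<in> {..d}" using K(1) by blast
  qed
  show "Poly_Mapping.single ?m (of_nat (lookup m i) * lookup F m) \<in> hom_polys d (e - 1)"
  proof (cases "lookup m i = 0")
    case False
    have deg: "(\<Sum>j\<in>keys q. lookup q j) = (\<Sum>j\<le>d. lookup q j)"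
      if "keys q \<subseteq> {..d}" for q :: "nat \<Rightarrow>\<^sub>0 nat"
      by (rule sum.mono_neutral_left) (use that in \<open>auto simp: in_keys_iff\<close>)
    have "(\<Sum>j\<le>d. lookup ?m j) + (\<Sum>j\<le>d. if j = i then 1 else 0) = (\<Sum>j\<le>d. lookup m j)"
      unfolding sum.distrib[symmetric] using False
      by (intro sum.cong) (auto simp: lookup_minus lookup_single)
    then have "(\<Sum>j\<in>keys ?m. lookup ?m j) = e - 1"
      unfolding deg[OF K'] using K deg[OF K(1)] assms(2) by simp
    then show ?thesis using K' by (simp add: hom_polys_def)
  qed simp
qed

text \<open>Openness of the rank of the Jacobian matrix: as few as possible of its \<open>d + 1\<close> independent rows
  are taken to be unit vectors, namely those with index in \<open>J\<close>; the determinant of the resulting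
  matrix is a homogeneous polynomial that does not vanish at \<open>x0\<close>.\<close>

lemma tangent_dimension_semicontinuous:
  fixes \<F> :: "'a::field mpoly set" and V :: "(nat \<Rightarrow> 'a) set"
  assumes hom: "\<F> \<subseteq> (\<Union>e. hom_polys d e)"
    and dense: "\<And>D e. D \<in> hom_polys d e \<Longrightarrow> (\<And>x. x \<in> V \<Longrightarrow> eval_poly D x = 0) \<Longrightarrow> eval_poly D x0 = 0"
    and indep: "\<And>x. x \<in> V \<Longrightarrow> \<exists>W. (\<forall>l<M. \<forall>F\<in>\<F>. differential d F x (W l) = 0) \<and>
      (\<forall>y. (\<forall>i\<le>d. (\<Sum>l<M. y l * W l i) = 0) \<longrightarrow> (\<forall>l<M. y l = 0))"
  obtains J w where "J \<subseteq> {..d}" "M \<le> card J" "\<And>j i. j \<in> J \<Longrightarrow> i \<in> J \<Longrightarrow> w j i = (if i = j then 1 else 0 :: 'a)"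
    "\<And>j F. j \<in> J \<Longrightarrow> F \<in> \<F> \<Longrightarrow> differential d F x0 (w j) = 0"
proof -
  note sum.lessThan_Suc [simp del]
  define A :: "nat set \<Rightarrow> (nat \<Rightarrow> 'a mpoly) \<Rightarrow> nat \<Rightarrow> nat \<Rightarrow> 'a mpoly" where
    "A J R i j = (if i \<in> J then (if j = i then 1 else 0) else partial_deriv j (R i))" for J R i j
  have evA: "eval_poly (A J R i j) x = (if i \<in> J then (if j = i then 1 else 0) else eval_poly (partial_deriv j (R i)) x)" for J R i j x
    by (simp add: A_def)
  have rowJ: "(\<Sum>j<d + 1. eval_poly (A J R i j) x * w j) = w i" if "i \<in> J" "i \<le> d" for J R i x w
  proof -
    have "(\<Sum>j<d + 1. eval_poly (A J R i j) x * w j) = (\<Sum>j<d + 1. if j = i then w j else 0)"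
      using that by (intro sum.cong) (auto simp: evA)
    then show ?thesis using that by simp
  qed
  have rowR: "(\<Sum>j<d + 1. eval_poly (A J R i j) x * w j) = differential d (R i) x w"
    if "i \<notin> J" for J R i x w
    using that by (simp add: evA lessThan_Suc_atMost)
  define P where "P J \<longleftrightarrow> J \<subseteq> {..d} \<and> (\<exists>R. (\<forall>i\<in>{..d} - J. R i \<in> \<F>) \<and> trivial_kernel (d + 1) (\<lambda>i j. eval_poly (A J R i j) x0))" for J
  have "P {..d}"
  proof -
    have "trivial_kernel (d + 1) (\<lambda>i j. eval_poly (A {..d} (\<lambda>_. 0) i j) x0)"
      unfolding trivial_kernel_def
    proof (intro allI impI)
      fix w j assume "\<forall>i<d + 1. (\<Sum>j<d + 1. eval_poly (A {..d} (\<lambda>_. 0) i j) x0 * w j) = 0" "j < d + 1"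
      then show "w j = 0" using rowJ[of j "{..d}" "\<lambda>_. 0" x0 w] by simp
    qed
    then show ?thesis unfolding P_def by (intro conjI exI[of _ "\<lambda>_. 0"]) auto
  qed
  from ex_has_least_nat[where P = P and k = "{..d}" and m = card, OF \<open>P {..d}\<close>]
  obtain J where J': "P J \<and> (\<forall>J'. P J' \<longrightarrow> card J \<le> card J')" by (rule exE)
  note J = J'[THEN conjunct1] J'[THEN conjunct2, rule_format]
  obtain R where R: "\<forall>i\<in>{..d} - J. R i \<in> \<F>" "trivial_kernel (d + 1) (\<lambda>i j. eval_poly (A J R i j) x0)"
    using J(1) unfolding P_def by (elim conjE exE)
  have JJ: "J \<subseteq> {..d}" using J(1) by (simp add: P_def)
  then have fJ: "finite J" by (rule finite_subset) simp
  \<comment> \<open>The columns of the inverse matrix. Those with index in \<open>J\<close> restrict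
    to unit vectors on \<open>J\<close> and are tangent to the equations in the remaining
    rows.\<close>
  have "\<forall>j. \<exists>w. \<forall>i<d + 1. (\<Sum>l<d + 1. eval_poly (A J R i l) x0 * w l) = (if i = j then 1 else 0)"
    using trivial_kernel_solvable[OF R(2)] by (intro allI)
  from choice[OF this] obtain w where w: "\<forall>j. \<forall>i<d + 1. (\<Sum>l<d + 1. eval_poly (A J R i l) x0 * w j l) = (if i = j then 1 else 0)"
    by (rule exE)
  have wJ: "w j i = (if i = j then 1 else 0)" if "j \<in> J" "i \<in> J" for i j
    using w[rule_format, of i j] rowJ[of i J R x0 "w j"] that JJ by (auto simp: subset_iff)
  have wR: "differential d (R i) x0 (w j) = 0" if "j \<in> J" "i \<le> d" "i \<notin> J" for i j
  proof -
    have "i \<noteq> j" using that by auto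
    then show ?thesis using w[rule_format, of i j] rowR[of i J R x0 "w j"] that by simp
  qed
  \<comment> \<open>If \<open>w j\<close> were not tangent to some \<open>F\<close>, the gradient of
    \<open>F\<close> could replace the unit row \<open>j\<close> and keep the matrix invertible,
    against the minimal choice of \<open>J\<close>.\<close>
  have wF: "differential d F x0 (w j) = 0" if j: "j \<in> J" and F: "F \<in> \<F>" for j F
  proof (rule ccontr)
    assume ne: "differential d F x0 (w j) \<noteq> 0"
    define J' where "J' = J - {j}"
    define R' where "R' = R(j := F)"
    have "trivial_kernel (d + 1) (\<lambda>i l. eval_poly (A J' R' i l) x0)"
      unfolding trivial_kernel_def
    proof (intro allI impI)
      fix v l assume v: "\<forall>i<d + 1. (\<Sum>l<d + 1. eval_poly (A J' R' i l) x0 * v l) = 0" and l: "l < d + 1"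
      \<comment> \<open>Subtracting this multiple of \<open>w j\<close> moves a kernel vector of the
        new matrix into the kernel of the old one.\<close>
      define u where "u l = v l - v j * w j l" for l
      have vj: "differential d F x0 v = 0"
        using v[rule_format, of j] rowR[of j J' R' x0 v] j JJ by (auto simp: J'_def R'_def subset_iff)
      have "(\<Sum>l<d + 1. eval_poly (A J R i l) x0 * u l) = 0" if i: "i < d + 1" for i
      proof (cases "i \<in> J")
        case True
        have "u i = 0"
        proof (cases "i = j")
          case False
          then have "v i = 0" using v[rule_format, OF i] rowJ[of i J' R' x0 v] True i by (simp add: J'_def)
          then show ?thesis using wJ[OF j True] False by (simp add: u_def)
        qed (use wJ[OF j j] in \<open>simp add: u_def\<close>)
        then show ?thesis using rowJ[OF True, of R x0 u] i by simp
      next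
        case False
        then have "i \<noteq> j" using j by auto
        then have "differential d (R i) x0 v = 0"
          using v[rule_format, OF i] rowR[of i J' R' x0 v] False by (simp add: J'_def R'_def)
        then have "differential d (R i) x0 u = 0"
          using wR[OF j _ False] i
          by (simp add: u_def right_diff_distrib sum_subtractf mult.left_commute[of _ "v j"] flip: sum_distrib_left)
        then show ?thesis using rowR[OF False, of R x0 u] by simp
      qed
      then have u0: "u l = 0" if "l < d + 1" for l using R(2) that unfolding trivial_kernel_def by blast
      have "differential d F x0 v = v j * differential d F x0 (w j)"
        unfolding sum_distrib_left
      proof (intro sum.cong refl)
        fix l assume "l \<in> {..d}"
        then have "v l = v j * w j l" using u0[of l] by (simp add: u_def)
        then show "eval_poly (partial_deriv l F) x0 * v l = v j * (eval_poly (partial_deriv l F) x0 * w j l)"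
          by (simp only: mult.left_commute)
      qed
      then have "v j = 0" using vj ne by simp
      then show "v l = 0" using u0[OF l] by (simp add: u_def)
    qed
    moreover have "\<forall>i\<in>{..d} - J'. R' i \<in> \<F>" using R(1) F by (auto simp: J'_def R'_def)
    ultimately have "P J'" unfolding P_def using JJ by (auto simp: J'_def)
    then have "card J \<le> card J'" by (rule J(2))
    then show False using j fJ unfolding J'_def by (metis card_Diff1_less not_le)
  qed
  \<comment> \<open>With fewer than \<open>M\<close> unit rows, the same matrix would be invertible
    at some \<open>x \<in> V\<close>, yet a nontrivial combination of the \<open>M\<close> tangent
    vectors there, with zero entries on \<open>J\<close>, would lie in its kernel.\<close>
  have "M \<le> card J"
  proof (rule ccontr)
    assume "\<not> M \<le> card J"
    then have lt: "card J < M" by simp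
    have "\<exists>e. \<forall>i\<in>{..d} - J. R i \<in> hom_polys d (e i)" using R(1) hom by (intro bchoice) blast
    then obtain e where e: "\<And>i. i \<in> {..d} - J \<Longrightarrow> R i \<in> hom_polys d (e i)" by (elim exE) blast
    have A: "A J R i j \<in> hom_polys d (if i \<in> J then 0 else e i - 1)" if "i < d + 1" "j < d + 1" for i j
    proof (cases "i \<in> J")
      case False
      then have "R i \<in> hom_polys d (e i)" using that by (intro e) simp
      then show ?thesis using partial_deriv_in[of "R i" d "e i" j] that False by (simp add: A_def)
    qed (simp add: A_def hom_polys_one)
    have "\<exists>D\<in>hom_polys d (\<Sum>i<d + 1. if i \<in> J then 0 else e i - 1).
        \<forall>x. eval_poly D x \<noteq> 0 \<longleftrightarrow> trivial_kernel (d + 1) (\<lambda>i j. eval_poly (A J R i j) x)"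
      by (rule hom_det_poly) (rule A)
    then obtain D where D: "D \<in> hom_polys d (\<Sum>i<d + 1. if i \<in> J then 0 else e i - 1)"
      "\<And>x. eval_poly D x \<noteq> 0 \<longleftrightarrow> trivial_kernel (d + 1) (\<lambda>i j. eval_poly (A J R i j) x)"
      by (elim bexE) simp
    have "eval_poly D x0 \<noteq> 0" using D(2) R(2) by simp
    then obtain x where x: "x \<in> V" "eval_poly D x \<noteq> 0" using dense[OF D(1)] by blast
    obtain W where W: "\<forall>l<M. \<forall>F\<in>\<F>. differential d F x (W l) = 0"
      "\<forall>y. (\<forall>i\<le>d. (\<Sum>l<M. y l * W l i) = 0) \<longrightarrow> (\<forall>l<M. y l = 0)"
      using indep[OF x(1)] by (elim exE conjE)
    from underdetermined_nontrivial[OF fJ lt, of "\<lambda>i l. W l i"]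
    obtain y where y: "(\<forall>i\<in>J. (\<Sum>l<M. W l i * y l) = 0) \<and> (\<exists>l<M. y l \<noteq> 0)" by (rule exE)
    define u where "u i = (\<Sum>l<M. y l * W l i)" for i
    have "(\<Sum>j<d + 1. eval_poly (A J R i j) x * u j) = 0" if i: "i < d + 1" for i
    proof (cases "i \<in> J")
      case True
      then show ?thesis using rowJ[OF True, of R x u] i y by (simp add: u_def mult.commute)
    next
      case False
      then have "R i \<in> \<F>" using R(1) i by simp
      have "differential d (R i) x u = (\<Sum>l<M. y l * differential d (R i) x (W l))"
        unfolding u_def sum_distrib_left by (subst sum.swap) (simp only: mult.left_commute)
      also have "\<dots> = 0" using W(1) \<open>R i \<in> \<F>\<close> by (intro sum.neutral) simp
      finally show ?thesis using rowR[OF False, of R x u] by simp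
    qed
    moreover have "trivial_kernel (d + 1) (\<lambda>i j. eval_poly (A J R i j) x)" using D(2) x(2) by simp
    ultimately have "\<forall>i<d + 1. u i = 0" unfolding trivial_kernel_def by blast
    then have "\<forall>l<M. y l = 0" using W(2)[THEN spec[of _ y]] by (simp add: u_def)
    then show False using y by auto
  qed
  then show ?thesis using that[of J w] JJ wJ wF by blast
qed

lemma card_le_dim:
  fixes T :: "'a::field mpoly set"
  assumes J: "finite J" and T: "T \<subseteq> binary_forms d" and v: "\<And>j. j \<in> J \<Longrightarrow> v j \<in> T"
    and unit: "\<And>i j. i \<in> J \<Longrightarrow> j \<in> J \<Longrightarrow> form_coords d (v j) i = (if i = j then 1 else 0)"
  shows "card J \<le> mpoly.dim T"
proof -
  have inj: "inj_on v J"
  proof (rule inj_onI)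
    fix i j assume "i \<in> J" "j \<in> J" "v i = v j"
    then show "i = j" using unit[of i i] unit[of i j] by (auto split: if_splits)
  qed
  have ind: "mpoly.independent (v ` J)"
    unfolding mpoly.independent_explicit_finite_subsets
  proof (intro allI impI ballI)
    fix B u x assume B: "B \<subseteq> v ` J" "finite B" and u: "(\<Sum>x\<in>B. scale_poly (u x) x) = 0" and x: "x \<in> B"
    obtain i where i: "i \<in> J" "x = v i" using B x by blast
    have "0 = form_coords d (\<Sum>x\<in>B. scale_poly (u x) x) i" unfolding u by (simp add: form_coords_zero)
    also have "\<dots> = (\<Sum>y\<in>B. u y * form_coords d y i)" by (simp add: form_coords_sum form_coords_scale)
    also have "\<dots> = (\<Sum>y\<in>B. if y = x then u y else 0)"
    proof (rule sum.cong)
      fix y assume "y \<in> B"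
      then obtain j where j: "j \<in> J" "y = v j" using B by blast
      then have "y = x \<longleftrightarrow> j = i" using i inj by (auto dest: inj_onD)
      then show "u y * form_coords d y i = (if y = x then u y else 0)" using unit[OF i(1) j(1)] j(2) by auto
    qed simp
    also have "\<dots> = u x" using B(2) x by simp
    finally show "u x = 0" by simp
  qed
  obtain B where B: "B \<subseteq> T" "mpoly.independent B" "T \<subseteq> mpoly.span B" "card B = mpoly.dim T"
    using mpoly.basis_exists[of T] by blast
  \<comment> \<open>The ambient space has infinite dimension, and \<open>card\<close> of an infinite
    basis would be 0; the monomials of degree \<open>d\<close> show that the basis of
    \<open>T\<close> is finite.\<close>
  define M where "M = (\<lambda>i. Poly_Mapping.single (uv_monom (d - i) i) (1 :: 'a)) ` {..d}"
  have "binary_forms d \<subseteq> mpoly.span M"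
  proof
    fix f :: "'a mpoly" assume "f \<in> binary_forms d"
    then have "f = (\<Sum>i\<le>d. scale_poly (form_coords d f i) (Poly_Mapping.single (uv_monom (d - i) i) 1))"
      using form_of_coords_form_coords[of f d] by (simp add: form_of_coords_def scale_poly_def mult_single)
    also have "\<dots> \<in> mpoly.span M"
      by (intro mpoly.span_sum mpoly.span_scale mpoly.span_base) (auto simp: M_def)
    finally show "f \<in> mpoly.span M" .
  qed
  then have "finite B"
    using mpoly.independent_span_bound[of M B] B(1,2) T by (auto simp: M_def)
  then have "card (v ` J) \<le> card B"
    using mpoly.independent_span_bound[of B "v ` J"] ind v B(3) by blast
  then show ?thesis using inj B(4) by (simp add: card_image)
qed

section \<open>Singularity along the secant variety\<close>

text \<open>Up to sign the elementary symmetric functions of the roots, by a recursion over any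
  commutative ring: the roots will be polynomials in a curve parameter.\<close>

primrec root_coeffs :: "(nat \<Rightarrow> 'r::comm_ring_1) \<Rightarrow> nat \<Rightarrow> nat \<Rightarrow> 'r" where
  "root_coeffs r 0 j = (if j = 0 then 1 else 0)"
| "root_coeffs r (Suc n) j = (if j = 0 then 0 else root_coeffs r n (j - 1)) - r n * root_coeffs r n j"

lemma coeff_prod_linear: "coeff (\<Prod>i<n. [:- r i, 1:]) j = root_coeffs r n j"
proof (induction n arbitrary: j)
  case (Suc n)
  show ?case
    by (cases j) (simp_all add: Suc mult.commute[of _ "pCons _ _"] algebra_simps)
qed simp

lemma poly_root_coeffs: "poly (root_coeffs r n j) t = root_coeffs (\<lambda>i. poly (r i) t) n j"
  by (induction n arbitrary: j) simp_all

lemma poly_linrec: "poly (linrec n g b i) t = linrec n (\<lambda>j. poly (g j) t) (\<lambda>j. poly (b j) t) i"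
proof (induction i rule: less_induct)
  case (less i)
  show ?case
  proof (cases "i < n")
    case True
    then show ?thesis by (simp add: linrec.simps)
  next
    case False
    then have "poly (linrec n g b i) t = - (\<Sum>j<n. poly (g j) t * poly (linrec n g b (i - n + j)) t)"
      by (subst linrec.simps) (simp add: poly_sum)
    also have "\<dots> = - (\<Sum>j<n. poly (g j) t * linrec n (\<lambda>j. poly (g j) t) (\<lambda>j. poly (b j) t) (i - n + j))"
      using less False by simp
    finally show ?thesis using False by (subst (2) linrec.simps) simp
  qed
qed

lemma monic_splits:
  fixes g :: "'a::alg_closed_field poly"
  assumes "lead_coeff g = 1"
  obtains r where "g = (\<Prod>i<degree g. [:- r i, 1:])"
proof -
  have "g \<noteq> 0" using assms by auto
  then obtain A where A: "size A = degree g" "g = smult (lead_coeff g) (\<Prod>x\<in>#A. [:- x, 1:])"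
    using alg_closed_imp_factorization by blast
  obtain xs where xs: "mset xs = A" using ex_mset by blast
  have "(\<Prod>x\<in>#A. [:- x, 1:]) = prod_list (map (\<lambda>x. [:- x, 1:]) xs)"
    unfolding xs[symmetric] by (simp flip: prod_mset_prod_list)
  also have "\<dots> = (\<Prod>i<length xs. [:- (xs ! i), 1:])"
    by (simp add: prod.list_conv_set_nth atLeast0LessThan)
  finally have "g = (\<Prod>i<degree g. [:- (xs ! i), 1:])"
    using A assms xs by (metis size_mset smult_1_left)
  then show ?thesis by (rule that)
qed

text \<open>Zero weights lower the rank. Adding a common \<open>t\<close> makes all weights nonzero
  for all but finitely many \<open>t\<close>, and the value at \<open>t = 0\<close> follows along
  this line.\<close>

lemma vanishing_on_secants:
  fixes F :: "'a::{alg_closed_field,field_char_0} mpoly"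
  assumes F: "F \<in> hom_polys d e'" and van: "\<And>a. exact_rank d (card T) a \<Longrightarrow> eval_poly F (crd d a) = 0"
    and T: "finite T" "T \<noteq> {}" "2 * card T \<le> d" and b: "\<And>i. i \<le> d \<Longrightarrow> b i = (\<Sum>x\<in>T. e x * x ^ i)"
  shows "eval_poly F (crd d (chart d c b)) = 0"
proof -
  define p where "p i = [:\<Sum>x\<in>T. e x * x ^ i, \<Sum>x\<in>T. x ^ i:]" for i
  have fin: "finite ((\<lambda>x. - e x) ` T)" using T(1) by simp
  have p: "eval_poly F (crd d (chart d c (\<lambda>i. poly (p i) t))) = 0" if t: "t \<notin> (\<lambda>x. - e x) ` T" for t
  proof (rule van, rule secant_seq_exact[OF T(1) _ T(2) _ T(3)])
    show "e x + t \<noteq> 0" if "x \<in> T" for x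
      using t that by (auto simp: add_eq_0_iff)
    show "poly (p i) t = (\<Sum>x\<in>T. (e x + t) * hasse_pt x 0 i)" for i
      by (simp add: p_def hasse_pt_0 distrib_right sum.distrib sum_distrib_left)
  qed
  have "eval_poly F (crd d (chart d c (\<lambda>i. poly (p i) 0))) = 0"
    by (rule curve_vanishing(1)[OF F fin p])
  moreover have "chart d c (\<lambda>i. poly (p i) 0) = chart d c b"
    by (rule chart_cong) (simp add: p_def b)
  ultimately show ?thesis by simp
qed

text \<open>The roots \<open>r\<^sub>i\<close> of the annihilator are separated by moving them to \<open>r\<^sub>i + i t\<close>.\<close>

lemma vanishing_on_annihilated:
  fixes F :: "'a::{alg_closed_field,field_char_0} mpoly"
  assumes F: "F \<in> hom_polys d e'" and van: "\<And>a. exact_rank d n a \<Longrightarrow> eval_poly F (crd d a) = 0"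
    and n: "0 < n" "2 * n \<le> d" and ann: "annihilates d b g" "degree g = n" "lead_coeff g = 1"
  shows "eval_poly F (crd d (chart d c b)) = 0"
proof -
  obtain r where r: "g = (\<Prod>i<n. [:- r i, 1:])" using monic_splits[OF ann(3)] ann(2) by metis
  define s where "s t i = r i + of_nat i * t" for t i
  \<comment> \<open>Only the recurrence moves with \<open>t\<close>; the initial values stay those
    of \<open>b\<close>, so \<open>t = 0\<close> recovers \<open>b\<close>.\<close>
  define p where "p = linrec n (root_coeffs (\<lambda>i. [:r i, of_nat i:]) n) (\<lambda>i. [:b i:])"
  have p: "poly (p i) t = linrec n (coeff (\<Prod>i<n. [:- s t i, 1:])) b i" for i t
    unfolding p_def poly_linrec poly_root_coeffs coeff_prod_linear[abs_def] by (simp add: s_def mult.commute)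
  \<comment> \<open>Contains the parameters at which two roots collide. For \<open>i = j\<close>
    division by zero puts 0 into \<open>B\<close>, harmless since \<open>curve_vanishing\<close>
    reaches excluded parameters.\<close>
  define B where "B = (\<lambda>(i, j). (r j - r i) / (of_nat i - of_nat j)) ` ({..<n} \<times> {..<n})"
  have fin: "finite B" by (simp add: B_def)
  have "eval_poly F (crd d (chart d c (\<lambda>i. poly (p i) t))) = 0" if t: "t \<notin> B" for t
  proof -
    have inj: "inj_on (s t) {..<n}"
    proof (rule inj_onI, rule ccontr)
      fix i j assume ij: "i \<in> {..<n}" "j \<in> {..<n}" "s t i = s t j" "i \<noteq> j"
      have "(of_nat i - of_nat j) * t = r j - r i" using ij(3) by (simp add: s_def algebra_simps)
      then have "t = (r j - r i) / (of_nat i - of_nat j)" using ij(4) by (simp add: field_simps)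
      then have "t \<in> B" unfolding B_def using ij(1,2) by (intro image_eqI[of _ _ "(i, j)"]) auto
      then show False using t by blast
    qed
    define T where "T = s t ` {..<n}"
    have T: "finite T" "card T = n" "T \<noteq> {}" using n inj by (auto simp: T_def card_image)
    have g: "(\<Prod>i<n. [:- s t i, 1:]) = roots_poly T"
      unfolding T_def by (simp add: prod.reindex[OF inj])
    have "annihilates d (linrec n (coeff (roots_poly T)) b) (roots_poly T)"
    proof (rule linrec_annihilates)
      show "lead_coeff (roots_poly T) = 1" by (subst lead_coeff_prod) simp
    qed (simp add: T)
    then obtain e where e: "\<forall>i\<le>d. linrec n (coeff (roots_poly T)) b i = (\<Sum>x\<in>T. e x * x ^ i)"
      using annihilates_roots_poly_decomp[OF T(1), of d] T(2) n by fastforce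
    show ?thesis
      using T n e van by (intro vanishing_on_secants[OF F _ T(1), of _ e]) (auto simp: p g)
  qed
  from curve_vanishing(1)[OF F fin this, of 0]
  have "eval_poly F (crd d (chart d c (\<lambda>i. poly (p i) 0))) = 0" .
  moreover have "chart d c (\<lambda>i. poly (p i) 0) = chart d c b"
  proof (rule chart_cong)
    fix i assume "i \<le> d"
    then show "poly (p i) 0 = b i"
      unfolding p by (intro linrec_eq[OF ann]) (simp_all add: s_def r)
  qed
  ultimately show ?thesis by simp
qed

text \<open>A generic chart has no nonzero summand at infinity. Equal points are collected and zero
  weights dropped; minimality of the rank shows that exactly \<open>n\<close> points remain.\<close>

lemma exact_secant_form:
  fixes a :: "nat \<Rightarrow> 'a::{alg_closed_field,field_char_0}"
  assumes d: "d > 0" and a: "exact_rank d n a"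
  obtains c S e where "finite S" "card S = n" "\<And>x. x \<in> S \<Longrightarrow> e x \<noteq> 0"
    "crd d a = crd d (chart d c (\<lambda>i. \<Sum>x\<in>S. e x * hasse_pt x 0 i))"
proof -
  obtain p q where pq: "\<forall>i\<le>d. a i = (\<Sum>j<n. p j ^ i * q j ^ (d - i))"
    using a unfolding exact_rank_def decomp_def by (elim conjE exE)
  \<comment> \<open>With this \<open>c\<close>, \<open>w j = 0\<close> forces \<open>p j = 0\<close>
    and so \<open>q j = 0\<close>: the summand is the zero form, and the default
    \<open>p j / w j = 0\<close> receives weight 0 from it.\<close>
  obtain c where c: "c \<notin> (\<lambda>j. q j / p j) ` {..<n}"
    using ex_new_if_finite[OF infinite_UNIV_char_0, of "(\<lambda>j. q j / p j) ` {..<n}"] by auto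
  define w where "w j = q j - c * p j" for j
  define b where "b = chart d (- c) a"
  have w0: "p j = 0" if "j < n" "w j = 0" for j
  proof (rule ccontr)
    assume "p j \<noteq> 0"
    then have "c = q j / p j" using that(2) by (simp add: w_def field_simps)
    then show False using c that(1) by blast
  qed
  define S0 where "S0 = (\<lambda>j. p j / w j) ` {..<n}"
  define e where "e x = (\<Sum>j | j < n \<and> p j / w j = x. w j ^ d)" for x
  define S where "S = {x \<in> S0. e x \<noteq> 0}"
  have b: "b i = (\<Sum>x\<in>S. e x * x ^ i)" if i: "i \<le> d" for i
  proof -
    have "b = chart d (- c) (\<lambda>i. \<Sum>j<n. p j ^ i * q j ^ (d - i))"
      unfolding b_def by (rule chart_cong) (use pq in simp)
    then have "b i = (\<Sum>j<n. p j ^ i * w j ^ (d - i))"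
      using i by (simp add: chart_sum chart_power w_def)
    also have "\<dots> = (\<Sum>j<n. w j ^ d * (p j / w j) ^ i)"
    proof (rule sum.cong)
      fix j assume j: "j \<in> {..<n}"
      show "p j ^ i * w j ^ (d - i) = w j ^ d * (p j / w j) ^ i"
      proof (cases "w j = 0")
        case True
        then have "p j = 0" using w0 j by simp
        then show ?thesis using True d i by (simp add: power_0_left)
      next
        case False
        then show ?thesis using i by (simp add: power_divide power_diff)
      qed
    qed simp
    also have "\<dots> = (\<Sum>x\<in>S0. \<Sum>j | j \<in> {..<n} \<and> p j / w j = x. w j ^ d * (p j / w j) ^ i)"
      unfolding S0_def by (rule sum.image_gen) simp
    also have "\<dots> = (\<Sum>x\<in>S0. e x * x ^ i)"
      unfolding e_def sum_distrib_right by (intro sum.cong) auto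
    also have "\<dots> = (\<Sum>x\<in>S. e x * x ^ i)"
      by (rule sum.mono_neutral_right) (auto simp: S_def S0_def)
    finally show ?thesis .
  qed
  have fS: "finite S" by (simp add: S_def S0_def)
  have "card S \<le> card S0" by (intro card_mono) (auto simp: S_def S0_def)
  also have "\<dots> \<le> n" unfolding S0_def using card_image_le[of "{..<n}"] by simp
  finally have "card S \<le> n" .
  moreover have "\<not> card S < n"
  proof
    assume "card S < n"
    moreover have "decomp d (card S) b" by (rule decomp_points[OF fS order_refl d b])
    then have "decomp d (card S) a" unfolding b_def by (simp add: decomp_chart_iff)
    ultimately show False using a by (auto simp: exact_rank_def)
  qed
  ultimately have "card S = n" by simp
  moreover have "crd d a = crd d (chart d c (\<lambda>i. \<Sum>x\<in>S. e x * hasse_pt x 0 i))"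
  proof (rule crd_cong)
    fix i assume i: "i \<le> d"
    have "chart d c (\<lambda>i. \<Sum>x\<in>S. e x * hasse_pt x 0 i) = chart d c b"
      by (rule chart_cong) (simp add: b hasse_pt_0)
    then show "a i = chart d c (\<lambda>i. \<Sum>x\<in>S. e x * hasse_pt x 0 i) i"
      using chart_chart_neg(1)[OF i, of c a] by (simp add: b_def)
  qed
  ultimately show ?thesis using that fS by (auto simp: S_def)
qed

text \<open>Another representative of the point scales the gradient of a form of degree
  \<open>e\<close> by \<open>c ^ (e - 1)\<close>, so checking one representative is enough.\<close>

lemma cone_tangentI:
  fixes a :: "nat \<Rightarrow> 'a::field"
  assumes "\<And>F. F \<in> hom_ideal d X \<Longrightarrow> differential d F (crd d a) w = 0"
  shows "form_of_coords d w \<in> cone_tangent d X (pt d a)"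
  unfolding cone_tangent_def
proof (intro CollectI conjI ballI form_of_coords_in)
  fix F f assume F: "F \<in> hom_ideal d X" and f: "f \<in> pt d a"
  obtain e where e: "F \<in> hom_polys d e" using F by (auto simp: hom_ideal_def)
  obtain c where c: "f = scale_poly c (form_of d a)" using f by (auto simp: pt_def form_class_def)
  have "form_coords d f = (\<lambda>i. c * crd d a i)"
    unfolding c by (rule ext) (simp add: form_coords_scale form_coords_form_of)
  then have "(\<Sum>i\<le>d. eval_poly (partial_deriv i F) (form_coords d f) * form_coords d (form_of_coords d w) i) =
      (\<Sum>i\<le>d. c ^ (e - 1) * (eval_poly (partial_deriv i F) (crd d a) * w i))"
    by (intro sum.cong) (simp_all add: form_coords_form_of_coords eval_poly_scale[OF partial_deriv_in[OF e]] mult.assoc)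
  also have "\<dots> = 0" using assms[OF F] by (simp flip: sum_distrib_left)
  finally show "(\<Sum>i\<le>d. eval_poly (partial_deriv i F) (form_coords d f) * form_coords d (form_of_coords d w) i) = 0" .
qed

lemma secant_tangent_family:
  fixes a :: "nat \<Rightarrow> 'a::{alg_closed_field,field_char_0}"
  assumes d: "2 * k + 3 \<le> d" and a: "exact_rank d (k + 1) a"
    and \<F>: "\<And>F. F \<in> \<F> \<Longrightarrow> \<exists>e. F \<in> hom_polys d e"
    and van: "\<And>F a. F \<in> \<F> \<Longrightarrow> exact_rank d (d - k) a \<Longrightarrow> eval_poly F (crd d a) = 0"
  shows "\<exists>W. (\<forall>l<2 * k + 4. \<forall>F\<in>\<F>. differential d F (crd d a) (W l) = 0) \<and>
      (\<forall>y. (\<forall>i\<le>d. (\<Sum>l<2 * k + 4. y l * W l i) = 0) \<longrightarrow> (\<forall>l<2 * k + 4. y l = 0))"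
proof -
  let ?M = "2 * k + 4"
  obtain c S e where S: "finite S" "card S = k + 1" "\<And>x. x \<in> S \<Longrightarrow> e x \<noteq> 0"
    and crd: "crd d a = crd d (chart d c (\<lambda>i. \<Sum>x\<in>S. e x * hasse_pt x 0 i))"
    by (rule exact_secant_form[OF _ a]) (use d in auto)
  obtain x0 where x0: "x0 \<in> S" using S(2) by fastforce
  define \<mu> :: "'a \<Rightarrow> nat" where "\<mu> x = (if x = x0 then 4 else 2)" for x
  have "(\<Sum>x\<in>S. \<mu> x) = 4 + (\<Sum>x\<in>S - {x0}. \<mu> x)" using S(1) x0 by (simp add: sum.remove \<mu>_def)
  also have "(\<Sum>x\<in>S - {x0}. \<mu> x) = (\<Sum>x\<in>S - {x0}. 2)" by (intro sum.cong) (auto simp: \<mu>_def)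
  finally have \<mu>: "(\<Sum>x\<in>S. \<mu> x) = ?M" using S x0 by simp
  define \<Lambda> where "\<Lambda> = (SIGMA x:S. {..<\<mu> x})"
  have "finite \<Lambda>" "card \<Lambda> = ?M" using S(1) \<mu> by (simp_all add: \<Lambda>_def)
  then obtain h where h: "bij_betw h {..<?M} \<Lambda>"
    using ex_bij_betw_nat_finite[of \<Lambda>] by (auto simp: atLeast0LessThan)
  have h\<Lambda>: "h l \<in> \<Lambda>" if "l < ?M" for l using h that by (auto simp: bij_betw_def)
  define W where "W l = crd d (chart d c (hasse_pt (fst (h l)) (snd (h l))))" for l
  have "differential d F (crd d a) (W l) = 0" if l: "l < ?M" and F: "F \<in> \<F>" for l F
  proof -
    obtain e' where e': "F \<in> hom_polys d e'" using \<F>[OF F] by blast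
    have "fst (h l) \<in> S" "snd (h l) < 4"
      using h\<Lambda>[OF l] by (auto simp: \<Lambda>_def \<mu>_def split: if_splits)
    then have "tangent d F (chart d c (\<lambda>i. \<Sum>x\<in>S. e x * hasse_pt x 0 i)) (chart d c (hasse_pt (fst (h l)) (snd (h l))))"
      using d by (intro secant_tangents(2)[OF e' van[OF F] S refl]) auto
    then show ?thesis unfolding tangent_def crd W_def .
  qed
  moreover have "y l = 0" if y: "\<forall>i\<le>d. (\<Sum>l<?M. y l * W l i) = 0" and l: "l < ?M" for y l
  proof -
    define cc where "cc x m = y (the_inv_into {..<?M} h (x, m))" for x m
    have inv: "cc (fst (h l)) (snd (h l)) = y l" if "l < ?M" for l
      using h that by (simp add: cc_def bij_betw_def the_inv_into_f_f)
    define B where "B i = (\<Sum>l<?M. y l * hasse_pt (fst (h l)) (snd (h l)) i)" for i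
    have "crd d (chart d c B) i = (\<Sum>l<?M. y l * W l i)" for i
    proof -
      have "chart d c B = (\<lambda>i. \<Sum>l<?M. y l * chart d c (hasse_pt (fst (h l)) (snd (h l))) i)"
        unfolding B_def[abs_def] by (rule ext) (simp only: chart_sum chart_scale)
      then show ?thesis by (simp only: crd_sum crd_scale W_def)
    qed
    then have "\<forall>i\<le>d. crd d (chart d c B) i = 0" using y by simp
    then have tr0: "\<forall>i\<le>d. chart d c B i = 0" unfolding crd_eq_0_iff .
    have B0: "B i = 0" if i: "i \<le> d" for i
    proof -
      have "chart d (- c) (chart d c B) = chart d (- c) (\<lambda>_. 0)" by (rule chart_cong) (use tr0 in simp)
      then show ?thesis using chart_chart_neg(2)[OF i, of c B] by (simp add: chart_def)
    qed
    have "(\<Sum>x\<in>S. \<Sum>m<\<mu> x. cc x m * hasse_pt x m i) = B i" for i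
    proof -
      have "(\<Sum>x\<in>S. \<Sum>m<\<mu> x. cc x m * hasse_pt x m i) = (\<Sum>(x, m)\<in>\<Lambda>. cc x m * hasse_pt x m i)"
        unfolding \<Lambda>_def using S(1) by (intro sum.Sigma) auto
      also have "\<dots> = (\<Sum>z\<in>\<Lambda>. cc (fst z) (snd z) * hasse_pt (fst z) (snd z) i)"
        by (intro sum.cong) auto
      also have "\<dots> = (\<Sum>l<?M. cc (fst (h l)) (snd (h l)) * hasse_pt (fst (h l)) (snd (h l)) i)"
        by (rule sum.reindex_bij_betw[OF h, symmetric])
      also have "\<dots> = B i" unfolding B_def by (intro sum.cong) (simp_all add: inv)
      finally show ?thesis .
    qed
    \<comment> \<open>The total multiplicity \<open>2 * k + 4\<close> must not exceed
      \<open>d + 1\<close>, which is exactly the hypothesis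
      \<open>2 * k + 3 \<le> d\<close>.\<close>
    then have "\<forall>x\<in>S. \<forall>m<\<mu> x. cc x m = 0"
      using B0 S(1) \<mu> d by (intro hasse_pt_independent[of S \<mu> d cc]) simp_all
    moreover have "fst (h l) \<in> S" "snd (h l) < \<mu> (fst (h l))" using h\<Lambda>[OF l] by (auto simp: \<Lambda>_def)
    ultimately show "y l = 0" using inv[OF l] by simp
  qed
  ultimately show ?thesis by (intro exI[of _ W] conjI allI impI ballI)
qed

lemma hom_ideal_closure_rank_locus:
  fixes F :: "'a::{alg_closed_field,field_char_0} mpoly"
  assumes d: "d > 0" and F: "F \<in> hom_ideal d (rank_closure d r)" and a: "exact_rank d r a"
  shows "eval_poly F (crd d a) = 0"
proof -
  obtain e where e: "F \<in> hom_polys d e" using F by (auto simp: hom_ideal_def)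
  have "pt d a \<in> rank_locus d r" unfolding rank_locus_pt[OF d] using a by (intro imageI CollectI)
  moreover have "rank_locus d r \<subseteq> (rank_closure d r :: 'a form_point set)"
    by (intro closure_of_subset) (simp add: topspace_zariski rank_locus_subset)
  ultimately have "pt d a \<in> rank_closure d r" by blast
  then have "vanishes_at d F (pt d a)" using F by (simp add: hom_ideal_def)
  then show ?thesis using vanishes_at_pt[OF e] by simp
qed

lemma closure_rank_locus_subsetI:
  fixes d :: nat
  assumes d: "d > 0"
    and van: "\<And>(F :: 'a mpoly) e a. F \<in> hom_polys d e \<Longrightarrow> (\<And>a. exact_rank d s a \<Longrightarrow> eval_poly F (crd d a) = 0) \<Longrightarrow>
      exact_rank d r a \<Longrightarrow> eval_poly F (crd d a) = 0"
  shows "rank_closure d r \<subseteq>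
    (rank_closure d s :: 'a::{alg_closed_field,field_char_0} form_point set)"
proof
  fix p :: "'a form_point" assume p: "p \<in> rank_closure d r"
  show "p \<in> rank_closure d s"
    unfolding closure_of_zariski[OF rank_locus_subset]
  proof (intro conjI allI ballI impI)
    show "p \<in> proj_forms d"
      using p unfolding closure_of_zariski[OF rank_locus_subset] by (rule conjunct1)
    fix e and F :: "'a mpoly" assume F: "F \<in> hom_polys d e" and s: "\<forall>q\<in>rank_locus d s. vanishes_at d F q"
    have s': "eval_poly F (crd d a) = 0" if "exact_rank d s a" for a
      using s that vanishes_at_pt[OF F] unfolding rank_locus_pt[OF d] by blast
    show "vanishes_at d F p"
    proof (rule closure_of_zariskiD[OF rank_locus_subset p F])
      fix q :: "'a form_point" assume "q \<in> rank_locus d r"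
      then obtain a where "q = pt d a" "exact_rank d r a" unfolding rank_locus_pt[OF d] by (elim imageE CollectE)
      then show "vanishes_at d F q" using van[OF F s'] vanishes_at_pt[OF F] by simp
    qed
  qed
qed

text \<open>The first inclusion is the value at \<open>t = 0\<close> of curves of forms of rank
  \<open>d - k\<close> through a form of rank \<open>k + 1\<close>. In the second,
  \<open>d + 2 - (d - k + 1) = k + 1\<close> bounds the degree of the annihilator; for
  \<open>k = 0\<close> this leaves no room for a double root, in accordance with the empty
  locus.\<close>

lemma closure_rank_locus_chain:
  fixes d k :: nat
  assumes d: "2 * k + 3 \<le> d" and k: "d div 2 + 1 < d - k"
  shows "rank_closure d (k + 1) \<subseteq>
      (rank_closure d (d - k) :: 'a::{alg_closed_field,field_char_0} form_point set)"
    and "rank_closure d (d - k + 1) \<subseteq>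
      (rank_closure d (k + 1) :: 'a::{alg_closed_field,field_char_0} form_point set)"
proof -
  have d0: "d > 0" using d by simp
  show "rank_closure d (k + 1) \<subseteq>
      (rank_closure d (d - k) :: 'a form_point set)"
  proof (rule closure_rank_locus_subsetI[OF d0])
    fix F :: "'a mpoly" and e and a :: "nat \<Rightarrow> 'a"
    assume F: "F \<in> hom_polys d e" "\<And>a. exact_rank d (d - k) a \<Longrightarrow> eval_poly F (crd d a) = 0" "exact_rank d (k + 1) a"
    obtain c S e where S: "finite S" "card S = k + 1" "\<And>x. x \<in> S \<Longrightarrow> e x \<noteq> 0"
      and crd: "crd d a = crd d (chart d c (\<lambda>i. \<Sum>x\<in>S. e x * hasse_pt x 0 i))"
      by (rule exact_secant_form[OF d0 F(3)]) blast
    obtain x where "x \<in> S" using S(2) by fastforce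
    then show "eval_poly F (crd d a) = 0"
      unfolding crd using d by (intro secant_tangents(1)[OF F(1,2) S refl]) auto
  qed
  show "rank_closure d (d - k + 1) \<subseteq>
      (rank_closure d (k + 1) :: 'a form_point set)"
  proof (rule closure_rank_locus_subsetI[OF d0])
    fix F :: "'a mpoly" and e and a :: "nat \<Rightarrow> 'a"
    assume F: "F \<in> hom_polys d e" "\<And>a. exact_rank d (k + 1) a \<Longrightarrow> eval_poly F (crd d a) = 0"
      and a: "exact_rank d (d - k + 1) a"
    have nz: "\<exists>i\<le>d. a i \<noteq> 0" and nodec: "\<And>r'. r' < d - k + 1 \<Longrightarrow> \<not> decomp d r' a"
      using a by (auto simp: exact_rank_def)
    have r: "d div 2 + 1 < d - k + 1" using k by simp
    obtain c y q where c: "q \<noteq> 0" "degree ([:- y, 1:] ^ 2 * q) + (d - k + 1) \<le> d + 2"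
      "annihilates d (chart d (- c) a) ([:- y, 1:] ^ 2 * q)"
      by (rule high_rank_double_root[OF d0 nz r nodec])
    define g where "g = [:- y, 1:] ^ 2 * q"
    have g: "g \<noteq> 0" "degree g \<le> k + 1" using c(1,2) d by (simp_all add: g_def)
    obtain w where "degree (g * w) = k + 1" "lead_coeff (g * w) = 1"
      by (rule monic_multiple[OF g])
    moreover have "annihilates d (chart d (- c) a) (g * w)"
      by (rule annihilates_mult) (use c(3) in \<open>simp add: g_def\<close>)
    ultimately have "eval_poly F (crd d (chart d c (chart d (- c) a))) = 0"
      using d by (intro vanishing_on_annihilated[OF F]) auto
    moreover have "crd d (chart d c (chart d (- c) a)) = crd d a" by (rule crd_cong) (rule chart_chart_neg)
    ultimately show "eval_poly F (crd d a) = 0" by simp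
  qed
qed

lemma closure_secant_subset_singular_locus:
  fixes d k :: nat
  assumes d: "2 * k + 3 \<le> d" and k: "d div 2 + 1 < d - k"
  shows "rank_closure d (k + 1) \<subseteq>
    singular_locus d (rank_closure d (d - k) :: 'a::{alg_closed_field,field_char_0} form_point set)"
proof
  let ?X = "(rank_closure d (d - k) :: 'a form_point set)"
  fix p assume p: "p \<in> (rank_closure d (k + 1) :: 'a form_point set)"
  have d0: "d > 0" using d by simp
  have pX: "p \<in> ?X" using closure_rank_locus_chain(1)[OF d k] p by blast
  have "p \<in> proj_forms d" using p unfolding closure_of_zariski[OF rank_locus_subset] by (rule conjunct1)
  then obtain a where a: "p = pt d a" unfolding proj_forms_pt by (elim imageE)
  \<comment> \<open>The tangent family is constructed only at forms of rank exactly
    \<open>k + 1\<close>; their density in the closure is what the semicontinuity argument asks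
    for.\<close>
  let ?V = "crd d ` {a :: nat \<Rightarrow> 'a. exact_rank d (k + 1) a}"
  obtain J :: "nat set" and w :: "nat \<Rightarrow> nat \<Rightarrow> 'a" where J: "J \<subseteq> {..d}" "2 * k + 4 \<le> card J"
    "\<And>j i. j \<in> J \<Longrightarrow> i \<in> J \<Longrightarrow> w j i = (if i = j then 1 else 0)"
    "\<And>j F. j \<in> J \<Longrightarrow> F \<in> hom_ideal d ?X \<Longrightarrow> differential d F (crd d a) (w j) = 0"
  proof (rule tangent_dimension_semicontinuous[of "hom_ideal d ?X" d ?V "crd d a" "2 * k + 4"])
    show "hom_ideal d ?X \<subseteq> (\<Union>e. hom_polys d e)" by (auto simp: hom_ideal_def)
  next
    fix D :: "'a mpoly" and e assume D: "D \<in> hom_polys d e" "\<And>x. x \<in> ?V \<Longrightarrow> eval_poly D x = 0"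
    have "vanishes_at d D p"
    proof (rule closure_of_zariskiD[OF rank_locus_subset p D(1)])
      fix q :: "'a form_point" assume "q \<in> rank_locus d (k + 1)"
      then obtain b where "q = pt d b" "exact_rank d (k + 1) b" unfolding rank_locus_pt[OF d0] by (elim imageE CollectE)
      then show "vanishes_at d D q" using D(2) vanishes_at_pt[OF D(1)] by simp
    qed
    then show "eval_poly D (crd d a) = 0" unfolding a using vanishes_at_pt[OF D(1)] by simp
  next
    fix x assume "x \<in> ?V"
    then obtain b where b: "x = crd d b" "exact_rank d (k + 1) b" by (elim imageE CollectE)
    show "\<exists>W. (\<forall>l<2 * k + 4. \<forall>F\<in>hom_ideal d ?X. differential d F x (W l) = 0) \<and>
        (\<forall>y. (\<forall>i\<le>d. (\<Sum>l<2 * k + 4. y l * W l i) = 0) \<longrightarrow> (\<forall>l<2 * k + 4. y l = 0))"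
      unfolding b(1)
    proof (rule secant_tangent_family[OF d b(2)])
      show "\<exists>e. F \<in> hom_polys d e" if "F \<in> hom_ideal d ?X" for F using that by (auto simp: hom_ideal_def)
      show "eval_poly F (crd d a) = 0" if "F \<in> hom_ideal d ?X" "exact_rank d (d - k) a" for F a
        by (rule hom_ideal_closure_rank_locus[OF d0 that])
    qed
  qed blast
  have "card J \<le> mpoly.dim (cone_tangent d ?X p)"
  proof (rule card_le_dim[of J _ d "\<lambda>j. form_of_coords d (w j)"])
    show "finite J" using J(1) by (rule finite_subset) simp
    show "cone_tangent d ?X p \<subseteq> binary_forms d" by (auto simp: cone_tangent_def)
    show "form_of_coords d (w j) \<in> cone_tangent d ?X p" if "j \<in> J" for j
      unfolding a by (rule cone_tangentI) (rule J(4)[OF that])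
    show "form_coords d (form_of_coords d (w j)) i = (if i = j then 1 else 0)" if "i \<in> J" "j \<in> J" for i j
      using J(1,3) that by (auto simp: form_coords_form_of_coords)
  qed
  then have dim: "2 * k + 4 \<le> mpoly.dim (cone_tangent d ?X p)" using J(2) by simp
  \<comment> \<open>Both sides of the singularity criterion are those of the cone: at most
    \<open>2 * k + 3\<close> for the dimension against at least \<open>2 * k + 4\<close> for the
    tangent space.\<close>
  have "local_dim (zariski d) ?X p + 1 \<le> enat (2 * k + 2) + 1"
    by (intro add_right_mono local_dim_closure_rank_locus) (use d k in auto)
  also have "\<dots> = enat (2 * k + 3)" by (simp add: one_enat_def)
  also have "\<dots> < enat (mpoly.dim (cone_tangent d ?X p))" using dim by simp
  finally show "p \<in> singular_locus d ?X" unfolding singular_locus_def using pX by simp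
qed

theorem theorem3:
  fixes d k :: nat
  assumes "d > 0"
    and "int d - int k > \<lceil>(real d + 1) / 2\<rceil>"
  shows "zariski d closure_of (rank_locus d (k + 1)) \<union> zariski d closure_of (rank_locus d (d - k + 1))
           \<subseteq> singular_locus d
               (zariski d closure_of
                 (rank_locus d (d - k) :: 'a::{alg_closed_field, field_char_0} form_point set))"
proof -
  \<comment> \<open>Valid for both parities of \<open>d\<close>; the value is the bound on the least
    degree of an annihilator, so the ranks considered lie strictly above it.\<close>
  have "\<lceil>(real d + 1) / 2\<rceil> = int (d div 2 + 1)"
  proof (rule ceiling_unique)
    have "real d = 2 * real (d div 2) + real (d mod 2)"
      by (metis mult_div_mod_eq of_nat_add of_nat_mult of_nat_numeral)
    moreover have "real (d mod 2) \<le> 1" "0 \<le> real (d mod 2)" by (simp_all add: mod2_eq_if)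
    ultimately show "real_of_int (int (d div 2 + 1)) - 1 < (real d + 1) / 2"
      "(real d + 1) / 2 \<le> real_of_int (int (d div 2 + 1))" by simp_all
  qed
  then have "int d - int k > int (d div 2 + 1)" using assms(2) by simp
  then have k: "d div 2 + 1 < d - k" and d: "2 * k + 3 \<le> d" by presburger+
  show ?thesis
    using closure_secant_subset_singular_locus[OF d k, where 'a = 'a]
      closure_rank_locus_chain(2)[OF d k, where 'a = 'a] by blast
qed

end
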